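(* Let $M\ge1$, $R_1,\dots,R_M\in\mathbb{R}^3$ and $d>0$ be fixed. Consider a sequence of data $(N,\underline{Z})$, $N\in\mathbb{N}$, $\underline{Z}=(Z_1,\dots,Z_M)$ with all $Z_\alpha>0$, such that $$N\to\infty,\quad Z=\sum_{\alpha=1}^M Z_\alpha\to\infty,\quad \frac{N}{Z}\to\lambda\in(0,\infty),\quad \frac{Z_\alpha}{Z}\to z_\alpha\ (\alpha=1,\dots,M),$$ and let $\underline{z}=(z_1,\dots,z_M)$. Let $\{(x_1^{(N,\underline{Z})},\dots,x_N^{(N,\underline{Z})})\}$ be any sequence of approximate minimizers of $V_{N,\underline{Z}}$ (see context) in this limit. Then the associated measures $$\mu^{(N,\underline{Z})}:=\frac1Z\sum_{i=1}^N\delta_{x_i^{(N,\underline{Z})}}$$ satisfy $$\mu^{(N,\underline{Z})}\rightharpoonup^*\mu_\lambda\quad\text{in }\mathcal{M}(\mathbb{R}^3\setminus\Omega),$$ and $$\frac{V_{N,\underline{Z}}(x_1^{(N,\underline{Z})},\dots,x_N^{(N,\underline{Z})})}{Z^2}\longrightarrow I_{\lambda,\underline{z}}(\mu_\lambda),$$ where $I_{\lambda,\underline{z}}:\mathcal{M}_+(\mathbb{R}^3\setminus\Omega)\to\mathbb{R}\cup\{+\infty\}$ is the functional $$I_{\lambda,\underline{z}}(\mu):=-\int_{\mathbb{R}^3\setminus\Omega}\sum_{\alpha=1}^M\frac{z_\alpha}{|x-R_\alpha|}\,d\mu(x)+\frac12\iint_{(\mathbb{R}^3\setminus\Omega)^2}\frac{1}{|x-y|}\,d\mu(x)\,d\mu(y)\quad\text{if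 }\int d\mu\le\lambda,$$ $I_{\lambda,\underline{z}}(\mu):=+\infty$ otherwise, and $\mu_\lambda$ is its unique minimizer.
   Context: For $\underline{Z}=(Z_1,\dots,Z_M)$ with $Z_\alpha>0$, define $$V_{N,\underline{Z}}(x_1,\dots,x_N):=\sum_{i=1}^N v(x_i)+\sum_{1\le i<j\le N}\frac{1}{|x_i-x_j|},\qquad v(x)=\sum_{\alpha=1}^M\frac{-Z_\alpha}{|x-R_\alpha|},$$ with the convention $1/0=+\infty$ (also in the integrand $1/|x-y|$), on the admissible set $$\mathcal{A}_N:=\{(x_1,\dots,x_N)\in\mathbb{R}^{3N} : |x_i-R_\alpha|\ge d\text{ for all } i,\alpha\}.$$ A sequence of configurations $(x_1^{(N,\underline{Z})},\dots,x_N^{(N,\underline{Z})})\in\mathcal{A}_N$ is called a sequence of approximate minimizers of $V_{N,\underline{Z}}$ in the given limit if $$\frac{V_{N,\underline{Z}}(x_1^{(N,\underline{Z})},\dots,x_N^{(N,\underline{Z})})-\inf_{\mathcal{A}_N}V_{N,\underline{Z}}}{Z^2}\longrightarrow0.$$ $\Omega=\bigcup_{\alpha=1}^M B_d(R_\alpha)$ with $B_d(R_\alpha)=\{x\in\mathbb{R}^3:|x-R_\alpha|<d\}$. For a closed set $A\subseteq\mathbb{R}^3$, $\mathcal{M}(A)$ is the space of (finite, signed) Radon measures on $A$, i.e. the dual of $C_0(A)=\{f:A\to\mathbb{R}\text{ continuous},\ f(x)\to0\text{ as }|x|\to\infty\}$; $\mathcal{M}_+(A)=\{\mu\in\mathcal{M}(A):\mu\ge0\}$;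 and $\mu_\nu\rightharpoonup^*\mu$ means $\int_A f\,d\mu_\nu\to\int_A f\,d\mu$ for all $f\in C_0(A)$. *)

theory Defs
  imports "HOL-Analysis.Analysis"
begin

definition total_charge :: "nat \<Rightarrow> (nat \<Rightarrow> real) \<Rightarrow> real" where
  "total_charge M Z = (\<Sum>\<alpha>=1..M. Z \<alpha>)"

definition nuclear_potential ::
  "nat \<Rightarrow> (nat \<Rightarrow> real^3) \<Rightarrow> (nat \<Rightarrow> real) \<Rightarrow> real^3 \<Rightarrow> real" where
  "nuclear_potential M R Z x = (\<Sum>\<alpha>=1..M. - Z \<alpha> / norm (x - R \<alpha>))"

(* A configuration of N points is a function nat => real^3 of which only the values at 1..N matter.
   Division in ereal satisfies 1 / 0 = \<infinity>, as required for coinciding points.  The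
   real-valued nuclear potential agrees with the extended one on the admissible set, which keeps a
   distance d > 0 from the nuclei. *)
definition V ::
  "nat \<Rightarrow> (nat \<Rightarrow> real^3) \<Rightarrow> nat \<Rightarrow> (nat \<Rightarrow> real) \<Rightarrow> (nat \<Rightarrow> real^3) \<Rightarrow> ereal" where
  "V M R N Z x =
     ereal (\<Sum>i=1..N. nuclear_potential M R Z (x i))
     + (\<Sum>i=1..N. \<Sum>j=i+1..N. 1 / ereal (norm (x i - x j)))"

definition admissible ::
  "nat \<Rightarrow> (nat \<Rightarrow> real^3) \<Rightarrow> real \<Rightarrow> nat \<Rightarrow> (nat \<Rightarrow> real^3) set" where
  "admissible M R d N = {x. \<forall>i\<in>{1..N}. \<forall>\<alpha>\<in>{1..M}. norm (x i - R \<alpha>) \<ge> d}"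

definition approximate_minimizers ::
  "nat \<Rightarrow> (nat \<Rightarrow> real^3) \<Rightarrow> real \<Rightarrow> (nat \<Rightarrow> nat) \<Rightarrow> (nat \<Rightarrow> nat \<Rightarrow> real)
     \<Rightarrow> (nat \<Rightarrow> nat \<Rightarrow> real^3) \<Rightarrow> bool" where
  "approximate_minimizers M R d N Z x \<longleftrightarrow>
     (\<forall>k. x k \<in> admissible M R d (N k)) \<and>
     ((\<lambda>k. (V M R (N k) (Z k) (x k) - (INF y\<in>admissible M R d (N k). V M R (N k) (Z k) y))
             / ereal ((total_charge M (Z k))\<^sup>2)) \<longlonglongrightarrow> 0)"

definition Omega :: "nat \<Rightarrow> (nat \<Rightarrow> real^3) \<Rightarrow> real \<Rightarrow> (real^3) set" where
  "Omega M R d = (\<Union>\<alpha>\<in>{1..M}. ball (R \<alpha>) d)"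

(* Nonnegative finite Radon measures on a closed set A of a Euclidean space: there, every finite
   Borel measure is Radon. *)
definition M_plus :: "(real^3) set \<Rightarrow> (real^3) measure set" where
  "M_plus A = {\<mu>. sets \<mu> = sets (restrict_space borel A) \<and> finite_measure \<mu>}"

definition C0 :: "(real^3) set \<Rightarrow> (real^3 \<Rightarrow> real) set" where
  "C0 A = {f. continuous_on A f \<and> (f \<longlongrightarrow> 0) (inf at_infinity (principal A))}"

(* Weak-star convergence in the dual of C0 A, for sequences and limits in M_plus A. *)
definition weak_star_conv ::
  "(real^3) set \<Rightarrow> (nat \<Rightarrow> (real^3) measure) \<Rightarrow> (real^3) measure \<Rightarrow> bool" where
  "weak_star_conv A \<mu>s \<mu> \<longleftrightarrow>
     (\<forall>f\<in>C0 A. (\<lambda>k. \<integral>y. f y \<partial>(\<mu>s k)) \<longlonglongrightarrow> (\<integral>y. f y \<partial>\<mu>))"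

(* The sum of the Dirac measures at x 1, ..., x N is the image under x of the counting measure
   on {1..N}, so multiplicities are counted; c is the weight of each point.  The points are meant
   to lie in A. *)
definition point_masses ::
  "(real^3) set \<Rightarrow> real \<Rightarrow> nat \<Rightarrow> (nat \<Rightarrow> real^3) \<Rightarrow> (real^3) measure" where
  "point_masses A c N x =
     scale_measure (ennreal c) (distr (count_space {1..N}) (restrict_space borel A) x)"

lemma emeasure_point_masses:
  assumes "\<And>i. i \<in> {1..N} \<Longrightarrow> x i \<in> A" "B \<in> sets (restrict_space borel A)"
  shows "emeasure (point_masses A c N x) B = ennreal c * (\<Sum>i=1..N. indicator B (x i))"
proof -
  have m: "x \<in> measurable (count_space {1..N}) (restrict_space borel A)"
    using assms(1) by (auto simp: space_restrict_space)
  have "emeasure (distr (count_space {1..N}) (restrict_space borel A) x) B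
      = of_nat (card {i\<in>{1..N}. x i \<in> B})"
  proof -
    have e: "x -` B \<inter> {1..N} = {i\<in>{1..N}. x i \<in> B}" by auto
    show ?thesis
      using m assms(2) by (simp only: emeasure_distr space_count_space e)
        (subst emeasure_count_space_finite, auto)
  qed
  also have "\<dots> = (\<Sum>i=1..N. indicator B (x i))"
    by (simp add: indicator_def sum.If_cases Int_def)
  finally show ?thesis
    by (simp add: point_masses_def)
qed

(* In ennreal, 1 / 0 = \<infinity>, so an atom has infinite self-energy. *)
definition energy ::
  "nat \<Rightarrow> (nat \<Rightarrow> real^3) \<Rightarrow> real \<Rightarrow> (nat \<Rightarrow> real) \<Rightarrow> (real^3) measure \<Rightarrow> ereal" where
  "energy M R lam z \<mu> =
     (if measure \<mu> (space \<mu>) \<le> lam then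
        ereal (- (\<integral>x. (\<Sum>\<alpha>=1..M. z \<alpha> / norm (x - R \<alpha>)) \<partial>\<mu>))
        + ereal (1/2) * enn2ereal (\<integral>\<^sup>+x. \<integral>\<^sup>+y. 1 / ennreal (norm (x - y)) \<partial>\<mu> \<partial>\<mu>)
      else \<infinity>)"

lemma coinciding_points_conventions:
  "1 / ereal (norm (x - x :: real^3)) = \<infinity>" "1 / ennreal (norm (x - x :: real^3)) = \<infinity>"
  by (simp_all add: zero_ereal_def[symmetric] divide_ennreal_def)

end

theory Submission
  imports Defs "HOL-Probability.Helly_Selection" "HOL-Probability.Distributions"
begin

text \<open>
  With \<open>\<mu>\<^sub>k\<close> the rescaled empirical measures, \<open>V / Z\<^sup>2\<close> is the functional evaluated at \<open>\<mu>\<^sub>k\<close>, up to the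
  infinite self-energy of the atoms. Everything about the Coulomb interaction follows from writing
  the kernel as a superposition of squares,
  \<open>1 / |x - y| = c \<integral> s\<^sup>3 g\<^sub>s(x - w) g\<^sub>s(y - w) dw ds\<close> with \<open>g\<^sub>s(u) = exp (- 2 s\<^sup>2 |u|\<^sup>2)\<close> and \<open>s > 0\<close>:
  \<^item> the interaction of \<open>\<mu>\<close> is an integral of \<open>(\<integral> g\<^sub>s(x - w) d\<mu>(x))\<^sup>2\<close>, so Fatou's lemma makes it lower
    semicontinuous; cutting off \<open>s < S\<close> bounds the kernel by a multiple of \<open>S\<close>, so the diagonal costs
    only \<open>O(S N / Z\<^sup>2)\<close>;
  \<^item> by the parallelogram identity, equality in the midpoint convexity inequality forces the Gaussian
    transforms of two measures to agree, hence the measures to agree.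

  For the upper bound, points drawn independently from a competitor \<open>\<nu>\<close> have the right expected
  energy, and superfluous points can be moved to infinity at no cost. Compactness of the empirical
  measures is transported from Helly's theorem on the line along a space-filling curve. Any limit
  point of the given sequence is therefore a minimizer, which also gives existence.
\<close>

section \<open>The Coulomb kernel as a superposition of Gaussian squares\<close>

text \<open>Two difficulties shape the argument. The Coulomb kernel is unbounded, so weak-star
  convergence says nothing directly about the repulsion. Gaussian bumps separate the two variables,
  enter with nonnegative weights and are themselves test functions in \<open>C0\<close>. The formula
  comes from writing \<open>1 / a\<close> as \<open>2 / sqrt pi\<close> times the integral of
  \<open>exp (- (s * a)^2)\<close> over \<open>s > 0\<close>, and from a Gaussian in
  \<open>x - y\<close> being, up to a constant, a convolution of two narrower ones.

  The other difficulty is that mass may escape to infinity. Hence the limit problem bounds the total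
  mass by \<open>lam\<close> instead of prescribing it, and a competitor of smaller mass is matched
  by fewer sampled points. The attraction causes no trouble in either respect: away from the balls
  around the nuclei it is continuous, and it vanishes at infinity, so it passes to weak-star limits.
  Uniqueness of the minimizer finally turns statements about subsequences into statements about the
  whole sequence.\<close>

definition gauss_bump :: "real \<times> (real^3) \<Rightarrow> real^3 \<Rightarrow> real" where
  "gauss_bump \<tau> x = exp (- 2 * (fst \<tau>)\<^sup>2 * (norm (x - snd \<tau>))\<^sup>2)"

text \<open>
  The constant makes the integral over \<open>w\<close> of the product of two bumps, weighted, equal to
  \<open>2 / sqrt pi * exp (- (s * norm (x - y))\<^sup>2)\<close>, whose integral over \<open>s > 0\<close> is \<open>1 / norm (x - y)\<close>.
\<close>
definition gauss_weight :: "real set \<Rightarrow> real \<times> (real^3) \<Rightarrow> ennreal" where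
  "gauss_weight B \<tau> = indicator B (fst \<tau>) * ennreal (16 / pi\<^sup>2 * (fst \<tau>) ^ 3)"

text \<open>\<open>B\<close> selects the scales \<open>s\<close>: \<open>{0<..}\<close> yields the
  whole Coulomb kernel, while \<open>{0<..<S}\<close> yields a bounded kernel below it. Values in
  \<open>ennreal\<close> cover the diagonal as well.\<close>

definition coulomb_part :: "real set \<Rightarrow> real^3 \<Rightarrow> real^3 \<Rightarrow> ennreal" where
  "coulomb_part B x y = (\<integral>\<^sup>+\<tau>. gauss_weight B \<tau> * ennreal (gauss_bump \<tau> x * gauss_bump \<tau> y) \<partial>lborel)"

lemma gauss_bump_pos: "gauss_bump \<tau> x > 0"
  by (simp add: gauss_bump_def)

lemma gauss_bump_le_1: "gauss_bump \<tau> x \<le> 1"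
  by (simp add: gauss_bump_def)

lemma measurable_gauss_bump [measurable]:
  "(\<lambda>p. gauss_bump (fst p) (snd p)) \<in> borel_measurable borel"
  unfolding gauss_bump_def by (intro borel_measurable_continuous_onI continuous_intros)

lemma measurable_gauss_bump_compose [measurable (raw)]:
  assumes [measurable]: "f \<in> borel_measurable M" "g \<in> borel_measurable M"
  shows "(\<lambda>z. gauss_bump (f z) (g z)) \<in> borel_measurable M"
proof -
  have "(\<lambda>z. (f z, g z)) \<in> M \<rightarrow>\<^sub>M borel"
    by (intro borel_measurable_Pair assms)
  from measurable_compose[OF this measurable_gauss_bump] show ?thesis by simp
qed

lemma measurable_gauss_weight [measurable]:
  assumes [measurable]: "B \<in> sets borel"
  shows "gauss_weight B \<in> borel_measurable borel"
  unfolding gauss_weight_def borel_prod[symmetric] by measurable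

lemma nn_integral_gauss_real:
  assumes "s > 0"
  shows "(\<integral>\<^sup>+t. ennreal (exp (- (s * t)\<^sup>2)) \<partial>lborel) = ennreal (sqrt pi / s)"
proof -
  have "has_bochner_integral lborel (\<lambda>x::real. exp (- x\<^sup>2)) (2 * (sqrt pi / 2))"
    using has_bochner_integral_even_function[OF gaussian_moment_0] by simp
  then have e: "(\<integral>\<^sup>+t. ennreal (exp (- t\<^sup>2)) \<partial>lborel) = ennreal (sqrt pi)"
    by (auto simp: has_bochner_integral_iff nn_integral_eq_integral)
  have "ennreal (sqrt pi) = ennreal s * (\<integral>\<^sup>+t. ennreal (exp (- (s * t)\<^sup>2)) \<partial>lborel)"
    unfolding e[symmetric] using assms
    by (subst nn_integral_real_affine[where c=s and t=0]) auto
  then have "ennreal (1/s) * ennreal (sqrt pi)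
      = ennreal (1/s) * ennreal s * (\<integral>\<^sup>+t. ennreal (exp (- (s * t)\<^sup>2)) \<partial>lborel)"
    by (simp add: mult.assoc)
  also have "ennreal (1/s) * ennreal s = 1"
    using assms by (simp add: ennreal_mult'[symmetric])
  finally show ?thesis using assms by (simp add: ennreal_mult'[symmetric])
qed

lemma nn_integral_gauss_real3:
  assumes "s > 0"
  shows "(\<integral>\<^sup>+w. ennreal (exp (- 4 * s\<^sup>2 * (norm (w::real^3))\<^sup>2)) \<partial>lborel) = ennreal ((sqrt pi / (2 * s)) ^ 3)"
proof -
  have n: "(norm (w::real^3))\<^sup>2 = (\<Sum>b\<in>Basis. (w \<bullet> b)\<^sup>2)" for w
    unfolding power2_norm_eq_inner euclidean_inner[of w w] by (simp add: power2_eq_square)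
  have "(\<integral>\<^sup>+w. ennreal (exp (- 4 * s\<^sup>2 * (norm (w::real^3))\<^sup>2)) \<partial>lborel)
     = (\<integral>\<^sup>+w. ennreal (\<Prod>b\<in>(Basis::(real^3) set). exp (- (2 * s * (w \<bullet> b))\<^sup>2)) \<partial>lborel)"
    by (simp add: n sum_distrib_left exp_sum[symmetric] sum_negf[symmetric] power_mult_distrib)
  also have "\<dots> = (\<integral>\<^sup>+w. (\<Prod>b\<in>(Basis::(real^3) set). ennreal (exp (- (2 * s * (w \<bullet> b))\<^sup>2))) \<partial>lborel)"
    by (simp add: prod_ennreal)
  also have "\<dots> = (\<Prod>b\<in>(Basis::(real^3) set). (\<integral>\<^sup>+t. ennreal (exp (- (2 * s * t)\<^sup>2)) \<partial>lborel))"
    by (rule nn_integral_lborel_prod) auto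
  also have "\<dots> = ennreal ((sqrt pi / (2 * s)) ^ 3)"
    using assms by (subst nn_integral_gauss_real) (auto simp: ennreal_power)
  finally show ?thesis .
qed

text \<open>Completing the square about the midpoint of \<open>x\<close> and \<open>y\<close> splits
  the exponent into a part depending on \<open>x - y\<close> alone and a centred Gaussian in
  \<open>w\<close>, which translation invariance lets one integrate.\<close>

lemma nn_integral_gauss_bump_product:
  assumes "s > 0"
  shows "(\<integral>\<^sup>+w. ennreal (gauss_bump (s, w) x * gauss_bump (s, w) y) \<partial>lborel)
     = ennreal (exp (- (s * norm (x - y))\<^sup>2) * (sqrt pi / (2 * s)) ^ 3)"
proof -
  define m where "m = (1/2) *\<^sub>R (x + y)"
  have key: "2 * (norm (x - w))\<^sup>2 + 2 * (norm (y - w))\<^sup>2 = (norm (x - y))\<^sup>2 + 4 * (norm (w - m))\<^sup>2" for w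
    unfolding m_def power2_norm_eq_inner
    by (simp add: inner_diff_left inner_diff_right inner_add_left inner_add_right
      inner_commute algebra_simps)
  have eq: "gauss_bump (s, w) x * gauss_bump (s, w) y
      = exp (- (s * norm (x - y))\<^sup>2) * exp (- 4 * s\<^sup>2 * (norm (- m + w))\<^sup>2)" for w
  proof -
    have "- 2 * s\<^sup>2 * (norm (x - w))\<^sup>2 + - 2 * s\<^sup>2 * (norm (y - w))\<^sup>2
       = - (s\<^sup>2 * (2 * (norm (x - w))\<^sup>2 + 2 * (norm (y - w))\<^sup>2))" by (simp add: algebra_simps)
    also have "\<dots> = - (s * norm (x - y))\<^sup>2 + - 4 * s\<^sup>2 * (norm (- m + w))\<^sup>2"
      unfolding key by (simp add: algebra_simps power_mult_distrib)
    finally show ?thesis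
      by (simp add: gauss_bump_def exp_add[symmetric])
  qed
  have "(\<integral>\<^sup>+w. ennreal (exp (- 4 * s\<^sup>2 * (norm (- m + w))\<^sup>2)) \<partial>lborel)
     = (\<integral>\<^sup>+w. ennreal (exp (- 4 * s\<^sup>2 * (norm w)\<^sup>2)) \<partial>distr lborel borel ((+) (- m)))"
    by (subst nn_integral_distr) auto
  also have "\<dots> = ennreal ((sqrt pi / (2 * s)) ^ 3)"
    unfolding lborel_distr_plus nn_integral_gauss_real3[OF assms] ..
  finally have "(\<integral>\<^sup>+w. ennreal (exp (- 4 * s\<^sup>2 * (norm (- m + w))\<^sup>2)) \<partial>lborel)
     = ennreal ((sqrt pi / (2 * s)) ^ 3)" .
  then show ?thesis
    unfolding eq using assms by (simp add: ennreal_mult nn_integral_cmult)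
qed

text \<open>The centre \<open>w\<close> is integrated out first. In three dimensions a Gaussian of
  width \<open>1 / s\<close> has mass of order \<open>1 / s ^ 3\<close>, which the factor
  \<open>s ^ 3\<close> of the weight cancels; the constant of the weight then leaves
  \<open>2 / sqrt pi\<close>.\<close>

lemma coulomb_part_eq:
  assumes [measurable]: "B \<in> sets borel" and B: "B \<subseteq> {0<..}"
  shows "coulomb_part B x y = (\<integral>\<^sup>+s. indicator B s * ennreal (2 / sqrt pi * exp (- (s * norm (x - y))\<^sup>2)) \<partial>lborel)"
proof -
  have [measurable]: "(\<lambda>\<tau>. gauss_weight B \<tau> * ennreal (gauss_bump \<tau> x * gauss_bump \<tau> y))
      \<in> borel_measurable (lborel \<Otimes>\<^sub>M lborel)"
    unfolding lborel_prod by measurable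
  have "coulomb_part B x y = (\<integral>\<^sup>+s. \<integral>\<^sup>+w. gauss_weight B (s, w) * ennreal (gauss_bump (s, w) x * gauss_bump (s, w) y) \<partial>lborel \<partial>lborel)"
    unfolding coulomb_part_def lborel_prod[symmetric]
    by (subst lborel.nn_integral_fst[symmetric]) auto
  also have "\<dots> = (\<integral>\<^sup>+s. indicator B s * ennreal (2 / sqrt pi * exp (- (s * norm (x - y))\<^sup>2)) \<partial>lborel)"
  proof (rule nn_integral_cong)
    fix s :: real
    show "(\<integral>\<^sup>+w. gauss_weight B (s, w) * ennreal (gauss_bump (s, w) x * gauss_bump (s, w) y) \<partial>lborel)
      = indicator B s * ennreal (2 / sqrt pi * exp (- (s * norm (x - y))\<^sup>2))"
    proof (cases "s \<in> B")
      case True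
      then have s: "s > 0" using B by auto
      have "sqrt pi ^ 3 = pi * sqrt pi" by (simp add: power3_eq_cube)
      moreover have "pi\<^sup>2 = (pi * sqrt pi) * sqrt pi" by (simp add: power2_eq_square)
      ultimately have c: "16 / pi\<^sup>2 * s ^ 3 * (sqrt pi / (2 * s)) ^ 3 = 2 / sqrt pi"
        using s by (simp add: power_divide power_mult_distrib field_simps)
      have "(\<integral>\<^sup>+w. gauss_weight B (s, w) * ennreal (gauss_bump (s, w) x * gauss_bump (s, w) y) \<partial>lborel)
         = ennreal (16 / pi\<^sup>2 * s ^ 3) * ennreal (exp (- (s * norm (x - y))\<^sup>2) * (sqrt pi / (2 * s)) ^ 3)"
        using True by (simp add: gauss_weight_def nn_integral_cmult nn_integral_gauss_bump_product[OF s])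
      also have "\<dots> = ennreal (16 / pi\<^sup>2 * s ^ 3 * (sqrt pi / (2 * s)) ^ 3 * exp (- (s * norm (x - y))\<^sup>2))"
        using s by (simp add: ennreal_mult'[symmetric] algebra_simps)
      finally show ?thesis unfolding c using True by simp
    qed (simp add: gauss_weight_def)
  qed
  finally show ?thesis .
qed

text \<open>For distinct points this is the half-line Gaussian integral rescaled by the distance.
  For coinciding points the integrand is constant in \<open>s\<close> on a half-line, so the
  integral is infinite, in agreement with \<open>1 / 0\<close>.\<close>

lemma coulomb_part_UNIV: "coulomb_part {0<..} x y = 1 / ennreal (norm (x - y))"
proof -
  define a where "a = norm (x - y)"
  have c: "coulomb_part {0<..} x y = (\<integral>\<^sup>+s. indicator {0<..} s * ennreal (2 / sqrt pi * exp (- (s * a)\<^sup>2)) \<partial>lborel)"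
    unfolding a_def by (rule coulomb_part_eq) auto
  show ?thesis
  proof (cases "a = 0")
    case True
    have "of_nat n \<le> emeasure lborel {0::real<..}" for n
    proof -
      have "of_nat n = emeasure lborel {0<..<real n}" by (simp add: ennreal_of_nat_eq_real_of_nat)
      also have "\<dots> \<le> emeasure lborel {0::real<..}" by (intro emeasure_mono) auto
      finally show ?thesis .
    qed
    then have "emeasure lborel {0::real<..} = top"
      using SUP_least[of UNIV of_nat "emeasure lborel {0::real<..}"]
      by (simp add: ennreal_SUP_of_nat_eq_top top_unique)
    then have "(\<integral>\<^sup>+s. indicator {0::real<..} s * ennreal (2 / sqrt pi) \<partial>lborel) = \<infinity>"
      unfolding mult.commute[of "indicator _ _"]
      by (subst nn_integral_cmult_indicator) (auto simp: ennreal_mult_top)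
    then show ?thesis using True c unfolding a_def by (simp add: divide_ennreal_def)
  next
    case False
    then have a: "a > 0" unfolding a_def by simp
    have "has_bochner_integral lborel (\<lambda>x. indicator {0..} x *\<^sub>R exp (- x\<^sup>2)) (sqrt pi / 2)"
      by (rule gaussian_moment_0)
    then have "(\<integral>\<^sup>+s. ennreal (indicator {0..} s * exp (- s\<^sup>2)) \<partial>lborel) = ennreal (sqrt pi / 2)"
      by (auto simp: has_bochner_integral_iff nn_integral_eq_integral)
    then have "ennreal (sqrt pi / 2) = ennreal a * (\<integral>\<^sup>+s. ennreal (indicator {0..} (a * s) * exp (- (a * s)\<^sup>2)) \<partial>lborel)"
      using a by (subst (asm) nn_integral_real_affine[where c=a and t=0]) auto
    also have "(\<integral>\<^sup>+s. ennreal (indicator {0..} (a * s) * exp (- (a * s)\<^sup>2)) \<partial>lborel)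
       = (\<integral>\<^sup>+s. indicator {0<..} s * ennreal (exp (- (s * a)\<^sup>2)) \<partial>lborel)"
      using a by (intro nn_integral_cong_AE eventually_mono[OF AE_lborel_singleton[of 0]])
         (auto simp: indicator_def zero_le_mult_iff mult.commute)
    finally have *: "ennreal (sqrt pi / 2) = ennreal a * (\<integral>\<^sup>+s. indicator {0<..} s * ennreal (exp (- (s * a)\<^sup>2)) \<partial>lborel)" .
    have "coulomb_part {0<..} x y = ennreal (2 / sqrt pi) * (\<integral>\<^sup>+s. indicator {0<..} s * ennreal (exp (- (s * a)\<^sup>2)) \<partial>lborel)"
      unfolding c by (subst nn_integral_cmult[symmetric])
        (auto simp: ennreal_mult'[symmetric] mult.left_commute)
    also have "\<dots> = ennreal (1 / a) * ennreal (2 / sqrt pi) * (ennreal a * (\<integral>\<^sup>+s. indicator {0<..} s * ennreal (exp (- (s * a)\<^sup>2)) \<partial>lborel))"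
    proof -
      have "ennreal (1 / a) * ennreal a = 1" using a by (simp add: ennreal_mult'[symmetric])
      then show ?thesis by (metis (no_types, lifting) mult.assoc mult.commute mult.left_neutral)
    qed
    also have "\<dots> = ennreal (1 / a)"
      unfolding *[symmetric] using a by (simp add: ennreal_mult'[symmetric])
    also have "\<dots> = 1 / ennreal a"
      using a divide_ennreal[of 1 a] by simp
    finally show ?thesis unfolding a_def .
  qed
qed

text \<open>The Gaussian is at most 1, which leaves the length of the interval of scales. The bound
  holds on the diagonal too, and that is where it matters.\<close>

lemma coulomb_part_bounded:
  assumes "S > 0"
  shows "coulomb_part {0<..<S} x y \<le> ennreal (2 * S / sqrt pi)"
proof -
  have "coulomb_part {0<..<S} x y \<le> (\<integral>\<^sup>+s. ennreal (2 / sqrt pi) * indicator {0<..<S} s \<partial>lborel)"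
    by (subst coulomb_part_eq) (auto intro!: nn_integral_mono simp: indicator_def ennreal_leI divide_le_cancel)
  also have "\<dots> = ennreal (2 / sqrt pi) * ennreal S"
    using assms by (subst nn_integral_cmult_indicator) auto
  also have "\<dots> = ennreal (2 * S / sqrt pi)"
    using assms by (simp add: ennreal_mult'[symmetric])
  finally show ?thesis .
qed

lemma gauss_weight_mono: "B \<subseteq> C \<Longrightarrow> gauss_weight B \<tau> \<le> gauss_weight C \<tau>"
  by (auto simp: gauss_weight_def indicator_def)

lemma coulomb_part_le:
  assumes "S > 0"
  shows "coulomb_part {0<..<S} x y \<le> 1 / ennreal (norm (x - y))"
  unfolding coulomb_part_UNIV[symmetric] coulomb_part_def
  by (intro nn_integral_mono mult_right_mono gauss_weight_mono) auto

text \<open>Tonelli moves the integral over scales and centres outside; there the product form of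
  the integrand separates the two measures.\<close>

lemma nn_integral_coulomb_part:
  assumes [measurable]: "B \<in> sets borel"
    and "sigma_finite_measure \<mu>" and [measurable_cong]: "sets \<mu> = sets borel"
    and "sigma_finite_measure \<nu>" and [measurable_cong]: "sets \<nu> = sets borel"
  shows "(\<integral>\<^sup>+x. \<integral>\<^sup>+y. coulomb_part B x y \<partial>\<nu> \<partial>\<mu>)
    = (\<integral>\<^sup>+\<tau>. gauss_weight B \<tau> * ((\<integral>\<^sup>+x. ennreal (gauss_bump \<tau> x) \<partial>\<mu>) * (\<integral>\<^sup>+x. ennreal (gauss_bump \<tau> x) \<partial>\<nu>)) \<partial>lborel)"
proof -
  interpret M: sigma_finite_measure \<mu> by fact
  interpret N: sigma_finite_measure \<nu> by fact
  interpret L: pair_sigma_finite "lborel :: (real \<times> (real^3)) measure" \<mu> by standard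
  interpret L': pair_sigma_finite "lborel :: (real \<times> (real^3)) measure" \<nu> by standard
  have "(\<integral>\<^sup>+x. \<integral>\<^sup>+y. coulomb_part B x y \<partial>\<nu> \<partial>\<mu>)
    = (\<integral>\<^sup>+x. \<integral>\<^sup>+\<tau>. (\<integral>\<^sup>+y. gauss_weight B \<tau> * ennreal (gauss_bump \<tau> x * gauss_bump \<tau> y) \<partial>\<nu>) \<partial>lborel \<partial>\<mu>)"
    unfolding coulomb_part_def by (intro nn_integral_cong L'.Fubini') measurable
  also have "\<dots> = (\<integral>\<^sup>+x. \<integral>\<^sup>+\<tau>. (gauss_weight B \<tau> * ennreal (gauss_bump \<tau> x)) * (\<integral>\<^sup>+y. ennreal (gauss_bump \<tau> y) \<partial>\<nu>) \<partial>lborel \<partial>\<mu>)"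
    by (subst nn_integral_cmult[symmetric])
      (auto simp: ennreal_mult[OF less_imp_le[OF gauss_bump_pos] less_imp_le[OF gauss_bump_pos]] mult.assoc)
  also have "\<dots> = (\<integral>\<^sup>+\<tau>. \<integral>\<^sup>+x. (gauss_weight B \<tau> * ennreal (gauss_bump \<tau> x)) * (\<integral>\<^sup>+y. ennreal (gauss_bump \<tau> y) \<partial>\<nu>) \<partial>\<mu> \<partial>lborel)"
    by (intro L.Fubini') measurable
  also have "\<dots> = (\<integral>\<^sup>+\<tau>. gauss_weight B \<tau> * ((\<integral>\<^sup>+x. ennreal (gauss_bump \<tau> x) \<partial>\<mu>) * (\<integral>\<^sup>+x. ennreal (gauss_bump \<tau> x) \<partial>\<nu>)) \<partial>lborel)"
    by (intro nn_integral_cong, subst nn_integral_multc, measurable, subst nn_integral_cmult) (auto simp: ac_simps)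
  finally show ?thesis .
qed

section \<open>Lower semicontinuity of the interaction\<close>

text \<open>Squares of sums produce all ordered pairs and the diagonal, whereas \<open>V\<close>
  counts every unordered pair once. The statement avoids subtraction so that it applies in
  \<open>ennreal\<close>.\<close>

lemma sum_sum_symmetric:
  fixes f :: "nat \<Rightarrow> nat \<Rightarrow> 'a :: comm_semiring_1"
  assumes "\<And>i j. f i j = f j i"
  shows "(\<Sum>i=1..n. \<Sum>j=1..n. f i j) = (\<Sum>i=1..n. f i i) + 2 * (\<Sum>i=1..n. \<Sum>j=i+1..n. f i j)"
proof (induction n)
  case (Suc n)
  have "(\<Sum>i=1..Suc n. \<Sum>j=1..Suc n. f i j)
     = (\<Sum>i=1..n. \<Sum>j=1..n. f i j) + (\<Sum>i=1..n. f i (Suc n)) + ((\<Sum>j=1..n. f (Suc n) j) + f (Suc n) (Suc n))"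
    by (simp add: sum.distrib ac_simps)
  also have "(\<Sum>j=1..n. f (Suc n) j) = (\<Sum>i=1..n. f i (Suc n))"
    by (simp add: assms)
  finally have 1: "(\<Sum>i=1..Suc n. \<Sum>j=1..Suc n. f i j)
     = (\<Sum>i=1..n. \<Sum>j=1..n. f i j) + 2 * (\<Sum>i=1..n. f i (Suc n)) + f (Suc n) (Suc n)"
    by (simp add: mult_2 ac_simps)
  have 2: "(\<Sum>i=1..Suc n. \<Sum>j=i+1..Suc n. f i j) = (\<Sum>i=1..n. \<Sum>j=i+1..n. f i j) + (\<Sum>i=1..n. f i (Suc n))"
    by (simp add: sum.distrib)
  show ?case unfolding 1 2 Suc.IH by (simp add: distrib_left add_ac)
qed simp

lemma coulomb_part_commute: "coulomb_part B x y = coulomb_part B y x"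
  by (simp add: coulomb_part_def mult.commute)

text \<open>The discrete counterpart of \<open>nn_integral_coulomb_part\<close>: the inner sum times
  \<open>c\<close> is the Gaussian transform of the measure with mass \<open>c\<close> at each
  point.\<close>

lemma sum_coulomb_part:
  assumes [measurable]: "B \<in> sets borel" and "c \<ge> 0"
  shows "ennreal (c\<^sup>2) * (\<Sum>i\<in>I. \<Sum>j\<in>I. coulomb_part B (x i) (x j))
    = (\<integral>\<^sup>+\<tau>. gauss_weight B \<tau> * (ennreal (c * (\<Sum>i\<in>I. gauss_bump \<tau> (x i))))\<^sup>2 \<partial>lborel)"
proof -
  have "ennreal (c\<^sup>2) * (\<Sum>i\<in>I. \<Sum>j\<in>I. coulomb_part B (x i) (x j))
    = (\<integral>\<^sup>+\<tau>. ennreal (c\<^sup>2) * (\<Sum>i\<in>I. \<Sum>j\<in>I. gauss_weight B \<tau> * ennreal (gauss_bump \<tau> (x i) * gauss_bump \<tau> (x j))) \<partial>lborel)"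
    unfolding coulomb_part_def by (simp add: nn_integral_sum nn_integral_cmult)
  also have "\<dots> = (\<integral>\<^sup>+\<tau>. gauss_weight B \<tau> * (ennreal (c * (\<Sum>i\<in>I. gauss_bump \<tau> (x i))))\<^sup>2 \<partial>lborel)"
  proof (rule nn_integral_cong)
    fix \<tau>
    have "(c * (\<Sum>i\<in>I. gauss_bump \<tau> (x i)))\<^sup>2 = c\<^sup>2 * (\<Sum>i\<in>I. \<Sum>j\<in>I. gauss_bump \<tau> (x i) * gauss_bump \<tau> (x j))"
      by (simp add: power_mult_distrib power2_eq_square sum_product)
    moreover have "(ennreal (c * (\<Sum>i\<in>I. gauss_bump \<tau> (x i))))\<^sup>2 = ennreal ((c * (\<Sum>i\<in>I. gauss_bump \<tau> (x i)))\<^sup>2)"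
      using assms by (intro ennreal_power mult_nonneg_nonneg sum_nonneg less_imp_le[OF gauss_bump_pos]) auto
    moreover have "(\<Sum>i\<in>I. \<Sum>j\<in>I. gauss_weight B \<tau> * ennreal (gauss_bump \<tau> (x i) * gauss_bump \<tau> (x j)))
      = gauss_weight B \<tau> * ennreal (\<Sum>i\<in>I. \<Sum>j\<in>I. gauss_bump \<tau> (x i) * gauss_bump \<tau> (x j))"
      by (simp add: sum_distrib_left[symmetric] sum_ennreal sum_nonneg less_imp_le[OF gauss_bump_pos])
    ultimately show "ennreal (c\<^sup>2) * (\<Sum>i\<in>I. \<Sum>j\<in>I. gauss_weight B \<tau> * ennreal (gauss_bump \<tau> (x i) * gauss_bump \<tau> (x j)))
      = gauss_weight B \<tau> * (ennreal (c * (\<Sum>i\<in>I. gauss_bump \<tau> (x i))))\<^sup>2"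
      by (simp add: ennreal_mult' mult.left_commute)
  qed
  finally show ?thesis .
qed

text \<open>Monotone convergence in the cutoff, each integrand being stationary once the cutoff
  exceeds \<open>fst \<tau>\<close>. Cutoffs \<open>Suc n\<close> are positive, as the bound on the
  truncated kernel requires.\<close>

lemma nn_integral_gauss_weight_SUP:
  assumes [measurable]: "f \<in> borel_measurable lborel"
  shows "(\<integral>\<^sup>+\<tau>. gauss_weight {0<..} \<tau> * f \<tau> \<partial>lborel) = (SUP n. \<integral>\<^sup>+\<tau>. gauss_weight {0<..<real (Suc n)} \<tau> * f \<tau> \<partial>lborel)"
proof -
  have inc: "incseq (\<lambda>n \<tau>. gauss_weight {0<..<real (Suc n)} \<tau> * f \<tau>)"
    by (auto simp: incseq_def le_fun_def intro!: mult_right_mono gauss_weight_mono)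
  have "gauss_weight {0<..} \<tau> * f \<tau> = (SUP n. gauss_weight {0<..<real (Suc n)} \<tau> * f \<tau>)" for \<tau>
  proof (rule antisym)
    obtain n where "fst \<tau> < real n" using reals_Archimedean2 by blast
    then have "gauss_weight {0<..} \<tau> * f \<tau> = gauss_weight {0<..<real (Suc n)} \<tau> * f \<tau>"
      by (auto simp: gauss_weight_def indicator_def)
    also have "\<dots> \<le> (SUP n. gauss_weight {0<..<real (Suc n)} \<tau> * f \<tau>)" by (rule SUP_upper) simp
    finally show "gauss_weight {0<..} \<tau> * f \<tau> \<le> (SUP n. gauss_weight {0<..<real (Suc n)} \<tau> * f \<tau>)" .
  qed (auto intro!: SUP_least mult_right_mono gauss_weight_mono)
  then show ?thesis
    using nn_integral_monotone_convergence_SUP[OF inc, of lborel] by simp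
qed

text \<open>Subtraction in \<open>ennreal\<close> is truncated, so the null sequence is replaced by
  a constant \<open>\<epsilon>\<close>, which a continuous monotone map carries through the
  liminf.\<close>

lemma ennreal_le_liminf_add:
  fixes a :: ennreal
  assumes "a \<le> liminf (\<lambda>k. ennreal (e k) + q k)" and e: "e \<longlonglongrightarrow> 0"
  shows "a \<le> liminf q"
proof (rule ennreal_le_epsilon)
  fix \<epsilon> :: real assume "0 < \<epsilon>"
  have "a \<le> liminf (\<lambda>k. ennreal (e k) + q k)" by fact
  also have "\<dots> \<le> liminf (\<lambda>k. ennreal \<epsilon> + q k)"
    using order_tendstoD(2)[OF e \<open>0 < \<epsilon>\<close>]
    by (intro Liminf_mono) (auto elim!: eventually_mono intro!: add_right_mono ennreal_leI)
  also have "\<dots> = ennreal \<epsilon> + liminf q"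
  proof (rule Liminf_compose_continuous_mono)
    show "continuous_on UNIV ((+) (ennreal \<epsilon>))"
      by (intro continuous_intros)
  qed (auto intro!: monoI add_left_mono)
  finally show "a \<le> liminf q + ennreal \<epsilon>" by (simp add: add.commute)
qed


text \<open>The cutoff \<open>S\<close> stays fixed while \<open>k\<close> tends to infinity: the
  \<open>N k\<close> diagonal terms, each at most \<open>2 * S / sqrt pi\<close>, carry the weight
  \<open>(c k)\<^sup>2\<close> and vanish by the assumption on \<open>c\<close>. Only afterwards is
  \<open>S\<close> sent to infinity.\<close>

lemma coulomb_energy_liminf:
  fixes x :: "nat \<Rightarrow> nat \<Rightarrow> real^3"
  assumes "finite_measure \<mu>" and sets: "sets \<mu> = sets borel"
    and c: "\<And>k. c k \<ge> 0" "(\<lambda>k. (c k)\<^sup>2 * real (N k)) \<longlonglongrightarrow> 0"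
    and conv: "\<And>\<tau>. fst \<tau> > 0 \<Longrightarrow> (\<lambda>k. c k * (\<Sum>i=1..N k. gauss_bump \<tau> (x k i))) \<longlonglongrightarrow> (\<integral>y. gauss_bump \<tau> y \<partial>\<mu>)"
  shows "(\<integral>\<^sup>+x. \<integral>\<^sup>+y. 1 / ennreal (norm (x - y)) \<partial>\<mu> \<partial>\<mu>)
    \<le> liminf (\<lambda>k. 2 * (ennreal ((c k)\<^sup>2) * (\<Sum>i=1..N k. \<Sum>j=i+1..N k. 1 / ennreal (norm (x k i - x k j)))))"
proof -
  interpret finite_measure \<mu> by fact
  note [measurable_cong] = sets
  define G where "G \<tau> = (\<integral>\<^sup>+y. ennreal (gauss_bump \<tau> y) \<partial>\<mu>)" for \<tau>
  have [measurable]: "G \<in> borel_measurable lborel" unfolding G_def by measurable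
  have G: "G \<tau> = ennreal (\<integral>y. gauss_bump \<tau> y \<partial>\<mu>)" for \<tau>
    unfolding G_def
    by (intro nn_integral_eq_integral integrable_const_bound[where B=1])
      (auto simp: gauss_bump_le_1 less_imp_le[OF gauss_bump_pos])
  define q where "q k = 2 * (ennreal ((c k)\<^sup>2) * (\<Sum>i=1..N k. \<Sum>j=i+1..N k. 1 / ennreal (norm (x k i - x k j))))" for k
  have *: "(\<integral>\<^sup>+\<tau>. gauss_weight {0<..<S} \<tau> * (G \<tau>)\<^sup>2 \<partial>lborel) \<le> liminf q" if S: "S > 0" for S
  proof (rule ennreal_le_liminf_add)
    let ?h = "\<lambda>k \<tau>. gauss_weight {0<..<S} \<tau> * (ennreal (c k * (\<Sum>i=1..N k. gauss_bump \<tau> (x k i))))\<^sup>2"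
    let ?e = "\<lambda>k. (c k)\<^sup>2 * real (N k) * (2 * S / sqrt pi)"
    show "?e \<longlonglongrightarrow> 0"
      using tendsto_mult_right[OF c(2), of "2 * S / sqrt pi"] by simp
    have "(\<integral>\<^sup>+\<tau>. gauss_weight {0<..<S} \<tau> * (G \<tau>)\<^sup>2 \<partial>lborel) = (\<integral>\<^sup>+\<tau>. liminf (\<lambda>k. ?h k \<tau>) \<partial>lborel)"
    proof (rule nn_integral_cong)
      fix \<tau> :: "real \<times> (real^3)"
      show "gauss_weight {0<..<S} \<tau> * (G \<tau>)\<^sup>2 = liminf (\<lambda>k. ?h k \<tau>)"
      proof (cases "fst \<tau> \<in> {0<..<S}")
        case True
        then have "(\<lambda>k. ennreal (16 / pi\<^sup>2 * (fst \<tau>) ^ 3 * (c k * (\<Sum>i=1..N k. gauss_bump \<tau> (x k i)))\<^sup>2))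
          \<longlonglongrightarrow> ennreal (16 / pi\<^sup>2 * (fst \<tau>) ^ 3 * (\<integral>y. gauss_bump \<tau> y \<partial>\<mu>)\<^sup>2)"
          by (intro tendsto_ennrealI tendsto_intros conv) auto
        also have "(\<lambda>k. ennreal (16 / pi\<^sup>2 * (fst \<tau>) ^ 3 * (c k * (\<Sum>i=1..N k. gauss_bump \<tau> (x k i)))\<^sup>2)) = (\<lambda>k. ?h k \<tau>)"
        proof
          fix k
          have "(ennreal (c k * (\<Sum>i=1..N k. gauss_bump \<tau> (x k i))))\<^sup>2 = ennreal ((c k * (\<Sum>i=1..N k. gauss_bump \<tau> (x k i)))\<^sup>2)"
            using c(1) by (intro ennreal_power mult_nonneg_nonneg sum_nonneg less_imp_le[OF gauss_bump_pos])
          then show "ennreal (16 / pi\<^sup>2 * (fst \<tau>) ^ 3 * (c k * (\<Sum>i=1..N k. gauss_bump \<tau> (x k i)))\<^sup>2) = ?h k \<tau>"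
            using True unfolding gauss_weight_def by (subst ennreal_mult') auto
        qed
        also have "ennreal (16 / pi\<^sup>2 * (fst \<tau>) ^ 3 * (\<integral>y. gauss_bump \<tau> y \<partial>\<mu>)\<^sup>2) = gauss_weight {0<..<S} \<tau> * (G \<tau>)\<^sup>2"
        proof -
          have "(G \<tau>)\<^sup>2 = ennreal ((\<integral>y. gauss_bump \<tau> y \<partial>\<mu>)\<^sup>2)"
            unfolding G by (intro ennreal_power integral_nonneg_AE) (simp add: less_imp_le[OF gauss_bump_pos])
          then show ?thesis
            using True unfolding gauss_weight_def by (subst ennreal_mult') auto
        qed
        finally show ?thesis by (intro lim_imp_Liminf[symmetric]) auto
      qed (auto simp: gauss_weight_def Liminf_const)
    qed
    also have "\<dots> \<le> liminf (\<lambda>k. \<integral>\<^sup>+\<tau>. ?h k \<tau> \<partial>lborel)"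
      by (rule nn_integral_liminf) measurable
    also have "\<dots> \<le> liminf (\<lambda>k. ennreal (?e k) + q k)"
    proof (intro Liminf_mono always_eventually allI)
      fix k
      have "(\<integral>\<^sup>+\<tau>. ?h k \<tau> \<partial>lborel) = ennreal ((c k)\<^sup>2) * (\<Sum>i=1..N k. \<Sum>j=1..N k. coulomb_part {0<..<S} (x k i) (x k j))"
        by (rule sum_coulomb_part[symmetric]) (use c in auto)
      \<comment> \<open>Diagonal terms are controlled by the cutoff. Terms with distinct indices are
        compared with the full kernel, which remains valid if two points coincide, since the full
        kernel is then infinite.\<close>
      also have "\<dots> = ennreal ((c k)\<^sup>2) * (\<Sum>i=1..N k. coulomb_part {0<..<S} (x k i) (x k i))
          + 2 * (ennreal ((c k)\<^sup>2) * (\<Sum>i=1..N k. \<Sum>j=i+1..N k. coulomb_part {0<..<S} (x k i) (x k j)))"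
        by (subst sum_sum_symmetric, rule coulomb_part_commute) (simp add: distrib_left mult.left_commute)
      also have "\<dots> \<le> ennreal ((c k)\<^sup>2) * (\<Sum>i=1..N k. ennreal (2 * S / sqrt pi)) + q k"
        unfolding q_def by (intro add_mono mult_left_mono sum_mono coulomb_part_bounded coulomb_part_le S) auto
      also have "ennreal ((c k)\<^sup>2) * (\<Sum>i=1..N k. ennreal (2 * S / sqrt pi)) = ennreal (?e k)"
        using S by (simp add: ennreal_of_nat_eq_real_of_nat ennreal_mult'[symmetric] mult.assoc)
      finally show "(\<integral>\<^sup>+\<tau>. ?h k \<tau> \<partial>lborel) \<le> ennreal (?e k) + q k" .
    qed
    finally show "(\<integral>\<^sup>+\<tau>. gauss_weight {0<..<S} \<tau> * (G \<tau>)\<^sup>2 \<partial>lborel) \<le> liminf (\<lambda>k. ennreal (?e k) + q k)" .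
  qed
  have "(\<integral>\<^sup>+x. \<integral>\<^sup>+y. 1 / ennreal (norm (x - y)) \<partial>\<mu> \<partial>\<mu>) = (\<integral>\<^sup>+\<tau>. gauss_weight {0<..} \<tau> * (G \<tau>)\<^sup>2 \<partial>lborel)"
    unfolding coulomb_part_UNIV[symmetric]
    by (subst nn_integral_coulomb_part) (auto simp: sets G_def power2_eq_square intro: sigma_finite_measure)
  also have "\<dots> = (SUP n. \<integral>\<^sup>+\<tau>. gauss_weight {0<..<real (Suc n)} \<tau> * (G \<tau>)\<^sup>2 \<partial>lborel)"
    by (rule nn_integral_gauss_weight_SUP) measurable
  also have "\<dots> \<le> liminf q" by (intro SUP_least *) simp
  finally show ?thesis unfolding q_def .
qed

section \<open>Strict convexity of the interaction\<close>

text \<open>Closed sets are stable under intersection and generate the Borel sets, and the indicator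
  of a closed set is a pointwise limit of continuous functions with values in
  \<open>{0..1}\<close>.\<close>

lemma measure_eqI_nn_integral_continuous:
  fixes \<mu> \<nu> :: "'a::metric_space measure"
  assumes "finite_measure \<mu>" "sets \<mu> = sets borel" "finite_measure \<nu>" "sets \<nu> = sets borel"
    and eq: "\<And>f :: 'a \<Rightarrow> real. continuous_on UNIV f \<Longrightarrow> (\<And>x. 0 \<le> f x) \<Longrightarrow> (\<And>x. f x \<le> 1) \<Longrightarrow>
       (\<integral>\<^sup>+x. ennreal (f x) \<partial>\<mu>) = (\<integral>\<^sup>+x. ennreal (f x) \<partial>\<nu>)"
  shows "\<mu> = \<nu>"
proof (rule measure_eqI_generator_eq)
  interpret M: finite_measure \<mu> by fact
  interpret N: finite_measure \<nu> by fact
  note [measurable_cong] = assms(2,4)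
  show "emeasure \<mu> C = emeasure \<nu> C" if C: "C \<in> Collect closed" for C
  proof (cases "C = {}")
    \<comment> \<open>The empty set is treated apart because \<open>infdist x {}\<close> is 0, which
      would make all the cutoffs constantly 1.\<close>
    case False
    have [measurable]: "C \<in> sets borel" using C by auto
    define f where "f n x = max 0 (1 - real n * infdist x C)" for n x
    have cont: "continuous_on UNIV (f n)" for n
      unfolding f_def by (intro continuous_intros)
    have [measurable]: "f n \<in> borel_measurable borel" for n
      by (rule borel_measurable_continuous_onI[OF cont])
    have f01: "0 \<le> f n x" "f n x \<le> 1" for n x
      by (auto simp: f_def infdist_nonneg)
    have lim: "(\<lambda>n. ennreal (f n x)) \<longlonglongrightarrow> indicator C x" for x
    proof (cases "x \<in> C")
      case True
      then show ?thesis by (simp add: f_def)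
    next
      case nC: False
      then have pos: "infdist x C > 0"
        using C False in_closed_iff_infdist_zero[of C x] infdist_nonneg[of x C] by fastforce
      obtain m where m: "1 / infdist x C < real m" using reals_Archimedean2 by blast
      have "ennreal (f n x) = 0" if "n \<ge> m" for n
      proof -
        have "1 / infdist x C < real n" using m that by linarith
        then have "1 \<le> real n * infdist x C" using pos by (simp add: field_simps)
        then show ?thesis by (simp add: f_def)
      qed
      then show ?thesis using nC by (intro tendsto_eventually) (auto simp: eventually_sequentially)
    qed
    have cv: "(\<lambda>n. \<integral>\<^sup>+x. ennreal (f n x) \<partial>\<rho>) \<longlonglongrightarrow> emeasure \<rho> C"
      if "finite_measure \<rho>" and [measurable_cong]: "sets \<rho> = sets borel" for \<rho>
    proof -
      interpret finite_measure \<rho> by fact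
      have "(\<lambda>n. \<integral>\<^sup>+x. ennreal (f n x) \<partial>\<rho>) \<longlonglongrightarrow> (\<integral>\<^sup>+x. indicator C x \<partial>\<rho>)"
        by (rule nn_integral_dominated_convergence[where w="\<lambda>_. 1"])
          (auto simp: f01 lim less_top[symmetric])
      then show ?thesis by simp
    qed
    have "(\<lambda>n. \<integral>\<^sup>+x. ennreal (f n x) \<partial>\<mu>) = (\<lambda>n. \<integral>\<^sup>+x. ennreal (f n x) \<partial>\<nu>)"
      by (intro ext eq cont f01)
    then show ?thesis
      using cv[OF assms(1,2)] cv[OF assms(3,4)] LIMSEQ_unique by metis
  qed simp
  show "range (\<lambda>_::nat. UNIV) \<subseteq> Collect (closed :: 'a set \<Rightarrow> bool)" by auto
  show "emeasure \<mu> UNIV \<noteq> \<infinity>" by simp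
qed (auto simp: assms borel_eq_closed Int_stable_def)

text \<open>
  Mollifying \<open>f\<close> with a Gaussian of width \<open>1 / s n\<close> gives \<open>\<Phi> n\<close>, whose integral is determined by the
  Gaussian transforms.
\<close>
lemma measure_eqI_gauss_bump:
  assumes "finite_measure \<mu>" and [measurable_cong]: "sets \<mu> = sets borel"
    and "finite_measure \<nu>" and [measurable_cong]: "sets \<nu> = sets borel"
    and ae: "AE \<tau> in lborel. fst \<tau> > 0 \<longrightarrow> (\<integral>\<^sup>+x. ennreal (gauss_bump \<tau> x) \<partial>\<mu>) = (\<integral>\<^sup>+x. ennreal (gauss_bump \<tau> x) \<partial>\<nu>)"
  shows "\<mu> = \<nu>"
proof (rule measure_eqI_nn_integral_continuous)
  interpret M: finite_measure \<mu> by fact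
  interpret N: finite_measure \<nu> by fact
  fix f :: "real^3 \<Rightarrow> real"
  assume f: "continuous_on UNIV f" "\<And>x. 0 \<le> f x" "\<And>x. f x \<le> 1"
  have [measurable]: "f \<in> borel_measurable borel" by (rule borel_measurable_continuous_onI[OF f(1)])
  define good where "good s \<longleftrightarrow> (AE w in lborel. s > 0 \<longrightarrow>
      (\<integral>\<^sup>+x. ennreal (gauss_bump (s, w) x) \<partial>\<mu>) = (\<integral>\<^sup>+x. ennreal (gauss_bump (s, w) x) \<partial>\<nu>))" for s
  have aes: "AE s in lborel. good s"
    using lborel_pair.AE_pair[OF ae[folded lborel_prod]] by (simp add: good_def)
  \<comment> \<open>The exceptional scales form a null set, so they cannot fill an interval; this
    yields good scales tending to infinity.\<close>
  have "\<exists>s. good s \<and> s > real (Suc n)" for n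
  proof (rule ccontr)
    assume "\<nexists>s. good s \<and> s > real (Suc n)"
    with aes have "AE s in lborel. s \<notin> {real (Suc n)<..<real (Suc n) + 1}"
      by (auto elim!: eventually_mono)
    then have "emeasure lborel {real (Suc n)<..<real (Suc n) + 1} = 0"
      by (subst (asm) AE_iff_null_sets[symmetric]) (auto dest: null_setsD1)
    then show False by simp
  qed
  then obtain s where s: "\<And>n. good (s n)" "\<And>n. s n > real (Suc n)" by metis
  then have spos: "s n > 0" for n using less_trans[OF _ s(2)[of n], of 0] by simp
  define \<kappa> where "\<kappa> = (\<integral>\<^sup>+u. ennreal (exp (- 2 * (norm (u::real^3))\<^sup>2)) \<partial>lborel)"
  \<comment> \<open>The value \<open>s = 1 / sqrt 2\<close> turns the exponent factor
    \<open>4 * s\<^sup>2\<close> into 2.\<close>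
  have \<kappa>: "\<kappa> = ennreal ((sqrt pi / (2 * (1 / sqrt 2))) ^ 3)"
    unfolding \<kappa>_def by (subst nn_integral_gauss_real3[symmetric]) (auto simp: power_divide)
  define \<Phi> where "\<Phi> n x = (\<integral>\<^sup>+u. ennreal (f (x + (1 / s n) *\<^sub>R u) * exp (- 2 * (norm u)\<^sup>2)) \<partial>lborel)" for n x
  have s0: "(\<lambda>n. 1 / s n) \<longlonglongrightarrow> 0"
  proof (rule tendsto_sandwich[OF _ _ tendsto_const LIMSEQ_inverse_real_of_nat])
    show "\<forall>\<^sub>F n in sequentially. 1 / s n \<le> inverse (real (Suc n))"
      using s(2) by (intro always_eventually allI) (simp add: inverse_eq_divide frac_le less_imp_le)
  qed (auto simp: less_imp_le[OF spos])
  have \<Phi>lim: "(\<lambda>n. \<Phi> n x) \<longlonglongrightarrow> ennreal (f x) * \<kappa>" for x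
  proof -
    have "(\<lambda>n. \<Phi> n x) \<longlonglongrightarrow> (\<integral>\<^sup>+u. ennreal (f x * exp (- 2 * (norm (u::real^3))\<^sup>2)) \<partial>lborel)"
      unfolding \<Phi>_def
    proof (rule nn_integral_dominated_convergence[where w="\<lambda>u. ennreal (exp (- 2 * (norm u)\<^sup>2))"])
      show "AE u in lborel. (\<lambda>n. ennreal (f (x + (1 / s n) *\<^sub>R u) * exp (- 2 * (norm u)\<^sup>2)))
          \<longlonglongrightarrow> ennreal (f x * exp (- 2 * (norm u)\<^sup>2))"
      proof (rule AE_I2)
        fix u :: "real^3"
        have "(\<lambda>n. x + (1 / s n) *\<^sub>R u) \<longlonglongrightarrow> x + 0 *\<^sub>R u" by (intro tendsto_intros s0)
        then have "(\<lambda>n. f (x + (1 / s n) *\<^sub>R u)) \<longlonglongrightarrow> f x"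
          using continuous_on_tendsto_compose[OF f(1)] by simp
        then show "(\<lambda>n. ennreal (f (x + (1 / s n) *\<^sub>R u) * exp (- 2 * (norm u)\<^sup>2)))
          \<longlonglongrightarrow> ennreal (f x * exp (- 2 * (norm u)\<^sup>2))"
          by (intro tendsto_ennrealI tendsto_intros)
      qed
      show "(\<integral>\<^sup>+u. ennreal (exp (- 2 * (norm (u::real^3))\<^sup>2)) \<partial>lborel) < \<infinity>"
        using \<kappa> unfolding \<kappa>_def by simp
    qed (auto intro!: ennreal_leI mult_left_le_one_le f)
    also have "(\<integral>\<^sup>+u. ennreal (f x * exp (- 2 * (norm (u::real^3))\<^sup>2)) \<partial>lborel) = ennreal (f x) * \<kappa>"
      unfolding \<kappa>_def using f by (simp add: ennreal_mult nn_integral_cmult)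
    finally show ?thesis .
  qed
  have \<Phi>le: "\<Phi> n x \<le> \<kappa>" for n x
    unfolding \<Phi>_def \<kappa>_def by (intro nn_integral_mono ennreal_leI mult_left_le_one_le f) auto
  have [measurable]: "\<Phi> n \<in> borel_measurable borel" for n
    unfolding \<Phi>_def by measurable
  \<comment> \<open>Substituting \<open>w = x + (1 / s n) *\<^sub>R u\<close> turns the average of
    \<open>f\<close> around \<open>x\<close> into an integral over centres \<open>w\<close> of bumps
    evaluated at \<open>x\<close>. Integrating over \<open>x\<close> then involves the measure only
    through its Gaussian transform.\<close>
  have \<Phi>eq: "\<Phi> n x = ennreal (s n ^ 3) * (\<integral>\<^sup>+w. ennreal (f w * gauss_bump (s n, w) x) \<partial>lborel)" for n x
  proof -
    have bump: "gauss_bump (s n, x + (1 / s n) *\<^sub>R u) x = exp (- 2 * (norm u)\<^sup>2)" for u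
      using spos[of n] by (simp add: gauss_bump_def power_divide)
    have "(\<integral>\<^sup>+w. ennreal (f w * gauss_bump (s n, w) x) \<partial>lborel)
       = (\<integral>\<^sup>+w. ennreal (f w * gauss_bump (s n, w) x) \<partial>density (distr lborel borel (\<lambda>u. x + (1 / s n) *\<^sub>R u)) (\<lambda>_. \<bar>1 / s n\<bar> ^ DIM(real^3)))"
      using spos[of n] by (subst lborel_affine[where t=x and c="1 / s n"]) auto
    also have "\<dots> = ennreal ((1 / s n) ^ 3) * (\<integral>\<^sup>+u. ennreal (f (x + (1 / s n) *\<^sub>R u) * gauss_bump (s n, x + (1 / s n) *\<^sub>R u) x) \<partial>lborel)"
      using spos[of n] by (simp add: nn_integral_density nn_integral_distr nn_integral_cmult)
    finally have "(\<integral>\<^sup>+w. ennreal (f w * gauss_bump (s n, w) x) \<partial>lborel) = ennreal ((1 / s n) ^ 3) * \<Phi> n x"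
      unfolding \<Phi>_def bump .
    then have "ennreal (s n ^ 3) * (\<integral>\<^sup>+w. ennreal (f w * gauss_bump (s n, w) x) \<partial>lborel)
       = (ennreal (s n ^ 3) * ennreal ((1 / s n) ^ 3)) * \<Phi> n x" by (simp add: mult.assoc)
    also have "ennreal (s n ^ 3) * ennreal ((1 / s n) ^ 3) = 1"
      using spos[of n] by (subst ennreal_mult'[symmetric]) (auto simp: power_divide)
    finally show ?thesis by simp
  qed
  have cv: "(\<lambda>n. \<integral>\<^sup>+x. \<Phi> n x \<partial>\<rho>) \<longlonglongrightarrow> (\<integral>\<^sup>+x. ennreal (f x) \<partial>\<rho>) * \<kappa>"
    if "finite_measure \<rho>" and [measurable_cong]: "sets \<rho> = sets borel" for \<rho>
  proof -
    interpret finite_measure \<rho> by fact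
    have "(\<lambda>n. \<integral>\<^sup>+x. \<Phi> n x \<partial>\<rho>) \<longlonglongrightarrow> (\<integral>\<^sup>+x. ennreal (f x) * \<kappa> \<partial>\<rho>)"
      using \<Phi>le \<Phi>lim
      by (intro nn_integral_dominated_convergence[where w="\<lambda>_. \<kappa>"])
        (auto simp: \<kappa> ennreal_mult_less_top less_top[symmetric] ennreal_mult_eq_top_iff)
    then show ?thesis by (simp add: nn_integral_multc)
  qed
  have sw: "(\<integral>\<^sup>+x. \<Phi> n x \<partial>\<rho>) = ennreal (s n ^ 3) * (\<integral>\<^sup>+w. ennreal (f w) * (\<integral>\<^sup>+x. ennreal (gauss_bump (s n, w) x) \<partial>\<rho>) \<partial>lborel)"
    if "finite_measure \<rho>" and [measurable_cong]: "sets \<rho> = sets borel" for \<rho> n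
  proof -
    interpret finite_measure \<rho> by fact
    interpret L: pair_sigma_finite "lborel :: (real^3) measure" \<rho> by standard
    have "(\<integral>\<^sup>+x. \<Phi> n x \<partial>\<rho>) = ennreal (s n ^ 3) * (\<integral>\<^sup>+x. \<integral>\<^sup>+w. ennreal (f w * gauss_bump (s n, w) x) \<partial>lborel \<partial>\<rho>)"
      unfolding \<Phi>eq by (rule nn_integral_cmult) measurable
    also have "(\<integral>\<^sup>+x. \<integral>\<^sup>+w. ennreal (f w * gauss_bump (s n, w) x) \<partial>lborel \<partial>\<rho>)
       = (\<integral>\<^sup>+w. \<integral>\<^sup>+x. ennreal (f w * gauss_bump (s n, w) x) \<partial>\<rho> \<partial>lborel)"
      by (rule L.Fubini') measurable
    also have "\<dots> = (\<integral>\<^sup>+w. ennreal (f w) * (\<integral>\<^sup>+x. ennreal (gauss_bump (s n, w) x) \<partial>\<rho>) \<partial>lborel)"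
      using f by (simp add: ennreal_mult less_imp_le[OF gauss_bump_pos] nn_integral_cmult)
    finally show ?thesis .
  qed
  have "(\<integral>\<^sup>+x. \<Phi> n x \<partial>\<mu>) = (\<integral>\<^sup>+x. \<Phi> n x \<partial>\<nu>)" for n
    unfolding sw[OF assms(1,2)] sw[OF assms(3,4)] using s(1)[of n] spos[of n]
    by (intro arg_cong[where f="\<lambda>x. _ * x"] nn_integral_cong_AE) (auto simp: good_def)
  then have "(\<lambda>n. \<integral>\<^sup>+x. \<Phi> n x \<partial>\<mu>) = (\<lambda>n. \<integral>\<^sup>+x. \<Phi> n x \<partial>\<nu>)" ..
  from LIMSEQ_unique[OF cv[OF assms(1,2), unfolded this] cv[OF assms(3,4)]]
  have "(\<integral>\<^sup>+x. ennreal (f x) \<partial>\<mu>) * \<kappa> = (\<integral>\<^sup>+x. ennreal (f x) \<partial>\<nu>) * \<kappa>" .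
  moreover have "\<kappa> \<noteq> 0" "\<kappa> \<noteq> top" by (auto simp: \<kappa>)
  ultimately show "(\<integral>\<^sup>+x. ennreal (f x) \<partial>\<mu>) = (\<integral>\<^sup>+x. ennreal (f x) \<partial>\<nu>)"
    by (simp add: mult.commute[of _ \<kappa>] ennreal_mult_cancel_left)
qed fact+

section \<open>Sums of measures, and extension from a closed set to the whole space\<close>

definition add_measure :: "'a measure \<Rightarrow> 'a measure \<Rightarrow> 'a measure" where
  "add_measure \<mu> \<nu> = measure_of (space \<mu>) (sets \<mu>) (\<lambda>X. emeasure \<mu> X + emeasure \<nu> X)"

lemma sets_add_measure [simp, measurable_cong]: "sets (add_measure \<mu> \<nu>) = sets \<mu>"
  and space_add_measure [simp]: "space (add_measure \<mu> \<nu>) = space \<mu>"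
  by (simp_all add: add_measure_def)

lemma emeasure_add_measure:
  assumes s: "sets \<nu> = sets \<mu>" and X: "X \<in> sets \<mu>"
  shows "emeasure (add_measure \<mu> \<nu>) X = emeasure \<mu> X + emeasure \<nu> X"
  unfolding add_measure_def
proof (rule emeasure_measure_of_sigma)
  show "sigma_algebra (space \<mu>) (sets \<mu>)" ..
  show "positive (sets \<mu>) (\<lambda>X. emeasure \<mu> X + emeasure \<nu> X)" by (simp add: positive_def)
  show "countably_additive (sets \<mu>) (\<lambda>X. emeasure \<mu> X + emeasure \<nu> X)"
  proof (rule countably_additiveI)
    fix A :: "nat \<Rightarrow> _" assume A: "range A \<subseteq> sets \<mu>" "disjoint_family A"
    have "(\<Sum>i. emeasure \<mu> (A i) + emeasure \<nu> (A i)) = (\<Sum>i. emeasure \<mu> (A i)) + (\<Sum>i. emeasure \<nu> (A i))"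
      by (rule suminf_add[symmetric]) auto
    then show "(\<Sum>i. emeasure \<mu> (A i) + emeasure \<nu> (A i)) = emeasure \<mu> (\<Union>i. A i) + emeasure \<nu> (\<Union>i. A i)"
      using A s by (simp add: suminf_emeasure)
  qed
qed fact

lemma nn_integral_add_measure:
  assumes s: "sets \<nu> = sets \<mu>" and f: "f \<in> borel_measurable \<mu>"
  shows "(\<integral>\<^sup>+x. f x \<partial>add_measure \<mu> \<nu>) = (\<integral>\<^sup>+x. f x \<partial>\<mu>) + (\<integral>\<^sup>+x. f x \<partial>\<nu>)"
  using f
proof induction
  case (cong f g)
  moreover have "space \<nu> = space \<mu>" using s by (rule sets_eq_imp_space_eq)
  ultimately show ?case by (simp cong: nn_integral_cong_simp)
next
  case (set A)
  then show ?case using s by (simp add: emeasure_add_measure)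
next
  case (mult u c)
  moreover have "u \<in> borel_measurable \<nu>" "u \<in> borel_measurable (add_measure \<mu> \<nu>)"
    using mult(2) s by (simp_all cong: measurable_cong_sets)
  ultimately show ?case by (simp add: nn_integral_cmult distrib_left)
next
  case (add u v)
  moreover have "u \<in> borel_measurable \<nu>" "u \<in> borel_measurable (add_measure \<mu> \<nu>)"
     "v \<in> borel_measurable \<nu>" "v \<in> borel_measurable (add_measure \<mu> \<nu>)"
    using add(1,3) s by (simp_all cong: measurable_cong_sets)
  ultimately show ?case by (simp add: nn_integral_add ac_simps)
next
  case (seq U)
  have m: "U i \<in> borel_measurable \<nu>" "U i \<in> borel_measurable (add_measure \<mu> \<nu>)" for i
    using seq(1) s by (simp_all cong: measurable_cong_sets)
  have "incseq (\<lambda>i. integral\<^sup>N \<mu> (U i))" "incseq (\<lambda>i. integral\<^sup>N \<nu> (U i))"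
    using \<open>incseq U\<close> by (auto simp: incseq_def le_fun_def intro!: nn_integral_mono)
  moreover have mc: "integral\<^sup>N \<rho> (Sup (range U)) = (SUP i. integral\<^sup>N \<rho> (U i))"
    if "\<And>i. U i \<in> borel_measurable \<rho>" for \<rho>
  proof -
    have "Sup (range U) = (\<lambda>x. SUP i. U i x)" by (rule ext) (simp add: image_comp)
    then show ?thesis using nn_integral_monotone_convergence_SUP[OF \<open>incseq U\<close> that] by simp
  qed
  ultimately show ?case
    unfolding mc[OF seq(1)] mc[OF m(1)] mc[OF m(2)] by (simp only: seq ennreal_SUP_add)
qed

text \<open>Makes the rules for Bochner integrals against a density available for scaled
  measures.\<close>

lemma scale_measure_eq_density: "scale_measure c M = density M (\<lambda>_. c)"
  by (rule measure_eqI) (simp_all add: emeasure_density_const)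

lemma integral_scale_measure:
  fixes f :: "'a \<Rightarrow> real"
  assumes "f \<in> borel_measurable M" "c \<ge> 0"
  shows "(\<integral>x. f x \<partial>scale_measure (ennreal c) M) = c * (\<integral>x. f x \<partial>M)"
  unfolding scale_measure_eq_density using assms by (subst integral_density) auto

lemma finite_measure_scale_measure:
  assumes "finite_measure M" "c \<ge> 0"
  shows "finite_measure (scale_measure (ennreal c) M)"
  using assms(1) by (auto intro!: finite_measureI simp: space_scale_measure finite_measure.emeasure_finite ennreal_mult_eq_top_iff)

lemma id_measurable_M_plus:
  assumes "\<nu> \<in> M_plus A"
  shows "(\<lambda>x. x) \<in> \<nu> \<rightarrow>\<^sub>M borel"
proof -
  have "sets \<nu> = sets (restrict_space borel A)" using assms by (simp add: M_plus_def)
  then show ?thesis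
    using measurable_restrict_space1[OF measurable_ident[of borel], of A]
    by (simp cong: measurable_cong_sets add: id_def)
qed

lemma borel_measurable_M_plus:
  assumes "\<nu> \<in> M_plus A" "f \<in> borel_measurable borel"
  shows "f \<in> borel_measurable \<nu>"
  using measurable_compose[OF id_measurable_M_plus[OF assms(1)] assms(2)] .

lemma space_M_plus: "\<nu> \<in> M_plus A \<Longrightarrow> space \<nu> = A"
  unfolding M_plus_def using sets_eq_imp_space_eq[of \<nu> "restrict_space borel A"]
  by (auto simp: space_restrict_space)

text \<open>Members of \<open>M_plus A\<close> live on the restricted sigma-algebra, while the
  Gaussian calculus is stated for Borel measures on the whole space. The push-forward under the
  inclusion extends a measure by zero.\<close>

definition borel_extension :: "(real^3) measure \<Rightarrow> (real^3) measure" where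
  "borel_extension \<nu> = distr \<nu> borel (\<lambda>x. x)"

lemma borel_extension:
  assumes "\<nu> \<in> M_plus A"
  shows "finite_measure (borel_extension \<nu>)" "sets (borel_extension \<nu>) = sets borel"
    "\<And>f. f \<in> borel_measurable borel \<Longrightarrow> (\<integral>\<^sup>+x. f x \<partial>borel_extension \<nu>) = (\<integral>\<^sup>+x. f x \<partial>\<nu>)"
    "\<And>f :: _ \<Rightarrow> real. f \<in> borel_measurable borel \<Longrightarrow> (\<integral>x. f x \<partial>borel_extension \<nu>) = (\<integral>x. f x \<partial>\<nu>)"
proof -
  note m = id_measurable_M_plus[OF assms]
  show "finite_measure (borel_extension \<nu>)" unfolding borel_extension_def
    using assms m by (intro finite_measure.finite_measure_distr) (auto simp: M_plus_def)
  show "(\<integral>\<^sup>+x. f x \<partial>borel_extension \<nu>) = (\<integral>\<^sup>+x. f x \<partial>\<nu>)" if "f \<in> borel_measurable borel" for f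
    unfolding borel_extension_def using m that by (subst nn_integral_distr) auto
  show "(\<integral>x. f x \<partial>borel_extension \<nu>) = (\<integral>x. f x \<partial>\<nu>)" if "f \<in> borel_measurable borel" for f :: "_ \<Rightarrow> real"
    unfolding borel_extension_def using m that by (rule integral_distr)
qed (simp add: borel_extension_def)

text \<open>Since \<open>A\<close> is closed, measurable subsets of \<open>A\<close> are Borel in
  the whole space, so the extension can be evaluated on them.\<close>

lemma borel_extension_inject:
  assumes "closed A" "\<mu> \<in> M_plus A" "\<nu> \<in> M_plus A" "borel_extension \<mu> = borel_extension \<nu>"
  shows "\<mu> = \<nu>"
proof (rule measure_eqI)
  show s: "sets \<mu> = sets \<nu>" using assms by (simp add: M_plus_def)
  have e: "emeasure (borel_extension \<rho>) X = emeasure \<rho> X" if "X \<in> sets \<rho>" "\<rho> \<in> M_plus A" for X \<rho>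
  proof -
    have X: "X \<in> sets (restrict_space borel A)" using that by (simp add: M_plus_def)
    then have "X \<in> sets borel" "X \<subseteq> A"
      using assms(1) by (auto simp: sets_restrict_space_iff)
    then show ?thesis
      unfolding borel_extension_def using space_M_plus[OF that(2)]
      by (subst emeasure_distr[OF id_measurable_M_plus[OF that(2)]]) (auto simp: Int_absorb2)
  qed
  show "emeasure \<mu> X = emeasure \<nu> X" if "X \<in> sets \<mu>" for X
    using e[OF that assms(2)] e[of X \<nu>] that s assms by simp
qed

definition interaction :: "(real^3) measure \<Rightarrow> ennreal" where
  "interaction \<mu> = (\<integral>\<^sup>+x. \<integral>\<^sup>+y. 1 / ennreal (norm (x - y)) \<partial>\<mu> \<partial>\<mu>)"

lemma interaction_borel_extension:
  assumes "\<nu> \<in> M_plus A"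
  shows "interaction (borel_extension \<nu>) = interaction \<nu>"
proof -
  interpret finite_measure "borel_extension \<nu>" by (rule borel_extension[OF assms])
  note [measurable_cong] = borel_extension(2)[OF assms]
  have "(\<lambda>x. \<integral>\<^sup>+y. 1 / ennreal (norm (x - y)) \<partial>borel_extension \<nu>) \<in> borel_measurable (borel_extension \<nu>)"
    by measurable
  then have "(\<lambda>x. \<integral>\<^sup>+y. 1 / ennreal (norm (x - y)) \<partial>borel_extension \<nu>) \<in> borel_measurable borel"
    by (simp cong: measurable_cong_sets add: borel_extension(2)[OF assms])
  then show ?thesis
    unfolding interaction_def
    by (subst borel_extension(3)[OF assms], assumption, subst borel_extension(3)[OF assms]) auto
qed

text \<open>The interaction is thus a weighted squared \<open>L2\<close> norm of the Gaussian
  transform. The transform is finite because bumps are at most 1 and the measure is finite, so it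
  may be handled as a real function.\<close>

lemma interaction_gauss:
  assumes "\<nu> \<in> M_plus A"
  defines "G \<equiv> \<lambda>\<tau>. \<integral>\<^sup>+x. ennreal (gauss_bump \<tau> x) \<partial>\<nu>"
  shows "G \<in> borel_measurable lborel"
    and "interaction \<nu> = (\<integral>\<^sup>+\<tau>. gauss_weight {0<..} \<tau> * (G \<tau>)\<^sup>2 \<partial>lborel)"
    and "G \<tau> = ennreal (\<integral>x. gauss_bump \<tau> x \<partial>\<nu>)"
proof -
  interpret finite_measure "borel_extension \<nu>" by (rule borel_extension[OF assms(1)])
  note [measurable_cong] = borel_extension(2)[OF assms(1)]
  have G: "G = (\<lambda>\<tau>. \<integral>\<^sup>+x. ennreal (gauss_bump \<tau> x) \<partial>borel_extension \<nu>)"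
    unfolding G_def by (subst borel_extension(3)[OF assms(1)]) auto
  show "G \<in> borel_measurable lborel" unfolding G by measurable
  show "interaction \<nu> = (\<integral>\<^sup>+\<tau>. gauss_weight {0<..} \<tau> * (G \<tau>)\<^sup>2 \<partial>lborel)"
  proof -
    have "interaction \<nu> = interaction (borel_extension \<nu>)"
      by (rule interaction_borel_extension[OF assms(1), symmetric])
    also have "\<dots> = (\<integral>\<^sup>+\<tau>. gauss_weight {0<..} \<tau> * (G \<tau>)\<^sup>2 \<partial>lborel)"
      unfolding interaction_def coulomb_part_UNIV[symmetric] G
      by (subst nn_integral_coulomb_part)
        (auto simp: borel_extension(2)[OF assms(1)] power2_eq_square intro: sigma_finite_measure)
    finally show ?thesis .
  qed
  show "G \<tau> = ennreal (\<integral>x. gauss_bump \<tau> x \<partial>\<nu>)"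
    unfolding G by (subst borel_extension(4)[OF assms(1), symmetric], simp)
      (auto intro!: nn_integral_eq_integral integrable_const_bound[where B=1]
        simp: gauss_bump_le_1 less_imp_le[OF gauss_bump_pos])
qed

definition midpoint :: "'a measure \<Rightarrow> 'a measure \<Rightarrow> 'a measure" where
  "midpoint \<mu> \<nu> = scale_measure (ennreal (1/2)) (add_measure \<mu> \<nu>)"

lemma nn_integral_midpoint:
  assumes "sets \<nu> = sets \<mu>" "f \<in> borel_measurable \<mu>"
  shows "(\<integral>\<^sup>+x. f x \<partial>midpoint \<mu> \<nu>) = ennreal (1/2) * ((\<integral>\<^sup>+x. f x \<partial>\<mu>) + (\<integral>\<^sup>+x. f x \<partial>\<nu>))"
  unfolding midpoint_def using assms
  by (subst nn_integral_scale_measure) (auto simp: nn_integral_add_measure cong: measurable_cong_sets)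

lemma midpoint_M_plus:
  assumes "\<mu> \<in> M_plus A" "\<nu> \<in> M_plus A"
  shows "midpoint \<mu> \<nu> \<in> M_plus A"
proof -
  have s: "sets \<nu> = sets \<mu>" using assms by (simp add: M_plus_def)
  have "finite_measure (add_measure \<mu> \<nu>)"
    using assms s sets_eq_imp_space_eq[OF s] emeasure_add_measure[OF s sets.top]
    by (intro finite_measureI) (auto simp: M_plus_def finite_measure.emeasure_finite)
  then show ?thesis
    using assms(1) unfolding midpoint_def M_plus_def mem_Collect_eq
    by (intro conjI finite_measure_scale_measure) auto
qed

text \<open>\<open>D\<close> stands for the interaction of the signed measure
  \<open>(\<mu> - \<nu>) / 2\<close>, expressed through the real Gaussian transforms only. The
  midpoint interaction plus \<open>D\<close> equals the average interaction, so the assumed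
  inequality forces \<open>D = 0\<close>; as the weight is positive for
  \<open>fst \<tau> > 0\<close>, the transforms agree almost everywhere there.\<close>

lemma midpoint_interaction_eqI:
  assumes M: "\<mu> \<in> M_plus A" "\<nu> \<in> M_plus A"
    and fin: "interaction \<mu> < top" "interaction \<nu> < top"
    and ge: "ennreal (1/2) * (interaction \<mu> + interaction \<nu>) \<le> interaction (midpoint \<mu> \<nu>)"
    and "closed A"
  shows "\<mu> = \<nu>"
proof (rule borel_extension_inject[OF \<open>closed A\<close> M])
  have s: "sets \<nu> = sets \<mu>" using M by (simp add: M_plus_def)
  define g where "g \<rho> \<tau> = (\<integral>x. gauss_bump \<tau> x \<partial>\<rho>)" for \<rho> \<tau>
  define G where "G \<rho> \<tau> = (\<integral>\<^sup>+x. ennreal (gauss_bump \<tau> x) \<partial>\<rho>)" for \<rho> \<tau>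
  have g0: "g \<rho> \<tau> \<ge> 0" for \<rho> \<tau>
    unfolding g_def by (intro integral_nonneg_AE) (simp add: less_imp_le[OF gauss_bump_pos])
  have Gg: "G \<rho> \<tau> = ennreal (g \<rho> \<tau>)" if "\<rho> \<in> M_plus A" for \<rho> \<tau>
    unfolding G_def g_def by (rule interaction_gauss(3)[OF that])
  have gG: "g \<rho> = (\<lambda>\<tau>. enn2real (G \<rho> \<tau>))" if "\<rho> \<in> M_plus A" for \<rho>
    using Gg[OF that] g0 by (simp add: fun_eq_iff)
  have gm: "g \<rho> \<in> borel_measurable borel" if "\<rho> \<in> M_plus A" for \<rho>
  proof -
    have "G \<rho> \<in> borel_measurable borel"
      using interaction_gauss(1)[OF that] unfolding G_def by simp
    then show ?thesis unfolding gG[OF that] by measurable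
  qed
  note [measurable] = gm[OF M(1)] gm[OF M(2)]
  have I: "interaction \<rho> = (\<integral>\<^sup>+\<tau>. gauss_weight {0<..} \<tau> * ennreal ((g \<rho> \<tau>)\<^sup>2) \<partial>lborel)" if "\<rho> \<in> M_plus A" for \<rho>
    using interaction_gauss(2)[OF that] Gg[OF that] unfolding G_def by (simp add: ennreal_power g0)
  have gmid: "g (midpoint \<mu> \<nu>) \<tau> = (g \<mu> \<tau> + g \<nu> \<tau>) / 2" for \<tau>
  proof -
    have "ennreal (g (midpoint \<mu> \<nu>) \<tau>) = ennreal (1/2) * (ennreal (g \<mu> \<tau>) + ennreal (g \<nu> \<tau>))"
      unfolding Gg[OF midpoint_M_plus[OF M], symmetric] Gg[OF M(1), symmetric] Gg[OF M(2), symmetric]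
      unfolding G_def by (rule nn_integral_midpoint[OF s]) (intro borel_measurable_M_plus[OF M(1)]; measurable)
    also have "\<dots> = ennreal ((g \<mu> \<tau> + g \<nu> \<tau>) / 2)"
      by (simp only: ennreal_plus[OF g0 g0, symmetric], subst ennreal_mult'[symmetric]) auto
    finally show ?thesis using g0 by (simp add: ennreal_inj)
  qed
  define D where "D = (\<integral>\<^sup>+\<tau>. gauss_weight {0<..} \<tau> * ennreal (((g \<mu> \<tau> - g \<nu> \<tau>) / 2)\<^sup>2) \<partial>lborel)"
  have "interaction (midpoint \<mu> \<nu>) + D
    = (\<integral>\<^sup>+\<tau>. gauss_weight {0<..} \<tau> * ennreal (((g \<mu> \<tau> + g \<nu> \<tau>) / 2)\<^sup>2)
       + gauss_weight {0<..} \<tau> * ennreal (((g \<mu> \<tau> - g \<nu> \<tau>) / 2)\<^sup>2) \<partial>lborel)"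
    unfolding I[OF midpoint_M_plus[OF M]] gmid D_def by (rule nn_integral_add[symmetric]) auto
  also have "\<dots> = (\<integral>\<^sup>+\<tau>. ennreal (1/2) * (gauss_weight {0<..} \<tau> * ennreal ((g \<mu> \<tau>)\<^sup>2)
       + gauss_weight {0<..} \<tau> * ennreal ((g \<nu> \<tau>)\<^sup>2)) \<partial>lborel)"
  proof (rule nn_integral_cong)
    fix \<tau>
    have "gauss_weight {0<..} \<tau> * ennreal (((g \<mu> \<tau> + g \<nu> \<tau>) / 2)\<^sup>2)
       + gauss_weight {0<..} \<tau> * ennreal (((g \<mu> \<tau> - g \<nu> \<tau>) / 2)\<^sup>2)
       = gauss_weight {0<..} \<tau> * ennreal (((g \<mu> \<tau> + g \<nu> \<tau>) / 2)\<^sup>2 + ((g \<mu> \<tau> - g \<nu> \<tau>) / 2)\<^sup>2)"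
      by (simp add: distrib_left)
    also have "((g \<mu> \<tau> + g \<nu> \<tau>) / 2)\<^sup>2 + ((g \<mu> \<tau> - g \<nu> \<tau>) / 2)\<^sup>2 = 1/2 * ((g \<mu> \<tau>)\<^sup>2 + (g \<nu> \<tau>)\<^sup>2)"
      by (simp add: power2_eq_square field_simps)
    also have "ennreal (1/2 * ((g \<mu> \<tau>)\<^sup>2 + (g \<nu> \<tau>)\<^sup>2)) = ennreal (1/2) * (ennreal ((g \<mu> \<tau>)\<^sup>2) + ennreal ((g \<nu> \<tau>)\<^sup>2))"
      by (subst ennreal_mult') auto
    finally show "gauss_weight {0<..} \<tau> * ennreal (((g \<mu> \<tau> + g \<nu> \<tau>) / 2)\<^sup>2)
       + gauss_weight {0<..} \<tau> * ennreal (((g \<mu> \<tau> - g \<nu> \<tau>) / 2)\<^sup>2)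
      = ennreal (1/2) * (gauss_weight {0<..} \<tau> * ennreal ((g \<mu> \<tau>)\<^sup>2)
       + gauss_weight {0<..} \<tau> * ennreal ((g \<nu> \<tau>)\<^sup>2))" by (simp only: distrib_left mult.left_commute)
  qed
  also have "\<dots> = ennreal (1/2) * (interaction \<mu> + interaction \<nu>)"
    unfolding I[OF M(1)] I[OF M(2)] by (simp add: nn_integral_cmult nn_integral_add)
  finally have eq: "interaction (midpoint \<mu> \<nu>) + D = ennreal (1/2) * (interaction \<mu> + interaction \<nu>)" .
  have fin': "ennreal (1/2) * (interaction \<mu> + interaction \<nu>) < top"
    using fin ennreal_less_top[of "1/2"]
    unfolding ennreal_mult_less_top by (intro disjI2 conjI) auto
  \<comment> \<open>Finiteness permits cancelling the midpoint interaction in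
    \<open>ennreal\<close>.\<close>
  have "interaction (midpoint \<mu> \<nu>) < top"
    using fin' unfolding eq[symmetric] by (simp add: ennreal_add_eq_top less_top)
  moreover have "interaction (midpoint \<mu> \<nu>) + D \<le> interaction (midpoint \<mu> \<nu>) + 0"
    unfolding eq using ge by simp
  ultimately have "D = 0"
    by (metis ennreal_add_left_cancel_le le_zero_eq less_irrefl infinity_ennreal_def)
  then have ae: "AE \<tau> in lborel. gauss_weight {0<..} \<tau> * ennreal (((g \<mu> \<tau> - g \<nu> \<tau>) / 2)\<^sup>2) = 0"
    unfolding D_def by (subst (asm) nn_integral_0_iff_AE) auto
  show "borel_extension \<mu> = borel_extension \<nu>"
  proof (rule measure_eqI_gauss_bump[OF borel_extension(1,2)[OF M(1)] borel_extension(1,2)[OF M(2)]])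
    show "AE \<tau> in lborel. fst \<tau> > 0 \<longrightarrow>
      (\<integral>\<^sup>+x. ennreal (gauss_bump \<tau> x) \<partial>borel_extension \<mu>) = (\<integral>\<^sup>+x. ennreal (gauss_bump \<tau> x) \<partial>borel_extension \<nu>)"
      using ae
    proof eventually_elim
      case (elim \<tau>)
      show ?case
      proof
        assume t: "fst \<tau> > 0"
        then have "\<not> 16 * fst \<tau> ^ 3 / pi\<^sup>2 \<le> 0" by (simp add: not_le)
        then have "((g \<mu> \<tau> - g \<nu> \<tau>) / 2)\<^sup>2 = 0"
          using elim t by (auto simp: gauss_weight_def ennreal_eq_0_iff)
        then have "G \<mu> \<tau> = G \<nu> \<tau>" unfolding Gg[OF M(1)] Gg[OF M(2)] by simp
        then show "(\<integral>\<^sup>+x. ennreal (gauss_bump \<tau> x) \<partial>borel_extension \<mu>) = (\<integral>\<^sup>+x. ennreal (gauss_bump \<tau> x) \<partial>borel_extension \<nu>)"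
          unfolding G_def by (simp add: borel_extension(3)[OF M(1)] borel_extension(3)[OF M(2)])
      qed
    qed
  qed
qed

section \<open>Upper bounds for the infimum\<close>

text \<open>The repulsion in \<open>V\<close>, but valued in \<open>ennreal\<close>, where
  expectations and Fatou's lemma need no conditions on sign or finiteness.\<close>

definition pair_energy :: "nat \<Rightarrow> (nat \<Rightarrow> real^3) \<Rightarrow> ennreal" where
  "pair_energy n x = (\<Sum>i=1..n. \<Sum>j=i+1..n. 1 / ennreal (norm (x i - x j)))"

lemma ereal_inverse_norm: "1 / ereal (norm (u :: real^3)) = enn2ereal (1 / ennreal (norm u))"
proof (cases "u = 0")
  case True
  then show ?thesis by (simp add: zero_ereal_def[symmetric] divide_ennreal_def)
next
  case False
  then have "1 / ennreal (norm u) = ennreal (1 / norm u)"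
    using divide_ennreal[of 1 "norm u"] by simp
  then show ?thesis using False by (simp add: one_ereal_def divide_ereal_def inverse_eq_divide)
qed

lemma V_eq:
  "V M R n Z x = ereal (\<Sum>i=1..n. nuclear_potential M R Z (x i)) + enn2ereal (pair_energy n x)"
  unfolding V_def pair_energy_def ereal_inverse_norm
  by (simp add: sum_enn2ereal)

text \<open>A function exceeding its mean almost everywhere would have a strictly larger integral
  than the mean. An infinite mean is excluded first, since nothing exceeds
  \<open>top\<close>.\<close>

lemma prob_exists_le_nn_integral:
  assumes "prob_space P" "f \<in> borel_measurable P" "AE y in P. y \<in> B"
  shows "\<exists>y\<in>B. f y \<le> (\<integral>\<^sup>+y. f y \<partial>P)"
proof (rule ccontr)
  interpret prob_space P by fact
  note [measurable] = assms(2)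
  define I where "I = (\<integral>\<^sup>+y. f y \<partial>P)"
  assume "\<not> (\<exists>y\<in>B. f y \<le> (\<integral>\<^sup>+y. f y \<partial>P))"
  then have *: "AE y in P. I < f y"
    using assms(3) by (auto elim!: eventually_mono simp: I_def not_le)
  have "I < top"
  proof (rule ccontr)
    assume "\<not> I < top"
    then have "I = top" using less_top by blast
    with * have "AE y in P. False" by simp
    then show False by (simp add: AE_False)
  qed
  moreover have "\<not> (AE y in P. f y \<le> I)"
  proof
    assume "AE y in P. f y \<le> I"
    with * have "AE y in P. False" by eventually_elim simp
    then show False by (simp add: AE_False)
  qed
  ultimately have "(\<integral>\<^sup>+y. I \<partial>P) < (\<integral>\<^sup>+y. f y \<partial>P)"
    using * by (intro nn_integral_less) (auto simp: emeasure_space_1 elim!: eventually_mono)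
  then show False by (simp add: I_def[symmetric] emeasure_space_1)
qed

text \<open>
  Choosing the points one at a time avoids product measures: each chosen point \<open>y\<close> adds \<open>K x y\<close> to the
  external potential \<open>u\<close> felt by the remaining ones.
\<close>
lemma exists_configuration_le_expectation:
  fixes K :: "'a \<Rightarrow> 'a \<Rightarrow> ennreal"
  assumes P: "prob_space P" and K: "case_prod K \<in> borel_measurable (P \<Otimes>\<^sub>M P)"
    and sym: "\<And>x y. K x y = K y x"
    and B: "AE y in P. y \<in> B"
    and u: "u \<in> borel_measurable P"
  shows "\<exists>x. (\<forall>i\<in>{1..n}. x i \<in> B) \<and>
    (\<Sum>i=1..n. u (x i)) + (\<Sum>i=1..n. \<Sum>j=i+1..n. K (x i) (x j))
      \<le> of_nat n * (\<integral>\<^sup>+y. u y \<partial>P) + of_nat (n choose 2) * (\<integral>\<^sup>+x. \<integral>\<^sup>+y. K x y \<partial>P \<partial>P)"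
  using u
proof (induction n arbitrary: u)
  case (Suc n)
  interpret prob_space P by fact
  note [measurable] = Suc.prems
  have K1: "(\<lambda>y. K x y) \<in> borel_measurable P" if "x \<in> space P" for x
    using measurable_compose[OF measurable_Pair[OF measurable_const[OF that] measurable_ident_sets[OF refl]] K]
    by simp
  define k where "k x = (\<integral>\<^sup>+y. K x y \<partial>P)" for x
  have [measurable]: "k \<in> borel_measurable P"
    unfolding k_def using K by (intro borel_measurable_nn_integral) auto
  \<comment> \<open>Once \<open>y\<close> is fixed, each of the \<open>n\<close> remaining points
    interacts with it by \<open>k y\<close> on average, so \<open>y\<close> is chosen to keep the
    sum of both costs at or below its mean.\<close>
  have "\<exists>y\<in>B \<inter> space P. u y + of_nat n * k y \<le> (\<integral>\<^sup>+y. u y + of_nat n * k y \<partial>P)"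
    using B by (intro prob_exists_le_nn_integral P) auto
  then obtain y where y: "y \<in> B" "y \<in> space P"
    and le: "u y + of_nat n * k y \<le> (\<integral>\<^sup>+y. u y \<partial>P) + of_nat n * (\<integral>\<^sup>+y. k y \<partial>P)"
    by (auto simp: nn_integral_add nn_integral_cmult)
  have [measurable]: "(\<lambda>x. K x y) \<in> borel_measurable P"
    unfolding sym[of _ y] using y by (intro K1)
  obtain x where x: "\<forall>i\<in>{1..n}. x i \<in> B" and
    IH: "(\<Sum>i=1..n. u (x i) + K (x i) y) + (\<Sum>i=1..n. \<Sum>j=i+1..n. K (x i) (x j))
      \<le> of_nat n * (\<integral>\<^sup>+x. u x + K x y \<partial>P) + of_nat (n choose 2) * (\<integral>\<^sup>+x. k x \<partial>P)"
    using Suc.IH[of "\<lambda>x. u x + K x y"] unfolding k_def by auto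
  have ky: "(\<integral>\<^sup>+x. K x y \<partial>P) = k y" unfolding k_def sym[of _ y] ..
  define x' where "x' = x(Suc n := y)"
  have x'i: "x' i = x i" if "i \<le> n" for i using that by (simp add: x'_def)
  have x'n: "x' (Suc n) = y" by (simp add: x'_def)
  have "(\<Sum>i=1..Suc n. u (x' i)) + (\<Sum>i=1..Suc n. \<Sum>j=i+1..Suc n. K (x' i) (x' j))
     = u y + ((\<Sum>i=1..n. u (x i) + K (x i) y) + (\<Sum>i=1..n. \<Sum>j=i+1..n. K (x i) (x j)))"
    by (simp add: sum.distrib x'i x'n ac_simps)
  also have "\<dots> \<le> u y + (of_nat n * (\<integral>\<^sup>+x. u x + K x y \<partial>P) + of_nat (n choose 2) * (\<integral>\<^sup>+x. k x \<partial>P))"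
    by (intro add_left_mono IH)
  also have "\<dots> = of_nat n * (\<integral>\<^sup>+x. u x \<partial>P) + of_nat (n choose 2) * (\<integral>\<^sup>+x. k x \<partial>P) + (u y + of_nat n * k y)"
    by (simp add: nn_integral_add ky distrib_left ac_simps)
  also have "\<dots> \<le> of_nat n * (\<integral>\<^sup>+x. u x \<partial>P) + of_nat (n choose 2) * (\<integral>\<^sup>+x. k x \<partial>P) + ((\<integral>\<^sup>+y. u y \<partial>P) + of_nat n * (\<integral>\<^sup>+y. k y \<partial>P))"
    by (intro add_left_mono le)
  \<comment> \<open>Pascal's rule: \<open>n\<close> pairs contain the new point and
    \<open>n choose 2\<close> do not.\<close>
  also have "\<dots> = of_nat (Suc n) * (\<integral>\<^sup>+x. u x \<partial>P) + of_nat (Suc n choose 2) * (\<integral>\<^sup>+x. k x \<partial>P)"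
    by (simp add: numeral_2_eq_2 algebra_simps)
  finally have "(\<Sum>i=1..Suc n. u (x' i)) + (\<Sum>i=1..Suc n. \<Sum>j=i+1..Suc n. K (x' i) (x' j))
    \<le> of_nat (Suc n) * (\<integral>\<^sup>+x. u x \<partial>P) + of_nat (Suc n choose 2) * (\<integral>\<^sup>+x. \<integral>\<^sup>+y. K x y \<partial>P \<partial>P)"
    unfolding k_def .
  moreover have "\<forall>i\<in>{1..Suc n}. x' i \<in> B"
    using x y by (auto simp: x'_def)
  ultimately show ?case by blast
qed simp

lemma nuclear_potential_nonpos:
  "(\<And>\<alpha>. \<alpha> \<in> {1..M} \<Longrightarrow> Z \<alpha> > 0) \<Longrightarrow> nuclear_potential M R Z x \<le> 0"
  unfolding nuclear_potential_def by (intro sum_nonpos) (simp add: less_imp_le)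

text \<open>A point added far away is repelled arbitrarily little by the others, and its attraction
  to the nuclei only lowers the energy.\<close>

lemma INF_V_Suc_le:
  assumes Z: "\<And>\<alpha>. \<alpha> \<in> {1..M} \<Longrightarrow> Z \<alpha> > 0"
  shows "(INF y\<in>admissible M R d (Suc n). V M R (Suc n) Z y) \<le> (INF y\<in>admissible M R d n. V M R n Z y)"
proof (rule INF_greatest, rule ereal_le_epsilon2)
  fix x and \<epsilon> :: real assume x: "x \<in> admissible M R d n" and \<epsilon>: "0 < \<epsilon>"
  \<comment> \<open>At distance at least \<open>L\<close> from all points and nuclei, the new point
    is admissible by \<open>L \<ge> d\<close> and adds at most \<open>n / L \<le> \<epsilon>\<close>
    to the repulsion; the numerator \<open>n + 1\<close> keeps \<open>L\<close> positive for
    \<open>n = 0\<close>.\<close>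
  define L where "L = max (\<bar>d\<bar>) ((real n + 1) / \<epsilon>)"
  have L: "L > 0" "L \<ge> d" "real n / L \<le> \<epsilon>"
  proof -
    have q: "0 < (real n + 1) / \<epsilon>" using \<epsilon> by simp
    then show "L > 0" by (simp add: L_def)
    show "L \<ge> d" by (simp add: L_def)
    have "real n / L \<le> real n / ((real n + 1) / \<epsilon>)"
      using q by (intro divide_left_mono mult_pos_pos) (auto simp: L_def less_max_iff_disj)
    also have "\<dots> = \<epsilon> * (real n / (real n + 1))" using \<epsilon> by simp
    also have "\<dots> \<le> \<epsilon>" using \<epsilon> by (intro mult_left_le) auto
    finally show "real n / L \<le> \<epsilon>" .
  qed
  have "bounded (x ` {1..n} \<union> R ` {1..M})" by (intro finite_imp_bounded) auto
  then obtain \<rho> where \<rho>: "\<And>p. p \<in> x ` {1..n} \<union> R ` {1..M} \<Longrightarrow> norm p \<le> \<rho>"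
    by (auto simp: bounded_iff)
  obtain y :: "real^3" where y: "norm y = \<bar>\<rho>\<bar> + L"
    using L vector_choose_size[of "\<bar>\<rho>\<bar> + L"] by auto
  have far: "norm (y - p) \<ge> L" "norm (p - y) \<ge> L" if "p \<in> x ` {1..n} \<union> R ` {1..M}" for p
    using \<rho>[OF that] y norm_triangle_ineq2[of y p] by (auto simp: norm_minus_commute)
  define x' where "x' = x(Suc n := y)"
  have x'i: "x' i = x i" if "i \<le> n" for i using that by (simp add: x'_def)
  have x'n: "x' (Suc n) = y" by (simp add: x'_def)
  have adm: "x' \<in> admissible M R d (Suc n)"
    using x far L unfolding admissible_def x'_def by (auto intro: order_trans)
  have "pair_energy (Suc n) x' = pair_energy n x + (\<Sum>i=1..n. 1 / ennreal (norm (x i - y)))"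
    by (simp add: pair_energy_def sum.distrib x'i x'n)
  also have "\<dots> \<le> pair_energy n x + (\<Sum>i=1..n. ennreal (1 / L))"
  proof (intro add_left_mono sum_mono)
    fix i assume "i \<in> {1..n}"
    then have "L \<le> norm (x i - y)" using far by auto
    then have "1 / ennreal (norm (x i - y)) = ennreal (1 / norm (x i - y))"
      using L divide_ennreal[of 1 "norm (x i - y)"] by (metis ennreal_1 less_le_trans zero_le_one)
    also have "\<dots> \<le> ennreal (1 / L)"
      using L \<open>L \<le> norm (x i - y)\<close> by (intro ennreal_leI divide_left_mono mult_pos_pos) linarith+
    finally show "1 / ennreal (norm (x i - y)) \<le> ennreal (1 / L)" .
  qed
  also have "(\<Sum>i=1..n. ennreal (1 / L)) = ennreal (real n / L)"
    using L by (simp add: ennreal_of_nat_eq_real_of_nat ennreal_mult'[symmetric])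
  also have "pair_energy n x + ennreal (real n / L) \<le> pair_energy n x + ennreal \<epsilon>"
    by (intro add_left_mono ennreal_leI L)
  finally have pe: "enn2ereal (pair_energy (Suc n) x') \<le> enn2ereal (pair_energy n x) + ereal \<epsilon>"
    using \<epsilon> by (simp add: less_eq_ennreal.rep_eq plus_ennreal.rep_eq)
  have "(INF y\<in>admissible M R d (Suc n). V M R (Suc n) Z y) \<le> V M R (Suc n) Z x'"
    by (rule INF_lower[OF adm])
  also have "\<dots> \<le> ereal (\<Sum>i=1..n. nuclear_potential M R Z (x i)) + (enn2ereal (pair_energy n x) + ereal \<epsilon>)"
    unfolding V_eq using nuclear_potential_nonpos[OF Z, where x=y]
    by (intro add_mono pe) (auto simp: x'i x'n)
  also have "\<dots> = V M R n Z x + ereal \<epsilon>"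
    unfolding V_eq by (simp add: add.assoc)
  finally show "(INF y\<in>admissible M R d (Suc n). V M R (Suc n) Z y) \<le> V M R n Z x + ereal \<epsilon>" .
qed

lemma INF_V_le:
  assumes Z: "\<And>\<alpha>. \<alpha> \<in> {1..M} \<Longrightarrow> Z \<alpha> > 0" and "n \<le> N" "x \<in> admissible M R d n"
  shows "(INF y\<in>admissible M R d N. V M R N Z y) \<le> V M R n Z x"
proof -
  have "(INF y\<in>admissible M R d N. V M R N Z y) \<le> (INF y\<in>admissible M R d n. V M R n Z y)"
    by (rule lift_Suc_antimono_le[OF _ \<open>n \<le> N\<close>]) (rule INF_V_Suc_le[OF Z])
  also have "\<dots> \<le> V M R n Z x" by (rule INF_lower) fact
  finally show ?thesis .
qed

section \<open>Compactness of empirical measures\<close>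

definition binary_digit :: "nat \<Rightarrow> real \<Rightarrow> int" where
  "binary_digit k y = \<lfloor>2 ^ Suc k * y\<rfloor> - 2 * \<lfloor>2 ^ k * y\<rfloor>"

lemma binary_digit_cases: "binary_digit k y = 0 \<or> binary_digit k y = 1"
proof -
  have e: "2 ^ Suc k * y = 2 * (2 ^ k * y)" by simp
  define r where "r = 2 ^ k * y"
  have "0 \<le> \<lfloor>2 * r\<rfloor> - 2 * \<lfloor>r\<rfloor>" "\<lfloor>2 * r\<rfloor> - 2 * \<lfloor>r\<rfloor> < 2" by linarith+
  then show ?thesis unfolding binary_digit_def e r_def[symmetric] by linarith
qed

text \<open>The partial sums telescope to \<open>\<lfloor>2 ^ n * y\<rfloor> / 2 ^ n\<close>; the
  start of the telescope is \<open>\<lfloor>y\<rfloor> = 0\<close>, which is where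
  \<open>y < 1\<close> enters.\<close>

lemma binary_digit_sums:
  assumes "0 \<le> y" "y < 1"
  shows "(\<lambda>k. (1/2) ^ Suc k * real_of_int (binary_digit k y)) sums y"
proof -
  have part: "(\<Sum>k<n. (1/2) ^ Suc k * real_of_int (binary_digit k y)) = \<lfloor>2 ^ n * y\<rfloor> / 2 ^ n" for n
  proof (induction n)
    case 0
    then show ?case using assms by (simp add: floor_eq_iff)
  next
    case (Suc n)
    then show ?case
      by (simp add: binary_digit_def field_simps)
  qed
  have "(\<lambda>n. y - \<lfloor>2 ^ n * y\<rfloor> / 2 ^ n) \<longlonglongrightarrow> 0"
  proof (rule tendsto_sandwich[OF _ _ tendsto_const])
    show "(\<lambda>n. (1/2::real) ^ n) \<longlonglongrightarrow> 0" by (simp add: LIMSEQ_power_zero)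
    have "y - \<lfloor>2 ^ n * y\<rfloor> / 2 ^ n = (2 ^ n * y - \<lfloor>2 ^ n * y\<rfloor>) * (1/2) ^ n" for n
      by (simp add: field_simps)
    moreover have "0 \<le> 2 ^ n * y - \<lfloor>2 ^ n * y\<rfloor>" "2 ^ n * y - \<lfloor>2 ^ n * y\<rfloor> \<le> 1" for n by linarith+
    ultimately show "\<forall>\<^sub>F n in sequentially. 0 \<le> y - \<lfloor>2 ^ n * y\<rfloor> / 2 ^ n"
      "\<forall>\<^sub>F n in sequentially. y - \<lfloor>2 ^ n * y\<rfloor> / 2 ^ n \<le> (1/2) ^ n"
      by (auto intro!: always_eventually mult_left_le_one_le)
  qed
  then have "(\<lambda>n. y - (y - \<lfloor>2 ^ n * y\<rfloor> / 2 ^ n)) \<longlonglongrightarrow> y - 0" by (intro tendsto_intros)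
  then show ?thesis unfolding sums_def part by simp
qed

text \<open>
  This has period 2, is 0 on \<open>{0..1/3}\<close> and 1 on \<open>{2/3..1}\<close>, hence at \<open>3 ^ i * t\<close> it reads off the ternary
  digit number \<open>i\<close> of \<open>t\<close> when all digits are 0 or 2. Schoenberg's curve has the components
  \<open>\<Sum>k. 2 ^ (- k - 1) * schoenberg_wave (3 ^ (k * n + j) * t)\<close>.
\<close>
definition schoenberg_wave :: "real \<Rightarrow> real" where
  "schoenberg_wave t = max 0 (min 1 (1/2 - cos (pi * t)))"

text \<open>The cosine is at least \<open>1/2\<close> up to angle \<open>pi / 3\<close> and at most
  \<open>-1/2\<close> from \<open>2 * pi / 3\<close> to \<open>pi\<close>, so clipping
  \<open>1/2 - cos\<close> to the unit interval gives exactly 0 or 1; even integers are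
  periods.\<close>

lemma schoenberg_wave_digit:
  fixes a m :: int
  assumes "a = 0 \<or> a = 1" and r: "0 \<le> r" "r \<le> 1/3"
  shows "schoenberg_wave (2 * a / 3 + r + 2 * m) = a"
proof -
  have "pi * (2 * a / 3 + r + 2 * m) = pi * (2 * a / 3 + r) + of_int m * (2 * pi)"
    by (simp add: algebra_simps)
  then have c: "cos (pi * (2 * a / 3 + r + 2 * m)) = cos (pi * (2 * a / 3 + r))"
    using cos.plus_of_int[of "pi * (2 * a / 3 + r)" m] by simp
  show ?thesis
    using assms(1)
  proof
    assume a: "a = 0"
    have "cos (pi / 3) \<le> cos (pi * r)"
      using r by (intro cos_monotone_0_pi_le) auto
    then show ?thesis unfolding schoenberg_wave_def c using a by (simp add: cos_60)
  next
    assume a: "a = 1"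
    have "pi / 3 \<le> pi * (2/3 + r) \<and> pi * (2/3 + r) \<le> pi"
      using r mult_left_mono[of "2/3 + r" 1 pi] by (auto simp: algebra_simps)
    moreover have "pi * (2/3 + r) \<ge> pi * (2/3)" using r by simp
    ultimately have "cos (pi * (2/3 + r)) \<le> cos (pi * (2/3))"
      by (intro cos_monotone_0_pi_le) auto
    moreover have "cos (pi * (2/3)) = -1/2"
      using cos_120 by (simp add: mult.commute)
    ultimately show ?thesis unfolding schoenberg_wave_def c using a by simp
  qed
qed

text \<open>\<open>t i\<close> is the number whose ternary digits are twice the sequence
  \<open>a\<close> from place \<open>i\<close> on. Multiplying by 3 shifts it and releases the even
  integer \<open>2 * a i\<close>, so \<open>3 ^ i * t 0\<close> and \<open>t i\<close> differ by a
  period of the wave.\<close>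

lemma exists_ternary_expansion:
  fixes a :: "nat \<Rightarrow> int"
  assumes "\<And>i. a i = 0 \<or> a i = 1"
  shows "\<exists>t\<in>{0..1}. \<forall>i. schoenberg_wave (3 ^ i * t) = a i"
proof -
  define t where "t i = (\<Sum>l. 2 * a (i + l) / 3 ^ Suc l :: real)" for i
  have geo: "(\<lambda>l. 2 / 3 ^ Suc l :: real) sums 1"
    using sums_mult[OF geometric_sums[of "1/3::real"], of "2/3"] by (simp add: power_divide field_simps)
  have le: "2 * a (i + l) / 3 ^ Suc l \<le> 2 / (3 ^ Suc l :: real)" "0 \<le> 2 * a (i + l) / (3 ^ Suc l :: real)" for i l
    using assms[of "i + l"] by auto
  have sm: "summable (\<lambda>l. 2 * a (i + l) / 3 ^ Suc l :: real)" for i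
  proof (rule summable_comparison_test'[OF sums_summable[OF geo], of 0])
    show "norm (2 * a (i + l) / 3 ^ Suc l :: real) \<le> 2 / 3 ^ Suc l" for l
      using assms[of "i + l"] by auto
  qed
  have t01: "0 \<le> t i" "t i \<le> 1" for i
    using suminf_nonneg[OF sm le(2)] suminf_le[OF le(1) sm sums_summable[OF geo]] sums_unique[OF geo]
    unfolding t_def by auto
  have rec: "t i = 2 * a i / 3 + t (Suc i) / 3" for i
  proof -
    have "t i = (\<Sum>l. 2 * a (i + Suc l) / 3 ^ Suc (Suc l) :: real) + 2 * a i / 3"
      using suminf_split_head[OF sm, of i] unfolding t_def by simp
    also have "(\<Sum>l. 2 * a (i + Suc l) / 3 ^ Suc (Suc l) :: real) = (\<Sum>l. (2 * a (Suc i + l) / 3 ^ Suc l) / 3 :: real)"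
      by (simp add: mult.commute)
    also have "\<dots> = t (Suc i) / 3" unfolding t_def by (rule suminf_divide[OF sm])
    finally show ?thesis by simp
  qed
  have "\<exists>m::int. 3 ^ i * t 0 = t i + 2 * m" for i
  proof (induction i)
    case (Suc i)
    then obtain m :: int where "3 ^ i * t 0 = t i + 2 * m" by auto
    then have "3 ^ Suc i * t 0 = 3 * t i + 6 * m" by simp
    also have "\<dots> = t (Suc i) + 2 * of_int (a i + 3 * m)" using rec[of i] by simp
    finally show ?case by blast
  qed (auto intro: exI[of _ 0])
  then obtain m :: "nat \<Rightarrow> int" where "3 ^ i * t 0 = t i + 2 * real_of_int (m i)" for i by metis
  then have "schoenberg_wave (3 ^ i * t 0) = a i" for i
    using schoenberg_wave_digit[OF assms, of "t (Suc i) / 3" i "m i"] t01[of "Suc i"] rec[of i] by simp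
  then show ?thesis using t01[of 0] by (intro bexI[of _ "t 0"]) auto
qed

text \<open>The binary digits of all coordinates are interleaved into one sequence, which a single
  parameter encodes as ternary digits; each component of the curve reads its own digits back.
  Continuity is the Weierstrass test.\<close>

lemma exists_space_filling_curve:
  "\<exists>c :: real \<Rightarrow> real^'n. continuous_on UNIV c \<and> ball 0 1 \<subseteq> c ` {0..1}"
proof -
  let ?n = "CARD('n)"
  obtain h :: "'n \<Rightarrow> nat" where h: "bij_betw h UNIV {0..<?n}"
    using ex_bij_betw_finite_nat[of "UNIV :: 'n set"] by auto
  have hlt: "h j < ?n" for j using h by (auto simp: bij_betw_def)
  have w01: "0 \<le> schoenberg_wave t" "schoenberg_wave t \<le> 1" for t by (auto simp: schoenberg_wave_def)
  define f where "f j k t = (1/2) ^ Suc k * schoenberg_wave (3 ^ (k * ?n + h j) * t)" for j k t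
  define c where "c t = (\<chi> j. 2 * (\<Sum>k. f j k t) - 1)" for t
  have "continuous_on UNIV (\<lambda>t. \<Sum>k. f j k t)" for j
  proof (rule uniform_limit_theorem[OF always_eventually])
    show "\<forall>n. continuous_on UNIV (\<lambda>t. \<Sum>k<n. f j k t)"
      unfolding f_def schoenberg_wave_def by (intro allI continuous_intros)
    show "uniform_limit UNIV (\<lambda>n t. \<Sum>k<n. f j k t) (\<lambda>t. \<Sum>k. f j k t) sequentially"
    proof (rule Weierstrass_m_test)
      show "norm (f j k t) \<le> (1/2) ^ Suc k" for k t
        using w01[of "3 ^ (k * ?n + h j) * t"] by (simp add: f_def abs_mult mult_left_le)
    qed (auto intro!: summable_geometric simp: summable_Suc_iff simp del: power_Suc)
  qed auto
  then have "continuous_on UNIV c"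
    unfolding c_def by (intro continuous_intros)
  moreover have "y \<in> c ` {0..1}" if y: "y \<in> ball 0 1" for y
  proof -
    define v where "v j = (y $ j + 1) / 2" for j
    have v: "0 \<le> v j" "v j < 1" for j
      using component_le_norm_cart[of y j] y by (auto simp: v_def abs_le_iff)
    \<comment> \<open>Place \<open>k * ?n + h j\<close> holds digit \<open>k\<close> of coordinate
      \<open>j\<close>; quotient and remainder by \<open>?n\<close> recover both.\<close>
    define a where "a i = binary_digit (i div ?n) (v (inv_into UNIV h (i mod ?n)))" for i
    obtain t where t01: "t \<in> {0..1}" and t: "\<And>i. schoenberg_wave (3 ^ i * t) = a i"
      using exists_ternary_expansion[of a] binary_digit_cases unfolding a_def by blast
    have "a (k * ?n + h j) = binary_digit k (v j)" for k j
      using hlt[of j] h by (simp add: a_def bij_betw_def)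
    then have "(\<lambda>k. f j k t) = (\<lambda>k. (1/2) ^ Suc k * real_of_int (binary_digit k (v j)))" for j
      by (simp add: f_def t)
    then have sumv: "(\<Sum>k. f j k t) = v j" for j
      using sums_unique[OF binary_digit_sums[OF v, of j]] by simp
    have "2 * (\<Sum>k. f j k t) - 1 = y $ j" for j unfolding sumv v_def by (simp add: field_simps)
    then have "c t = y" by (simp add: c_def vec_eq_iff)
    then show ?thesis using t01 by blast
  qed
  ultimately show ?thesis by blast
qed

text \<open>
  The map \<open>h\<close> embeds the space into its unit ball, which the curve \<open>c\<close> covers; mass of the limit on the
  unit sphere has escaped to infinity and is not seen by functions vanishing there.
\<close>
lemma point_masses_compact:
  fixes A :: "(real^'n) set" and x :: "nat \<Rightarrow> nat \<Rightarrow> real^'n"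
  assumes A: "closed A" and N: "\<And>k. N k \<ge> 1" and x: "\<And>k i. i \<in> {1..N k} \<Longrightarrow> x k i \<in> A"
  shows "\<exists>r \<mu>. strict_mono r \<and> sets \<mu> = sets (restrict_space borel A) \<and> finite_measure \<mu> \<and>
     measure \<mu> (space \<mu>) \<le> 1 \<and>
     (\<forall>f :: real^'n \<Rightarrow> real. continuous_on A f \<longrightarrow> (f \<longlongrightarrow> 0) (inf at_infinity (principal A)) \<longrightarrow>
       (\<lambda>k. (\<Sum>i=1..N (r k). f (x (r k) i)) / real (N (r k))) \<longlonglongrightarrow> (\<integral>y. f y \<partial>\<mu>))"
proof -
  obtain c :: "real \<Rightarrow> real^'n" where c: "continuous_on UNIV c" "ball 0 1 \<subseteq> c ` {0..1}"
    using exists_space_filling_curve by blast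
  define h :: "real^'n \<Rightarrow> real^'n" where "h p = (1 / (1 + norm p)) *\<^sub>R p" for p
  define h' :: "real^'n \<Rightarrow> real^'n" where "h' u = (1 / (1 - norm u)) *\<^sub>R u" for u
  have nh: "norm (h p) = norm p / (1 + norm p)" for p
    by (simp add: h_def)
  have nh1: "norm (h p) < 1" for p
    unfolding nh by (simp add: add_pos_nonneg)
  have h'h: "h' (h p) = p" for p
  proof -
    have "1 - norm (h p) = 1 / (1 + norm p)" 
      unfolding nh by (simp add: diff_eq_eq add_divide_distrib[symmetric] add_nonneg_eq_0_iff)
    then show ?thesis by (simp add: h'_def h_def add_nonneg_eq_0_iff)
  qed
  have hh': "h (h' u) = u" if "norm u < 1" for u
  proof -
    have "norm (h' u) = norm u / (1 - norm u)" using that by (simp add: h'_def)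
    then have "1 + norm (h' u) = 1 / (1 - norm u)" using that by (simp add: field_simps)
    then show ?thesis unfolding h_def using that by (simp add: h'_def)
  qed
  have cont_h': "continuous_on (ball 0 1) h'"
    unfolding h'_def by (intro continuous_intros) auto
  \<comment> \<open>\<open>D\<close> is the image of \<open>A\<close> under \<open>h\<close>. Adding
    the whole unit sphere makes it closed, whichever directions \<open>A\<close> takes to
    infinity.\<close>
  define D where "D = {u \<in> ball 0 1. h' u \<in> A}"
  define H where "H = D \<union> sphere 0 1"
  have DA: "D = h ` A"
    unfolding D_def using nh1 h'h hh' by (auto simp: image_iff) metis
  have "closedin (top_of_set (ball 0 1)) D"
    using continuous_closedin_preimage[OF cont_h' A] by (simp add: D_def vimage_def Int_def)
  then obtain T where T: "closed T" "D = ball 0 1 \<inter> T" by (auto simp: closedin_closed)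
  have H: "closed H"
  proof -
    have "H = (cball 0 1 \<inter> T) \<union> sphere 0 1" unfolding H_def T by (auto simp: less_le)
    then show ?thesis using T by auto
  qed
  have Hne: "H \<noteq> {}"
    unfolding H_def using vector_choose_size[of 1] by (auto simp: sphere_def dist_norm)
  have Hball: "H \<inter> ball 0 1 = D" by (auto simp: H_def D_def)
  have "\<exists>s\<in>{0..1}. c s = h p" for p
  proof -
    have "h p \<in> ball 0 1" using nh1 by simp
    then show ?thesis using c(2) by (auto simp: subset_iff image_iff) metis
  qed
  \<comment> \<open>Parameters are merely chosen, so \<open>s'\<close> may fail to be measurable; it
    is only composed with maps from finite index sets, where every function is measurable.\<close>
  then obtain s' where s': "\<And>p. s' p \<in> {0..1}" "\<And>p. c (s' p) = h p" by metis
  have s'': "-1 < s' p" "s' p \<le> 1" for p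
    using s'(1)[of p] by auto
  define Q where "Q k = distr (uniform_count_measure {1..N k}) borel (\<lambda>i. s' (x k i))" for k
  have meas_s [measurable]: "(\<lambda>i. s' (x k i)) \<in> uniform_count_measure {1..N k} \<rightarrow>\<^sub>M borel" for k
    by (subst measurable_cong_sets[OF sets_uniform_count_measure_count_space refl]) simp
  have Q: "real_distribution (Q k)" for k
    unfolding Q_def using N[of k]
    by (intro prob_space.real_distribution_distr prob_space_uniform_count_measure meas_s) auto
  have intQ: "(\<integral>t. g t \<partial>Q k) = (\<Sum>i=1..N k. g (s' (x k i))) / real (N k)"
    if "g \<in> borel_measurable borel" for g :: "real \<Rightarrow> real" and k
    unfolding Q_def integral_distr[OF meas_s that] by (simp add: integral_uniform_count_measure)
  have "tight Q"
    unfolding tight_def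
  proof (intro conjI allI impI Q)
    fix \<epsilon> :: real assume "0 < \<epsilon>"
    \<comment> \<open>Tightness is automatic since all parameters lie in \<open>{0..1}\<close>; the
      left end -1 makes the half-open interval contain the parameter 0.\<close>
    have "1 - \<epsilon> < measure (Q k) {-1<..1}" for k
    proof -
    have "measure (Q k) {-1<..1} = measure (uniform_count_measure {1..N k}) {1..N k}"
      unfolding Q_def using s''
      by (subst measure_distr[OF meas_s]) (auto simp: space_uniform_count_measure intro!: arg_cong2[where f=measure])
    also have "\<dots> = 1" using N[of k] by (simp add: measure_uniform_count_measure)
    finally show ?thesis using \<open>0 < \<epsilon>\<close> by simp
    qed
    then show "\<exists>a b. a < b \<and> (\<forall>k. 1 - \<epsilon> < measure (Q k) {a<..b})"
      by (intro exI[of _ "-1"] exI[of _ 1]) simp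
  qed
  from tight_imp_convergent_subsubsequence[OF this strict_mono_id]
  obtain r P where r: "strict_mono r" and P: "real_distribution P" and wc: "weak_conv_m (\<lambda>k. Q (r k)) P"
    by (auto simp: comp_def)
  interpret P: real_distribution P by fact
  have conv: "(\<lambda>k. (\<Sum>i=1..N (r k). g (h (x (r k) i))) / real (N (r k))) \<longlonglongrightarrow> (\<integral>t. g (c t) \<partial>P)"
    if g: "continuous_on UNIV g" "\<And>u. \<bar>g u\<bar> \<le> B" for g :: "real^'n \<Rightarrow> real" and B
  proof -
    have gc: "continuous_on UNIV (\<lambda>t. g (c t))"
      by (rule continuous_on_compose2[OF g(1) c(1)]) auto
    have "(\<lambda>k. \<integral>t. g (c t) \<partial>Q (r k)) \<longlonglongrightarrow> (\<integral>t. g (c t) \<partial>P)"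
      using gc g(2) by (intro weak_conv_imp_integral_bdd_continuous_conv[OF Q P wc, where B=B])
        (auto simp: continuous_on_eq_continuous_at)
    then show ?thesis
      by (subst (asm) intQ) (auto simp: s' intro: borel_measurable_continuous_onI[OF gc])
  qed
  have [measurable]: "c \<in> borel_measurable borel" by (rule borel_measurable_continuous_onI[OF c(1)])
  have [measurable]: "h' \<in> borel_measurable borel" unfolding h'_def by measurable
  have [measurable]: "D \<in> sets borel" "H \<in> sets borel" using T H by auto
  have aeH: "AE t in P. c t \<in> H"
  proof -
    \<comment> \<open>The truncated distance to \<open>H\<close> is bounded, continuous and zero at
      all embedded points, so its integral along the limit vanishes too.\<close>
    define q where "q u = min 1 (infdist u H)" for u
    have q: "continuous_on UNIV q" "\<And>u. \<bar>q u\<bar> \<le> 1" "\<And>u. 0 \<le> q u"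
      unfolding q_def by (auto intro!: continuous_intros simp: infdist_nonneg)
    have "q (h p) = 0" if "p \<in> A" for p
      using that by (simp add: q_def H_def DA)
    then have "(\<lambda>k. (\<Sum>i=1..N (r k). q (h (x (r k) i))) / real (N (r k))) = (\<lambda>k. 0)"
      using x by (intro ext) (simp add: sum.neutral)
    with conv[OF q(1,2)] have "(\<integral>t. q (c t) \<partial>P) = 0"
      using LIMSEQ_unique[OF _ tendsto_const] by metis
    moreover have [measurable]: "q \<in> borel_measurable borel" by (rule borel_measurable_continuous_onI[OF q(1)])
    have "integrable P (\<lambda>t. q (c t))"
      by (rule P.integrable_const_bound[where B=1]) (auto simp: q(2))
    ultimately have "AE t in P. q (c t) = 0"
      using q(3) by (subst (asm) integral_nonneg_eq_0_iff_AE) auto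
    then show ?thesis
    proof eventually_elim
      case (elim t)
      then have "infdist (c t) H = 0" by (simp add: q_def min_def split: if_splits)
      then show "c t \<in> H" using in_closed_iff_infdist_zero[OF H Hne] by simp
    qed
  qed
  \<comment> \<open>Restricting \<open>P\<close> to the parameters that hit \<open>D\<close>
    discards the mass which the limit puts on the sphere; hence total mass at most 1 instead of
    equal to 1.\<close>
  define U where "U = c -` D"
  have [measurable]: "U \<in> sets borel" unfolding U_def using measurable_sets[of c borel borel D] by simp
  have US: "U \<inter> space P \<in> sets P" by simp
  have meas: "(\<lambda>t. h' (c t)) \<in> restrict_space P U \<rightarrow>\<^sub>M restrict_space borel A"
    by (rule measurable_restrict_space2)
      (auto simp: space_restrict_space U_def D_def intro!: measurable_restrict_space1)
  define \<mu> where "\<mu> = distr (restrict_space P U) (restrict_space borel A) (\<lambda>t. h' (c t))"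
  have fin: "finite_measure (restrict_space P U)"
    by (rule finite_measure_restrict_space) (use US P.finite_measure_axioms in auto)
  have "finite_measure \<mu>" unfolding \<mu>_def by (rule finite_measure.finite_measure_distr[OF fin meas])
  moreover have "sets \<mu> = sets (restrict_space borel A)" unfolding \<mu>_def by simp
  moreover have "measure \<mu> (space \<mu>) \<le> 1"
  proof -
    have "(\<lambda>t. h' (c t)) -` A \<inter> U = U" by (auto simp: U_def D_def)
    then have "measure \<mu> (space \<mu>) = measure (restrict_space P U) U"
      unfolding \<mu>_def using A by (subst measure_distr[OF meas]) (auto simp: space_restrict_space sets_restrict_space_iff)
    also have "\<dots> = measure P U" by (rule measure_restrict_space) auto
    finally show ?thesis by simp
  qed
  moreover have "(\<lambda>k. (\<Sum>i=1..N (r k). f (x (r k) i)) / real (N (r k))) \<longlonglongrightarrow> (\<integral>y. f y \<partial>\<mu>)"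
    if f: "continuous_on A f" and f0: "(f \<longlongrightarrow> 0) (inf at_infinity (principal A))" for f :: "real^'n \<Rightarrow> real"
  proof -
    \<comment> \<open>The test function transported to the ball and set to zero on the sphere. Its
      continuity at the sphere is precisely the vanishing of \<open>f\<close> at infinity.\<close>
    define F where "F u = (if u \<in> D then f (h' u) else 0)" for u
    have "continuous_on H F"
      unfolding continuous_on_def
    proof
      fix u assume u: "u \<in> H"
      show "(F \<longlongrightarrow> F u) (at u within H)"
      proof (cases "u \<in> D")
        case True
        have "continuous_on D (\<lambda>u. f (h' u))"
          by (rule continuous_on_compose2[OF f continuous_on_subset[OF cont_h']]) (auto simp: D_def)
        then have "continuous_on D F" by (rule continuous_on_eq) (simp add: F_def)
        then have "(F \<longlongrightarrow> F u) (at u within D)" using True by (auto simp: continuous_on_def)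
        also have "at u within D = at u within H"
          using True Hball by (intro at_within_nhd[of u "ball 0 1"]) (auto simp: D_def)
        finally show ?thesis .
      next
        case False
        then have u1: "norm u = 1" using u by (auto simp: H_def)
        have "(F \<longlongrightarrow> 0) (at u within H)"
        proof (rule tendstoI)
          fix e :: real assume "0 < e"
          with f0 have "\<forall>\<^sub>F p in inf at_infinity (principal A). dist (f p) 0 < e" by (rule tendstoD)
          then obtain b where b: "\<And>p. norm p \<ge> b \<Longrightarrow> p \<in> A \<Longrightarrow> \<bar>f p\<bar> < e"
            by (auto simp: eventually_inf_principal eventually_at_infinity)
          \<comment> \<open>Points of norm \<open>b'\<close> are mapped by \<open>h\<close> to norm
            \<open>b' / (1 + b')\<close>; the absolute value guarantees that this threshold is below
            1.\<close>
          define b' where "b' = \<bar>b\<bar>"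
          have "((\<lambda>v. norm v) \<longlongrightarrow> norm u) (at u within H)" by (intro tendsto_intros)
          then have "\<forall>\<^sub>F v in at u within H. b' / (1 + b') < norm v"
            by (rule order_tendstoD) (simp add: u1 b'_def field_simps)
          then show "\<forall>\<^sub>F v in at u within H. dist (F v) 0 < e"
          proof eventually_elim
            case (elim v)
            show ?case
            proof (cases "v \<in> D")
              case True
              then have v1: "norm v < 1" and vA: "h' v \<in> A" by (auto simp: D_def)
              have "b' < norm v * (1 + b')"
                using elim by (simp add: b'_def pos_divide_less_eq add_pos_nonneg)
              then have "b' * (1 - norm v) \<le> norm v" by (simp add: algebra_simps)
              then have "b' \<le> norm (h' v)"
                using v1 by (simp add: h'_def pos_le_divide_eq)
              then have "b \<le> norm (h' v)" by (simp add: b'_def)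
              then show ?thesis using b vA True by (simp add: F_def)
            qed (simp add: F_def \<open>0 < e\<close>)
          qed
        qed
        then show ?thesis using False by (simp add: F_def)
      qed
    qed
    moreover have "bounded (F ` H)"
    proof (rule compact_imp_bounded, rule compact_continuous_image[OF \<open>continuous_on H F\<close>])
      have "bounded H" unfolding H_def D_def by (rule bounded_subset[OF bounded_cball[of 0 1]]) auto
      then show "compact H" using H by (simp add: compact_eq_bounded_closed)
    qed
    then obtain B where B: "\<And>u. u \<in> H \<Longrightarrow> norm (F u) \<le> B" "0 \<le> B"
      unfolding bounded_pos by (metis imageI less_imp_le)
    \<comment> \<open>Weak convergence on the line needs a test function along the entire curve,
      which may leave \<open>H\<close>, so \<open>F\<close> is extended by Tietze with the same
      bound.\<close>
    ultimately obtain g where g: "continuous_on UNIV g" "\<And>u. u \<in> H \<Longrightarrow> g u = F u" "\<And>u. norm (g u) \<le> B"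
      using Tietze[of H F UNIV B] H by auto
    have "(\<Sum>i=1..N k. g (h (x k i))) = (\<Sum>i=1..N k. f (x k i))" for k
      using x[of _ k] by (intro sum.cong) (auto simp: g F_def H_def DA h'h)
    then have "(\<lambda>k. (\<Sum>i=1..N (r k). f (x (r k) i)) / real (N (r k))) \<longlonglongrightarrow> (\<integral>t. g (c t) \<partial>P)"
      using conv[OF g(1), of B] g(3) by simp
    also have "(\<integral>t. g (c t) \<partial>P) = (\<integral>t. indicator U t *\<^sub>R f (h' (c t)) \<partial>P)"
    proof (rule integral_cong_AE)
      have [measurable]: "g \<in> borel_measurable borel" by (rule borel_measurable_continuous_onI[OF g(1)])
      show "(\<lambda>t. g (c t)) \<in> borel_measurable P" by simp
      have "(\<lambda>t. f (h' (c t))) \<in> borel_measurable (restrict_space P U)"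
        by (rule measurable_compose[OF meas borel_measurable_continuous_on_restrict[OF f]])
      then show "(\<lambda>t. indicator U t *\<^sub>R f (h' (c t))) \<in> borel_measurable P"
        by (subst (asm) borel_measurable_restrict_space_iff) auto
      show "AE t in P. g (c t) = indicator U t *\<^sub>R f (h' (c t))"
        using aeH by eventually_elim (auto simp: g F_def U_def)
    qed
    also have "\<dots> = (\<integral>t. f (h' (c t)) \<partial>restrict_space P U)"
      by (rule integral_restrict_space[symmetric]) (rule US)
    also have "\<dots> = (\<integral>y. f y \<partial>\<mu>)"
      unfolding \<mu>_def by (rule integral_distr[symmetric, OF meas borel_measurable_continuous_on_restrict[OF f]])
    finally show ?thesis .
  qed
  ultimately show ?thesis using r by blast
qed

section \<open>Convergence of approximate minimizers\<close>

lemma filterlim_norm_diff_at_top: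
  fixes a :: "'a::real_normed_vector"
  shows "LIM y at_infinity. norm (y - a) :> at_top"
proof (rule filterlim_at_top_mono[OF _ always_eventually])
  show "LIM y at_infinity. - norm a + norm y :> at_top"
    by (rule filterlim_tendsto_add_at_top[OF tendsto_const filterlim_norm_at_top])
  show "\<forall>y. - norm a + norm y \<le> norm (y - a)"
    using norm_triangle_ineq2[of _ a] by (simp add: algebra_simps)
qed

text \<open>With this, weak-star convergence supplies the convergence of Gaussian transforms that
  \<open>coulomb_energy_liminf\<close> assumes.\<close>

lemma gauss_bump_C0:
  assumes "fst \<tau> > 0"
  shows "gauss_bump \<tau> \<in> C0 A"
proof -
  have "continuous_on A (gauss_bump \<tau>)"
    unfolding gauss_bump_def by (intro continuous_intros)
  moreover have "(gauss_bump \<tau> \<longlongrightarrow> 0) at_infinity"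
    unfolding gauss_bump_def
  proof (rule filterlim_compose[OF exp_at_bot], rule filterlim_tendsto_neg_mult_at_bot[OF tendsto_const])
    show "- 2 * (fst \<tau>)\<^sup>2 < 0" using assms by simp
    show "LIM y at_infinity. (norm (y - snd \<tau>))\<^sup>2 :> at_top"
      by (rule filterlim_pow_at_top[OF _ filterlim_norm_diff_at_top]) simp
  qed
  ultimately show ?thesis
    unfolding C0_def by (auto intro: tendsto_mono[OF inf_le1])
qed

lemma tendsto_subsubsequence:
  fixes X :: "nat \<Rightarrow> 'a::topological_space"
  assumes "\<And>r :: nat \<Rightarrow> nat. strict_mono r \<Longrightarrow> \<exists>r'. strict_mono r' \<and> (\<lambda>k. X (r (r' k))) \<longlonglongrightarrow> L"
  shows "X \<longlonglongrightarrow> L"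
proof (rule topological_tendstoI, rule ccontr)
  fix S assume S: "open S" "L \<in> S" and "\<not> (\<forall>\<^sub>F k in sequentially. X k \<in> S)"
  then have "infinite {k. X k \<notin> S}"
    by (simp add: cofinite_eq_sequentially[symmetric] eventually_cofinite)
  then obtain r :: "nat \<Rightarrow> nat" where r: "strict_mono r" "\<And>k. X (r k) \<notin> S"
    using infinite_enumerate by blast
  with assms obtain r' where "(\<lambda>k. X (r (r' k))) \<longlonglongrightarrow> L" by blast
  then have "\<forall>\<^sub>F k in sequentially. X (r (r' k)) \<in> S" using S by (rule topological_tendstoD)
  then show False using r(2) by simp
qed

locale coulomb_limit =
  fixes M :: nat and R :: "nat \<Rightarrow> real^3" and d lam :: real and z :: "nat \<Rightarrow> real"
    and N :: "nat \<Rightarrow> nat" and Z :: "nat \<Rightarrow> nat \<Rightarrow> real"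
    and x :: "nat \<Rightarrow> nat \<Rightarrow> real^3"
  assumes M: "M \<ge> 1" and d: "d > 0"
    and Z_pos: "\<And>k \<alpha>. \<alpha> \<in> {1..M} \<Longrightarrow> Z k \<alpha> > 0"
    and N_lim: "filterlim N at_top sequentially"
    and Z_lim: "filterlim (\<lambda>k. total_charge M (Z k)) at_top sequentially"
    and lam_lim: "(\<lambda>k. real (N k) / total_charge M (Z k)) \<longlonglongrightarrow> lam" and lam: "lam > 0"
    and z_lim: "\<And>\<alpha>. \<alpha> \<in> {1..M} \<Longrightarrow> (\<lambda>k. Z k \<alpha> / total_charge M (Z k)) \<longlonglongrightarrow> z \<alpha>"
    and approx: "approximate_minimizers M R d N Z x"
begin

abbreviation Zt where "Zt k \<equiv> total_charge M (Z k)"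
abbreviation A where "A \<equiv> - Omega M R d"
abbreviation infV where "infV k \<equiv> (INF y\<in>admissible M R d (N k). V M R (N k) (Z k) y)"

definition W :: "real^3 \<Rightarrow> real" where
  "W y = (\<Sum>\<alpha>=1..M. z \<alpha> / norm (y - R \<alpha>))"

text \<open>The attraction with reversed sign and rescaled charges. These charges sum to 1, so
  \<open>1 / d\<close> bounds it on \<open>A\<close> uniformly in \<open>k\<close>.\<close>

definition Wk :: "nat \<Rightarrow> real^3 \<Rightarrow> real" where
  "Wk k y = (\<Sum>\<alpha>=1..M. (Z k \<alpha> / Zt k) / norm (y - R \<alpha>))"

definition err :: "nat \<Rightarrow> real" where
  "err k = (\<Sum>\<alpha>=1..M. \<bar>Z k \<alpha> / Zt k - z \<alpha>\<bar> / d)"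

lemma Zt_pos: "Zt k > 0"
  unfolding total_charge_def using M Z_pos by (intro sum_pos) auto

lemma nuclear_potential_eq: "nuclear_potential M R (Z k) y = - Zt k * Wk k y"
  using Zt_pos[of k] by (simp add: nuclear_potential_def Wk_def sum_distrib_left sum_negf)

lemma A_iff: "y \<in> A \<longleftrightarrow> (\<forall>\<alpha>\<in>{1..M}. norm (y - R \<alpha>) \<ge> d)"
  by (auto simp: Omega_def dist_norm norm_minus_commute not_less)

lemma admissible_iff: "y \<in> admissible M R d n \<longleftrightarrow> (\<forall>i\<in>{1..n}. y i \<in> A)"
  unfolding admissible_def A_iff by simp

lemma x_in_A: "i \<in> {1..N k} \<Longrightarrow> x k i \<in> A"
  using approx by (auto simp: approximate_minimizers_def admissible_iff)

lemma closed_A: "closed A"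
  unfolding Omega_def by (intro closed_Compl open_UN) auto

lemma divide_norm_bounds:
  assumes "y \<in> A" "\<alpha> \<in> {1..M}" "0 \<le> c"
  shows "0 \<le> c / norm (y - R \<alpha>)" "c / norm (y - R \<alpha>) \<le> c / d"
proof -
  have "norm (y - R \<alpha>) \<ge> d" using assms(1,2) unfolding A_iff by blast
  then show "c / norm (y - R \<alpha>) \<le> c / d" using d assms by (intro divide_left_mono mult_pos_pos) auto
qed (use assms in simp)

lemma W_err:
  assumes "y \<in> A"
  shows "\<bar>Wk k y - W y\<bar> \<le> err k"
proof -
  have "Wk k y - W y = (\<Sum>\<alpha>=1..M. (Z k \<alpha> / Zt k - z \<alpha>) / norm (y - R \<alpha>))"
    by (simp add: Wk_def W_def sum_subtractf[symmetric] diff_divide_distrib)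
  also have "\<bar>\<dots>\<bar> \<le> (\<Sum>\<alpha>=1..M. \<bar>(Z k \<alpha> / Zt k - z \<alpha>) / norm (y - R \<alpha>)\<bar>)" by (rule sum_abs)
  also have "\<dots> \<le> err k"
    unfolding err_def abs_divide abs_norm_cancel using divide_norm_bounds(2)[OF assms] by (intro sum_mono) auto
  finally show ?thesis .
qed

lemma err_lim: "err \<longlonglongrightarrow> 0"
proof -
  have "err \<longlonglongrightarrow> (\<Sum>\<alpha>=1..M. \<bar>z \<alpha> - z \<alpha>\<bar> / d)"
    unfolding err_def using d by (intro tendsto_intros z_lim) auto
  then show ?thesis by simp
qed

lemma z_nonneg: "\<alpha> \<in> {1..M} \<Longrightarrow> z \<alpha> \<ge> 0"
  using Z_pos Zt_pos by (intro LIMSEQ_le_const[OF z_lim]) (auto simp: less_imp_le)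

lemma W_bounds:
  assumes "y \<in> A"
  shows "0 \<le> W y" "W y \<le> (\<Sum>\<alpha>=1..M. z \<alpha> / d)" "0 \<le> Wk k y" "Wk k y \<le> 1 / d"
proof -
  show "0 \<le> W y" unfolding W_def using divide_norm_bounds(1)[OF assms] z_nonneg by (intro sum_nonneg) auto
  show "W y \<le> (\<Sum>\<alpha>=1..M. z \<alpha> / d)" unfolding W_def using divide_norm_bounds(2)[OF assms] z_nonneg by (intro sum_mono) auto
  have nn: "0 \<le> Z k \<alpha> / Zt k" if "\<alpha> \<in> {1..M}" for \<alpha>
    using Z_pos[OF that] Zt_pos[of k] by (simp add: less_imp_le)
  show "0 \<le> Wk k y" unfolding Wk_def by (intro sum_nonneg divide_norm_bounds(1)[OF assms] nn)
  have "Wk k y \<le> (\<Sum>\<alpha>=1..M. (Z k \<alpha> / Zt k) / d)"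
    unfolding Wk_def by (intro sum_mono divide_norm_bounds(2)[OF assms] nn)
  also have "\<dots> = Zt k / Zt k / d"
    by (simp only: sum_divide_distrib total_charge_def)
  also have "\<dots> = 1 / d" using Zt_pos[of k] by simp
  finally show "Wk k y \<le> 1 / d" .
qed

lemma W_borel: "W \<in> borel_measurable borel" "Wk k \<in> borel_measurable borel"
  unfolding W_def Wk_def by measurable

text \<open>The poles of \<open>W\<close> stay at distance \<open>d\<close> from \<open>A\<close>,
  so \<open>W\<close> is itself a test function and the limiting attraction is continuous for
  weak-star convergence.\<close>

lemma W_C0: "W \<in> C0 A"
proof -
  have "continuous_on A W"
    unfolding W_def
  proof (intro continuous_intros ballI)
    fix y \<alpha> assume "\<alpha> \<in> {1..M}" "y \<in> A"
    then have "norm (y - R \<alpha>) \<ge> d" unfolding A_iff by blast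
    then show "norm (y - R \<alpha>) \<noteq> 0" using d by linarith
  qed
  moreover have "(W \<longlongrightarrow> 0) at_infinity"
  proof -
    have "((\<lambda>y. z \<alpha> / norm (y - R \<alpha>)) \<longlongrightarrow> 0) at_infinity" for \<alpha>
      by (intro tendsto_divide_0[OF tendsto_const] filterlim_at_top_imp_at_infinity filterlim_norm_diff_at_top)
    then have "(W \<longlongrightarrow> (\<Sum>\<alpha>=1..M. 0)) at_infinity"
      unfolding W_def by (intro tendsto_sum) auto
    then show ?thesis by simp
  qed
  ultimately show ?thesis
    unfolding C0_def by (auto intro: tendsto_mono[OF inf_le1])
qed

lemma integrable_W:
  assumes "\<nu> \<in> M_plus A"
  shows "integrable \<nu> W" "integrable \<nu> (Wk k)"
proof -
  interpret finite_measure \<nu> using assms by (simp add: M_plus_def)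
  show "integrable \<nu> W"
    using W_bounds by (intro integrable_const_bound[where B="\<Sum>\<alpha>=1..M. z \<alpha> / d"] borel_measurable_M_plus[OF assms] W_borel)
      (auto simp: space_M_plus[OF assms])
  show "integrable \<nu> (Wk k)"
    using W_bounds by (intro integrable_const_bound[where B="1/d"] borel_measurable_M_plus[OF assms] W_borel)
      (auto simp: space_M_plus[OF assms])
qed

lemma energy_eq:
  assumes "\<nu> \<in> M_plus A" "measure \<nu> (space \<nu>) \<le> lam"
  shows "energy M R lam z \<nu> = ereal (- (\<integral>y. W y \<partial>\<nu>)) + ereal (1/2) * enn2ereal (interaction \<nu>)"
  using assms(2) by (simp add: energy_def W_def interaction_def)

lemma energy_eq_real:
  assumes "\<nu> \<in> M_plus A" "measure \<nu> (space \<nu>) \<le> lam" "interaction \<nu> = ennreal j" "0 \<le> j"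
  shows "energy M R lam z \<nu> = ereal (- (\<integral>y. W y \<partial>\<nu>) + j / 2)"
  unfolding energy_eq[OF assms(1,2)] assms(3) using assms(4) by simp

lemma energy_finite_cases:
  assumes "\<nu> \<in> M_plus A" "energy M R lam z \<nu> \<noteq> \<infinity>"
  obtains j where "measure \<nu> (space \<nu>) \<le> lam" "0 \<le> j" "interaction \<nu> = ennreal j"
    "energy M R lam z \<nu> = ereal (- (\<integral>y. W y \<partial>\<nu>) + j / 2)"
proof -
  have m: "measure \<nu> (space \<nu>) \<le> lam" using assms(2) unfolding energy_def by metis
  show ?thesis
  proof (cases "interaction \<nu>")
    case (real j)
    then show ?thesis using that[OF m] energy_eq_real[OF assms(1) m] by auto
  next
    case top
    then show ?thesis using assms(2) energy_eq[OF assms(1) m] by (simp add: top_ereal_def)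
  qed
qed

section \<open>Asymptotic upper bound for the infimum\<close>

lemma infV_nonpos: "infV k \<le> 0"
proof -
  have "infV k \<le> V M R 0 (Z k) (\<lambda>_. 0)"
    by (rule INF_V_le) (auto simp: Z_pos admissible_def)
  then show ?thesis by (simp add: V_def zero_ereal_def[symmetric])
qed

text \<open>Dropping the repulsion leaves at least \<open>- Zt k / d\<close> per point. Finiteness
  makes the difference between an energy and the infimum meaningful in \<open>ereal\<close>.\<close>

lemma infV_ereal: "\<exists>c. infV k = ereal c"
proof -
  note infV_nonpos[of k]
  moreover have "ereal (\<Sum>i=1..N k. - Zt k / d) \<le> infV k"
  proof (rule INF_greatest)
    fix y assume "y \<in> admissible M R d (N k)"
    then have "(\<Sum>i=1..N k. - Zt k / d) \<le> (\<Sum>i=1..N k. nuclear_potential M R (Z k) (y i))"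
      unfolding nuclear_potential_eq using W_bounds(4) Zt_pos[of k] mult_left_mono[of "Wk k _" "1/d" "Zt k"]
      by (intro sum_mono) (auto simp: admissible_iff)
    then have "ereal (\<Sum>i=1..N k. - Zt k / d) + 0 \<le> V M R (N k) (Z k) y"
      unfolding V_eq by (intro add_mono) auto
    then show "ereal (\<Sum>i=1..N k. - Zt k / d) \<le> V M R (N k) (Z k) y" by simp
  qed
  ultimately show ?thesis by (cases "infV k") auto
qed

lemma infV_le_sampling:
  assumes P: "P \<in> M_plus A" "prob_space P" and n: "n \<le> N k" and j: "interaction P = ennreal j" "0 \<le> j"
  shows "infV k \<le> ereal (- real n * Zt k * (\<integral>y. Wk k y \<partial>P) + (real n)\<^sup>2 / 2 * j)"
proof -
  interpret prob_space P by fact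
  \<comment> \<open>Adding \<open>Zt k / d\<close> makes the potential nonnegative on
    \<open>A\<close>, as the \<open>ennreal\<close> form of the sampling argument requires; the
    shift contributes \<open>n * Zt k / d\<close> to both sides and cancels.\<close>
  define u where "u y = Zt k / d + nuclear_potential M R (Z k) y" for y
  have u0: "0 \<le> u y" if "y \<in> A" for y
    unfolding u_def nuclear_potential_eq using W_bounds(4)[OF that, of k] Zt_pos[of k]
      mult_left_mono[of "Wk k y" "1/d" "Zt k"] by simp
  have um: "u \<in> borel_measurable borel"
    unfolding u_def nuclear_potential_eq using W_borel(2)[of k] by measurable
  have ui: "integrable P u"
    unfolding u_def nuclear_potential_eq by (intro Bochner_Integration.integrable_add integrable_const integrable_mult_right integrable_W[OF P(1)])
  have intu: "(\<integral>y. u y \<partial>P) = Zt k / d - Zt k * (\<integral>y. Wk k y \<partial>P)"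
    unfolding u_def nuclear_potential_eq using integrable_W[OF P(1)] by (simp add: prob_space)
  have intu': "(\<integral>\<^sup>+y. ennreal (u y) \<partial>P) = ennreal (\<integral>y. u y \<partial>P)"
    using u0 by (intro nn_integral_eq_integral ui) (auto simp: space_M_plus[OF P(1)])
  have intu0: "0 \<le> (\<integral>y. u y \<partial>P)"
    using u0 by (intro integral_nonneg_AE) (auto simp: space_M_plus[OF P(1)])
  note [measurable] = id_measurable_M_plus[OF P(1)]
  have "(\<lambda>(a, b). 1 / ennreal (norm (a - b))) \<in> borel_measurable (P \<Otimes>\<^sub>M P)"
    by measurable
  then obtain y where y: "\<forall>i\<in>{1..n}. y i \<in> A" and
    le: "(\<Sum>i=1..n. ennreal (u (y i))) + pair_energy n y \<le> of_nat n * (\<integral>\<^sup>+y. ennreal (u y) \<partial>P) + of_nat (n choose 2) * interaction P"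
    using exists_configuration_le_expectation[OF P(2), of "\<lambda>a b. 1 / ennreal (norm (a - b))" A "\<lambda>y. ennreal (u y)" n]
      borel_measurable_M_plus[OF P(1) um] space_M_plus[OF P(1)]
    unfolding pair_energy_def interaction_def by (auto simp: norm_minus_commute)
  have "(\<Sum>i=1..n. ennreal (u (y i))) = ennreal (\<Sum>i=1..n. u (y i))"
    using u0 y by (intro sum_ennreal) auto
  moreover have "of_nat n * (\<integral>\<^sup>+y. ennreal (u y) \<partial>P) + of_nat (n choose 2) * interaction P
    = ennreal (real n * (\<integral>y. u y \<partial>P) + real (n choose 2) * j)"
    unfolding intu' j using intu0 j(2)
    by (simp add: ennreal_of_nat_eq_real_of_nat ennreal_mult'[symmetric] ennreal_plus[symmetric] del: ennreal_plus)
  ultimately have le': "ennreal (\<Sum>i=1..n. u (y i)) + pair_energy n y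
      \<le> ennreal (real n * (\<integral>y. u y \<partial>P) + real (n choose 2) * j)" using le by simp
  have "pair_energy n y \<noteq> top"
  proof
    assume "pair_energy n y = top"
    with le' show False by (simp add: top_unique)
  qed
  then obtain p where p: "pair_energy n y = ennreal p" "0 \<le> p" by (cases "pair_energy n y") auto
  have "(\<Sum>i=1..n. u (y i)) + p \<le> real n * (\<integral>y. u y \<partial>P) + real (n choose 2) * j"
  proof -
    have "0 \<le> (\<Sum>i=1..n. u (y i))" using u0 y by (intro sum_nonneg) auto
    then have "ennreal ((\<Sum>i=1..n. u (y i)) + p) \<le> ennreal (real n * (\<integral>y. u y \<partial>P) + real (n choose 2) * j)"
      using le' p by simp
    then show ?thesis using intu0 j(2) by (subst (asm) ennreal_le_iff) auto
  qed
  also have "\<dots> \<le> real n * (\<integral>y. u y \<partial>P) + (real n)\<^sup>2 / 2 * j"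
  proof -
    have "real (n choose 2) \<le> (real n)\<^sup>2 / 2"
    proof -
      have "2 * (n choose 2) \<le> n * (n - 1)" by (simp add: choose_two)
      also have "\<dots> \<le> n * n" by simp
      finally have "real (2 * (n choose 2)) \<le> real (n * n)" by (rule of_nat_mono)
      then show ?thesis by (simp add: power2_eq_square)
    qed
    then show ?thesis using j(2) by (intro add_left_mono mult_right_mono)
  qed
  finally have le2: "(\<Sum>i=1..n. nuclear_potential M R (Z k) (y i)) + p \<le> - real n * Zt k * (\<integral>y. Wk k y \<partial>P) + (real n)\<^sup>2 / 2 * j"
    unfolding intu by (simp add: u_def sum.distrib algebra_simps)
  have "infV k \<le> V M R n (Z k) y"
    by (rule INF_V_le[OF Z_pos n]) (use y in \<open>auto simp: admissible_iff\<close>)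
  also have "\<dots> = ereal ((\<Sum>i=1..n. nuclear_potential M R (Z k) (y i)) + p)"
    unfolding V_eq p(1) using p(2) by simp
  also have "\<dots> \<le> ereal (- real n * Zt k * (\<integral>y. Wk k y \<partial>P) + (real n)\<^sup>2 / 2 * j)"
    using le2 by simp
  finally show ?thesis .
qed

abbreviation Vx where "Vx k \<equiv> V M R (N k) (Z k) (x k)"

lemma Zt_inverse_lim: "(\<lambda>k. 1 / Zt k) \<longlonglongrightarrow> 0"
  using tendsto_inverse_0_at_top[OF Z_lim] by (simp add: inverse_eq_divide)

lemma floor_mult_Zt_lim:
  assumes "m \<ge> 0"
  shows "(\<lambda>k. real (nat \<lfloor>m * Zt k\<rfloor>) / Zt k) \<longlonglongrightarrow> m"
proof (rule tendsto_sandwich[OF _ _ _ tendsto_const])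
  have e: "real (nat \<lfloor>m * Zt k\<rfloor>) = of_int \<lfloor>m * Zt k\<rfloor>" for k
    using assms Zt_pos[of k] by simp
  have "m * Zt k - 1 \<le> real (nat \<lfloor>m * Zt k\<rfloor>)" "real (nat \<lfloor>m * Zt k\<rfloor>) \<le> m * Zt k" for k
    unfolding e by linarith+
  moreover have "m - 1 / Zt k = (m * Zt k - 1) / Zt k" "m = m * Zt k / Zt k" for k
    using Zt_pos[of k] by (simp_all add: diff_divide_distrib)
  ultimately show "\<forall>\<^sub>F k in sequentially. m - 1 / Zt k \<le> real (nat \<lfloor>m * Zt k\<rfloor>) / Zt k"
    "\<forall>\<^sub>F k in sequentially. real (nat \<lfloor>m * Zt k\<rfloor>) / Zt k \<le> m"
    using Zt_pos by (metis (no_types, lifting) always_eventually divide_right_mono less_imp_le)+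
  have "(\<lambda>k. m - 1 / Zt k) \<longlonglongrightarrow> m - 0" by (intro tendsto_intros Zt_inverse_lim)
  then show "(\<lambda>k. m - 1 / Zt k) \<longlonglongrightarrow> m" by simp
qed

lemma interaction_scale_measure:
  assumes "\<nu> \<in> M_plus A"
  shows "interaction (scale_measure c \<nu>) = c\<^sup>2 * interaction \<nu>"
proof -
  interpret finite_measure \<nu> using assms by (simp add: M_plus_def)
  note [measurable] = id_measurable_M_plus[OF assms]
  have "interaction (scale_measure c \<nu>) = (\<integral>\<^sup>+x. c * (\<integral>\<^sup>+y. 1 / ennreal (norm (x - y)) \<partial>\<nu>) \<partial>scale_measure c \<nu>)"
    unfolding interaction_def by (subst nn_integral_scale_measure) auto
  also have "\<dots> = c * (c * interaction \<nu>)"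
    unfolding interaction_def by (subst nn_integral_scale_measure, measurable, subst nn_integral_cmult) auto
  finally show ?thesis by (simp add: power2_eq_square mult.assoc)
qed

lemma infV_upper_bound:
  assumes \<nu>: "\<nu> \<in> M_plus A" and e: "energy M R lam z \<nu> = ereal e"
  shows "\<exists>a. a \<longlonglongrightarrow> e \<and> (\<forall>k. infV k \<le> ereal (a k * (Zt k)\<^sup>2))"
proof -
  have "energy M R lam z \<nu> \<noteq> \<infinity>" using e by simp
  from energy_finite_cases[OF \<nu> this] obtain j where m: "measure \<nu> (space \<nu>) \<le> lam"
    and j: "0 \<le> j" "interaction \<nu> = ennreal j" and "energy M R lam z \<nu> = ereal (- (\<integral>y. W y \<partial>\<nu>) + j / 2)"
    by blast
  with e have e': "e = - (\<integral>y. W y \<partial>\<nu>) + j / 2" by simp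
  interpret finite_measure \<nu> using \<nu> by (simp add: M_plus_def)
  define m where "m = measure \<nu> (space \<nu>)"
  have m_lam: "m \<le> lam" using m unfolding m_def .
  show ?thesis
  proof (cases "m = 0")
    \<comment> \<open>A measure of mass zero cannot be normalised, but its energy is 0 and the
      infimum is never positive.\<close>
    case True
    then have "emeasure \<nu> (space \<nu>) = 0" unfolding m_def by (simp add: emeasure_eq_measure)
    then have F: "AE y in \<nu>. False" by (intro AE_I[where N="space \<nu>"]) auto
    have "(\<integral>y. W y \<partial>\<nu>) = 0"
      by (rule integral_eq_zero_AE) (use F in eventually_elim, simp)
    moreover have "interaction \<nu> = (\<integral>\<^sup>+y. 0 \<partial>\<nu>)"
      unfolding interaction_def by (rule nn_integral_cong_AE) (use F in eventually_elim, simp)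
    ultimately have "e = 0" using e' j by simp
    then show ?thesis
      using infV_nonpos by (intro exI[of _ "\<lambda>_. 0"]) (simp add: zero_ereal_def[symmetric])
  next
    case False
    then have m0: "m > 0" unfolding m_def using zero_less_measure_iff by fastforce
    define P where "P = scale_measure (ennreal (1 / m)) \<nu>"
    have P: "P \<in> M_plus A"
      using \<nu> m0 unfolding M_plus_def P_def by (auto intro!: finite_measure_scale_measure)
    have prob: "prob_space P"
    proof
      show "emeasure P (space P) = 1"
        unfolding P_def space_scale_measure emeasure_scale_measure emeasure_eq_measure
        using m0 by (simp add: m_def[symmetric] ennreal_mult'[symmetric])
    qed
    have intP: "(\<integral>y. f y \<partial>P) = (1 / m) * (\<integral>y. f y \<partial>\<nu>)" if "f \<in> borel_measurable \<nu>" for f :: "_ \<Rightarrow> real"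
      unfolding P_def using m0 that by (intro integral_scale_measure) auto
    have jP: "interaction P = ennreal (j / m\<^sup>2)"
      unfolding P_def interaction_scale_measure[OF \<nu>] j(2) using m0 j(1)
      by (subst ennreal_power) (auto simp: ennreal_mult'[symmetric] power_divide)
    \<comment> \<open>About \<open>m * Zt k\<close> points of weight \<open>1 / Zt k\<close>
      reproduce the mass \<open>m\<close>. The minimum respects the available number of points and
      does not affect the limit because \<open>m \<le> lam\<close>.\<close>
    define n where "n k = min (N k) (nat \<lfloor>m * Zt k\<rfloor>)" for k
    define a where "a k = - (real (n k) / Zt k) * (\<integral>y. Wk k y \<partial>P) + (real (n k) / Zt k)\<^sup>2 / 2 * (j / m\<^sup>2)" for k
    have "infV k \<le> ereal (a k * (Zt k)\<^sup>2)" for k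
    proof -
      have "infV k \<le> ereal (- real (n k) * Zt k * (\<integral>y. Wk k y \<partial>P) + (real (n k))\<^sup>2 / 2 * (j / m\<^sup>2))"
        by (rule infV_le_sampling[OF P prob _ jP]) (use j(1) in \<open>auto simp: n_def\<close>)
      also have "- real (n k) * Zt k * (\<integral>y. Wk k y \<partial>P) + (real (n k))\<^sup>2 / 2 * (j / m\<^sup>2) = a k * (Zt k)\<^sup>2"
        using Zt_pos[of k] by (simp add: a_def power2_eq_square field_simps)
      finally show ?thesis .
    qed
    moreover have "a \<longlonglongrightarrow> e"
    proof -
      interpret P: prob_space P by fact
      have n: "(\<lambda>k. real (n k) / Zt k) \<longlonglongrightarrow> m"
      proof -
        have "(\<lambda>k. min (real (N k) / Zt k) (real (nat \<lfloor>m * Zt k\<rfloor>) / Zt k)) \<longlonglongrightarrow> min lam m"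
          using m0 by (intro tendsto_min lam_lim floor_mult_Zt_lim) auto
        moreover have "min (real (N k) / Zt k) (real (nat \<lfloor>m * Zt k\<rfloor>) / Zt k) = real (n k) / Zt k" for k
          using Zt_pos[of k] by (auto simp: n_def min_def divide_le_cancel)
        ultimately show ?thesis using m_lam by (simp add: min_absorb2)
      qed
      have w: "(\<lambda>k. \<integral>y. Wk k y \<partial>P) \<longlonglongrightarrow> (\<integral>y. W y \<partial>P)"
      proof (rule Lim_transform2)
        have "\<bar>(\<integral>y. W y \<partial>P) - (\<integral>y. Wk k y \<partial>P)\<bar> \<le> err k" for k
        proof -
          have i: "integrable P (\<lambda>y. W y - Wk k y)"
            by (intro Bochner_Integration.integrable_diff integrable_W[OF P])
          have "\<bar>\<integral>y. W y - Wk k y \<partial>P\<bar> \<le> (\<integral>y. \<bar>W y - Wk k y\<bar> \<partial>P)" by (rule integral_abs_bound)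
          also have "\<dots> \<le> (\<integral>y. err k \<partial>P)"
            using i W_err[of _ k] by (intro integral_mono_AE) (auto simp: space_M_plus[OF P] abs_minus_commute)
          finally show ?thesis using integrable_W[OF P] by (simp add: P.prob_space)
        qed
        then show "(\<lambda>k. (\<integral>y. W y \<partial>P) - (\<integral>y. Wk k y \<partial>P)) \<longlonglongrightarrow> 0"
          by (intro Lim_null_comparison[OF always_eventually err_lim]) auto
      qed simp
      have "a \<longlonglongrightarrow> - m * (\<integral>y. W y \<partial>P) + m\<^sup>2 / 2 * (j / m\<^sup>2)"
        unfolding a_def by (intro tendsto_intros n w) auto
      also have "- m * (\<integral>y. W y \<partial>P) + m\<^sup>2 / 2 * (j / m\<^sup>2) = e"
        using m0 unfolding e' by (subst intP) (auto intro: borel_measurable_M_plus[OF \<nu> W_borel(1)])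
      finally show ?thesis .
    qed
    ultimately show ?thesis by blast
  qed
qed

text \<open>Approximate minimality allows \<open>Vx k\<close> to be infinite for finitely many
  \<open>k\<close>, so the bound is only eventual: once the scaled gap to the infimum is below 1, it
  is a real number that can be added to the bound for the infimum.\<close>

lemma Vx_upper_bound:
  assumes \<nu>: "\<nu> \<in> M_plus A" and e: "energy M R lam z \<nu> = ereal e"
  shows "\<exists>b. b \<longlonglongrightarrow> e \<and> (\<forall>\<^sub>F k in sequentially. Vx k / ereal ((Zt k)\<^sup>2) \<le> ereal (b k))"
proof -
  obtain a where a: "a \<longlonglongrightarrow> e" "\<And>k. infV k \<le> ereal (a k * (Zt k)\<^sup>2)"
    using infV_upper_bound[OF assms] by blast
  define \<delta> where "\<delta> k = (Vx k - infV k) / ereal ((Zt k)\<^sup>2)" for k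
  have \<delta>: "\<delta> \<longlonglongrightarrow> 0"
    using approx unfolding approximate_minimizers_def \<delta>_def by simp
  have "(\<lambda>k. real_of_ereal (\<delta> k)) \<longlonglongrightarrow> 0"
    by (rule lim_real_of_ereal[OF \<delta>[unfolded zero_ereal_def]])
  then have "(\<lambda>k. a k + real_of_ereal (\<delta> k)) \<longlonglongrightarrow> e + 0" by (rule tendsto_add[OF a(1)])
  moreover have "\<forall>\<^sub>F k in sequentially. \<delta> k < 1"
    using \<delta> by (rule order_tendstoD) simp
  then have "\<forall>\<^sub>F k in sequentially. Vx k / ereal ((Zt k)\<^sup>2) \<le> ereal (a k + real_of_ereal (\<delta> k))"
  proof eventually_elim
    case (elim k)
    have Z2: "(Zt k)\<^sup>2 > 0" using Zt_pos[of k] by simp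
    obtain c where c: "infV k = ereal c" using infV_ereal by blast
    show ?case
    proof (cases "Vx k")
      case (real v)
      have "c \<le> a k * (Zt k)\<^sup>2" using a(2)[of k] c by simp
      then have "c / (Zt k)\<^sup>2 \<le> a k" using Z2 by (simp add: pos_divide_le_eq)
      moreover have "\<delta> k = ereal ((v - c) / (Zt k)\<^sup>2)"
        unfolding \<delta>_def c real using Z2 by simp
      ultimately show ?thesis using Z2 by (simp add: real diff_divide_distrib)
    next
      case PInf
      then have "\<delta> k = \<infinity>" unfolding \<delta>_def c using Z2 by simp
      with elim show ?thesis by simp
    next
      case MInf
      then show ?thesis using Z2 by simp
    qed
  qed
  ultimately show ?thesis by auto
qed

section \<open>Limit points, uniqueness of the minimizer, and convergence\<close>

lemma energy_null_measure:
  "null_measure (restrict_space borel A) \<in> M_plus A"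
  "energy M R lam z (null_measure (restrict_space borel A)) = 0"
proof -
  show "null_measure (restrict_space borel A) \<in> M_plus A"
    by (auto simp: M_plus_def intro!: finite_measureI)
  show "energy M R lam z (null_measure (restrict_space borel A)) = 0"
    using lam by (simp add: energy_def zero_ereal_def[symmetric] zero_ennreal.rep_eq)
qed

lemma Vx_split:
  "Vx k / ereal ((Zt k)\<^sup>2) = ereal (- (1 / Zt k) * (\<Sum>i=1..N k. Wk k (x k i)))
     + enn2ereal (ennreal ((1 / Zt k)\<^sup>2) * pair_energy (N k) (x k))"
proof -
  have Z2: "(Zt k)\<^sup>2 > 0" using Zt_pos[of k] by simp
  have s: "(\<Sum>i=1..N k. nuclear_potential M R (Z k) (x k i)) / (Zt k)\<^sup>2 = - (1 / Zt k) * (\<Sum>i=1..N k. Wk k (x k i))"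
    unfolding nuclear_potential_eq sum_distrib_left[symmetric] using Zt_pos[of k] by (simp add: power2_eq_square)
  show ?thesis
  proof (cases "pair_energy (N k) (x k)")
    case (real p)
    have "enn2ereal (ennreal ((1 / Zt k)\<^sup>2) * pair_energy (N k) (x k)) = ereal (p / (Zt k)\<^sup>2)"
      unfolding real(2) using real(1) by (subst ennreal_mult'[symmetric]) (auto simp: power_divide)
    moreover have "Vx k / ereal ((Zt k)\<^sup>2) = ereal ((\<Sum>i=1..N k. nuclear_potential M R (Z k) (x k i)) / (Zt k)\<^sup>2 + p / (Zt k)\<^sup>2)"
      unfolding V_eq real(2) using real(1) Z2 by (simp add: add_divide_distrib)
    ultimately show ?thesis unfolding s by simp
  next
    case top
    then show ?thesis unfolding V_eq using Z2 Zt_pos[of k]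
      by (simp add: ennreal_mult_top top_ereal_def ennreal_eq_0_iff not_le)
  qed
qed

text \<open>The attraction converges to \<open>w\<close>, so an upper bound on the energies by that
  of a competitor, \<open>e\<close>, is an upper bound \<open>2 * (e + w)\<close> on the limsup of
  the doubled repulsion. Lower semicontinuity puts \<open>interaction \<mu>\<close> below it, which
  rearranges to the energy of \<open>\<mu>\<close> being at most \<open>e\<close>.\<close>

lemma limit_point_minimizes:
  assumes r: "strict_mono r" and \<mu>: "\<mu> \<in> M_plus A" "measure \<mu> (space \<mu>) \<le> lam"
    and conv: "\<And>f. f \<in> C0 A \<Longrightarrow> (\<lambda>k. (1 / Zt (r k)) * (\<Sum>i=1..N (r k). f (x (r k) i))) \<longlonglongrightarrow> (\<integral>y. f y \<partial>\<mu>)"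
  shows "is_arg_min (energy M R lam z) (\<lambda>\<nu>. \<nu> \<in> M_plus A) \<mu>"
    and "(\<lambda>k. Vx (r k) / ereal ((Zt (r k))\<^sup>2)) \<longlonglongrightarrow> energy M R lam z \<mu>"
proof -
  define w where "w = (\<integral>y. W y \<partial>\<mu>)"
  define \<alpha> where "\<alpha> k = - (1 / Zt (r k)) * (\<Sum>i=1..N (r k). Wk (r k) (x (r k) i))" for k
  define \<beta> where "\<beta> k = ennreal ((1 / Zt (r k))\<^sup>2) * pair_energy (N (r k)) (x (r k))" for k
  have split: "Vx (r k) / ereal ((Zt (r k))\<^sup>2) = ereal (\<alpha> k) + enn2ereal (\<beta> k)" for k
    unfolding \<alpha>_def \<beta>_def by (rule Vx_split)
  note sub = LIMSEQ_subseq_LIMSEQ[OF _ r, unfolded comp_def]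
  have \<alpha>: "\<alpha> \<longlonglongrightarrow> - w"
  proof (rule Lim_transform2)
    have "(\<lambda>k. - ((1 / Zt (r k)) * (\<Sum>i=1..N (r k). W (x (r k) i)))) \<longlonglongrightarrow> - w"
      unfolding w_def by (intro tendsto_minus conv W_C0)
    then show "(\<lambda>k. - (1 / Zt (r k)) * (\<Sum>i=1..N (r k). W (x (r k) i))) \<longlonglongrightarrow> - w" by simp
    have "\<bar>- (1 / Zt (r k)) * (\<Sum>i=1..N (r k). W (x (r k) i)) - \<alpha> k\<bar> \<le> real (N (r k)) / Zt (r k) * err (r k)" for k
    proof -
      have eq: "- (1 / Zt (r k)) * (\<Sum>i=1..N (r k). W (x (r k) i)) - \<alpha> k
        = (1 / Zt (r k)) * (\<Sum>i=1..N (r k). Wk (r k) (x (r k) i) - W (x (r k) i))"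
        by (simp add: \<alpha>_def sum_subtractf right_diff_distrib)
      have "\<bar>\<Sum>i=1..N (r k). Wk (r k) (x (r k) i) - W (x (r k) i)\<bar> \<le> (\<Sum>i=1..N (r k). err (r k))"
        using W_err[OF x_in_A] by (intro order_trans[OF sum_abs] sum_mono)
      then have "(1 / Zt (r k)) * \<bar>\<Sum>i=1..N (r k). Wk (r k) (x (r k) i) - W (x (r k) i)\<bar>
        \<le> (1 / Zt (r k)) * (\<Sum>i=1..N (r k). err (r k))"
        using Zt_pos[of "r k"] by (intro mult_left_mono) auto
      then show ?thesis unfolding eq abs_mult using Zt_pos[of "r k"] by simp
    qed
    then have bound: "\<forall>k. norm (- (1 / Zt (r k)) * (\<Sum>i=1..N (r k). W (x (r k) i)) - \<alpha> k)
        \<le> real (N (r k)) / Zt (r k) * err (r k)"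
      unfolding real_norm_def by blast
    have lim0: "(\<lambda>k. real (N (r k)) / Zt (r k) * err (r k)) \<longlonglongrightarrow> 0"
      using tendsto_mult[OF sub[OF lam_lim] sub[OF err_lim]] by (simp only: mult_zero_right)
    show "(\<lambda>k. - (1 / Zt (r k)) * (\<Sum>i=1..N (r k). W (x (r k) i)) - \<alpha> k) \<longlonglongrightarrow> 0"
      by (rule Lim_null_comparison[OF always_eventually[OF bound] lim0])
  qed
  have "interaction (borel_extension \<mu>) \<le> liminf (\<lambda>k. 2 * \<beta> k)"
    unfolding interaction_def \<beta>_def pair_energy_def
  proof (rule coulomb_energy_liminf[OF borel_extension(1,2)[OF \<mu>(1)]])
    show "0 \<le> 1 / Zt (r k)" for k using Zt_pos[of "r k"] by simp
    have "(\<lambda>k. (1 / Zt (r k)) * (real (N (r k)) / Zt (r k))) \<longlonglongrightarrow> 0 * lam"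
      by (intro tendsto_mult sub[OF lam_lim] sub[OF Zt_inverse_lim])
    then show "(\<lambda>k. (1 / Zt (r k))\<^sup>2 * real (N (r k))) \<longlonglongrightarrow> 0"
      by (simp add: power2_eq_square)
    show "(\<lambda>k. 1 / Zt (r k) * (\<Sum>i=1..N (r k). gauss_bump \<tau> (x (r k) i))) \<longlonglongrightarrow> (\<integral>y. gauss_bump \<tau> y \<partial>borel_extension \<mu>)"
      if "0 < fst \<tau>" for \<tau>
      using conv[OF gauss_bump_C0[OF that]] by (subst borel_extension(4)[OF \<mu>(1)]) auto
  qed
  then have lsc: "interaction \<mu> \<le> liminf (\<lambda>k. 2 * \<beta> k)"
    unfolding interaction_borel_extension[OF \<mu>(1)] .
  have upper: "0 \<le> e + w \<and> limsup (\<lambda>k. 2 * \<beta> k) \<le> ennreal (2 * (e + w))"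
    if \<nu>: "\<nu> \<in> M_plus A" and e: "energy M R lam z \<nu> = ereal e" for \<nu> e
  proof -
    obtain b where b: "b \<longlonglongrightarrow> e" "\<forall>\<^sub>F k in sequentially. Vx k / ereal ((Zt k)\<^sup>2) \<le> ereal (b k)"
      using Vx_upper_bound[OF \<nu> e] by blast
    have "\<forall>\<^sub>F k in sequentially. Vx (r k) / ereal ((Zt (r k))\<^sup>2) \<le> ereal (b (r k))"
      by (rule eventually_subseq[OF r b(2)])
    then have ev: "\<forall>\<^sub>F k in sequentially. 0 \<le> b (r k) - \<alpha> k \<and> 2 * \<beta> k \<le> ennreal (2 * (b (r k) - \<alpha> k))"
    proof eventually_elim
      case (elim k)
      then have le: "ereal (\<alpha> k) + enn2ereal (\<beta> k) \<le> ereal (b (r k))" unfolding split .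
      show ?case
      proof (cases "\<beta> k")
        case (real p)
        then show ?thesis using le by (simp add: ennreal_mult'[symmetric] ennreal_leI numeral_mult_ennreal)
      next
        case top
        with le show ?thesis by (simp add: top_ereal_def)
      qed
    qed
    have lim: "(\<lambda>k. b (r k) - \<alpha> k) \<longlonglongrightarrow> e + w"
      using tendsto_diff[OF sub[OF b(1)] \<alpha>] by simp
    then have "0 \<le> e + w"
      by (rule tendsto_lowerbound) (use ev in \<open>auto elim: eventually_mono\<close>)
    moreover have "limsup (\<lambda>k. 2 * \<beta> k) \<le> limsup (\<lambda>k. ennreal (2 * (b (r k) - \<alpha> k)))"
      by (rule Limsup_mono) (use ev in \<open>auto elim: eventually_mono\<close>)
    moreover have "limsup (\<lambda>k. ennreal (2 * (b (r k) - \<alpha> k))) = ennreal (2 * (e + w))"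
      by (intro lim_imp_Limsup tendsto_ennrealI tendsto_intros lim) simp
    ultimately show ?thesis by simp
  qed
  have lsc': "interaction \<mu> \<le> ennreal (2 * (e + w))" if "\<nu> \<in> M_plus A" "energy M R lam z \<nu> = ereal e" for \<nu> e
    using lsc Liminf_le_Limsup[of sequentially "\<lambda>k. 2 * \<beta> k"] upper[OF that] by auto
  \<comment> \<open>The null measure is a competitor of energy 0, which bounds the interaction by
    \<open>2 * w\<close>.\<close>
  have "interaction \<mu> < top"
    using lsc'[OF energy_null_measure(1), of 0] energy_null_measure(2) by (auto simp: zero_ereal_def less_top[symmetric] top_unique)
  then obtain i where i: "0 \<le> i" "interaction \<mu> = ennreal i" by (cases "interaction \<mu>") auto
  have E\<mu>: "energy M R lam z \<mu> = ereal (- w + i / 2)"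
    unfolding w_def by (rule energy_eq_real[OF \<mu> i(2,1)])
  show "is_arg_min (energy M R lam z) (\<lambda>\<nu>. \<nu> \<in> M_plus A) \<mu>"
    unfolding is_arg_min_def
  proof (intro conjI notI)
    assume "\<exists>\<nu>. \<nu> \<in> M_plus A \<and> energy M R lam z \<nu> < energy M R lam z \<mu>"
    then obtain \<nu> where \<nu>: "\<nu> \<in> M_plus A" and less: "energy M R lam z \<nu> < energy M R lam z \<mu>" by blast
    then have "energy M R lam z \<nu> \<noteq> \<infinity>" by auto
    then obtain e where e: "energy M R lam z \<nu> = ereal e" using energy_finite_cases[OF \<nu>] by metis
    have "i \<le> 2 * (e + w)"
      using lsc'[OF \<nu> e] upper[OF \<nu> e] unfolding i(2) by (subst (asm) ennreal_le_iff) auto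
    with less show False unfolding e E\<mu> by simp
  qed fact
  \<comment> \<open>Now \<open>\<mu>\<close> serves as its own competitor: with energy
    \<open>- w + i / 2\<close> the upper bound becomes \<open>i\<close> and meets the lower one, so
    the repulsion converges.\<close>
  have "(\<lambda>k. 2 * \<beta> k) \<longlonglongrightarrow> ennreal i"
  proof (rule Liminf_eq_Limsup)
    have up: "limsup (\<lambda>k. 2 * \<beta> k) \<le> ennreal i" using upper[OF \<mu>(1) E\<mu>] by simp
    have le: "liminf (\<lambda>k. 2 * \<beta> k) \<le> limsup (\<lambda>k. 2 * \<beta> k)" by (rule Liminf_le_Limsup) simp
    show "liminf (\<lambda>k. 2 * \<beta> k) = ennreal i" "limsup (\<lambda>k. 2 * \<beta> k) = ennreal i"
      using up le lsc i(2) by auto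
  qed simp
  then have lim2: "(\<lambda>k. enn2ereal (2 * \<beta> k)) \<longlonglongrightarrow> enn2ereal (ennreal i)"
    by (rule tendsto_enn2erealI)
  have "(\<lambda>k. ereal (\<alpha> k) + ereal (1/2) * enn2ereal (2 * \<beta> k)) \<longlonglongrightarrow> ereal (- w) + ereal (1/2) * ereal i"
    using lim2 i(1) by (intro tendsto_add_ereal tendsto_cmult_ereal) (auto intro: \<alpha>)
  moreover have "ereal (1/2) * enn2ereal (2 * \<beta> k) = enn2ereal (\<beta> k)" for k
    by (cases "\<beta> k") (auto simp: numeral_mult_ennreal ennreal_mult_top top_ereal_def)
  ultimately show "(\<lambda>k. Vx (r k) / ereal ((Zt (r k))\<^sup>2)) \<longlonglongrightarrow> energy M R lam z \<mu>"
    unfolding split E\<mu> by simp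
qed

text \<open>Compactness concerns averages with weight \<open>1 / N k\<close>, whereas the empirical
  measures have weight \<open>1 / Zt k\<close>. Since \<open>N k / Zt k\<close> tends to
  \<open>lam\<close>, the limit is scaled by \<open>lam\<close>, which also gives the mass
  bound.\<close>

lemma exists_limit_point:
  fixes r :: "nat \<Rightarrow> nat"
  assumes r: "strict_mono r"
  shows "\<exists>r' \<mu>. strict_mono r' \<and> \<mu> \<in> M_plus A \<and> measure \<mu> (space \<mu>) \<le> lam \<and>
    (\<forall>f\<in>C0 A. (\<lambda>k. (1 / Zt (r (r' k))) * (\<Sum>i=1..N (r (r' k)). f (x (r (r' k)) i))) \<longlonglongrightarrow> (\<integral>y. f y \<partial>\<mu>))"
proof -
  have "\<forall>\<^sub>F k in sequentially. 1 \<le> N (r k)"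
    using eventually_subseq[OF r] N_lim by (auto simp: filterlim_at_top)
  \<comment> \<open>Averages require at least one point, so the subsequence is shifted past the
    finitely many empty configurations.\<close>
  then obtain k0 where k0: "\<And>k. k \<ge> k0 \<Longrightarrow> 1 \<le> N (r k)" by (auto simp: eventually_sequentially)
  define s where "s k = r (k + k0)" for k
  have Ns: "\<And>k. 1 \<le> N (s k)" and xs: "\<And>k i. i \<in> {1..N (s k)} \<Longrightarrow> x (s k) i \<in> A"
    using k0 x_in_A unfolding s_def by auto
  obtain r1 \<mu>' where r1: "strict_mono r1" and \<mu>': "sets \<mu>' = sets (restrict_space borel A)" "finite_measure \<mu>'"
      "measure \<mu>' (space \<mu>') \<le> 1"
    and conv: "\<And>f :: real^3 \<Rightarrow> real. continuous_on A f \<Longrightarrow> (f \<longlongrightarrow> 0) (inf at_infinity (principal A)) \<Longrightarrow>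
       (\<lambda>k. (\<Sum>i=1..N (s (r1 k)). f (x (s (r1 k)) i)) / real (N (s (r1 k)))) \<longlonglongrightarrow> (\<integral>y. f y \<partial>\<mu>')"
    using point_masses_compact[where A=A and N="\<lambda>k. N (s k)" and x="\<lambda>k i. x (s k) i", OF closed_A Ns xs]
    by blast
  define r' where "r' k = r1 k + k0" for k
  have r': "strict_mono r'" using r1 unfolding r'_def strict_mono_def by simp
  have s: "s (r1 k) = r (r' k)" for k by (simp add: s_def r'_def)
  define \<mu> where "\<mu> = scale_measure (ennreal lam) \<mu>'"
  have "\<mu> \<in> M_plus A"
    using \<mu>' lam unfolding \<mu>_def M_plus_def by (auto intro!: finite_measure_scale_measure)
  moreover have "measure \<mu> (space \<mu>) \<le> lam"
    unfolding \<mu>_def space_scale_measure using lam \<mu>'(3) by (simp add: mult_left_le)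
  moreover have "(\<lambda>k. (1 / Zt (r (r' k))) * (\<Sum>i=1..N (r (r' k)). f (x (r (r' k)) i))) \<longlonglongrightarrow> (\<integral>y. f y \<partial>\<mu>)"
    if f: "f \<in> C0 A" for f
  proof -
    have "f \<in> borel_measurable (restrict_space borel A)"
      using f by (intro borel_measurable_continuous_on_restrict) (simp add: C0_def)
    then have "f \<in> borel_measurable \<mu>'" using \<mu>'(1) by (simp cong: measurable_cong_sets)
    then have "(\<integral>y. f y \<partial>\<mu>) = lam * (\<integral>y. f y \<partial>\<mu>')"
      unfolding \<mu>_def using lam by (intro integral_scale_measure) auto
    moreover have "(\<lambda>k. real (N (r (r' k))) / Zt (r (r' k)) * ((\<Sum>i=1..N (r (r' k)). f (x (r (r' k)) i)) / real (N (r (r' k)))))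
      \<longlonglongrightarrow> lam * (\<integral>y. f y \<partial>\<mu>')"
      using f LIMSEQ_subseq_LIMSEQ[OF lam_lim strict_mono_compose[OF r r']]
      by (intro tendsto_mult conv[unfolded s]) (auto simp: C0_def comp_def)
    moreover have "real (N (r (r' k))) / Zt (r (r' k)) * (S / real (N (r (r' k)))) = (1 / Zt (r (r' k))) * S" for k S
      using k0[of "r' k"] by (simp add: r'_def)
    ultimately show ?thesis by (simp only:)
  qed
  ultimately show ?thesis using r' by blast
qed

text \<open>The mass constraint is convex and the attraction is linear, so minimality against the
  midpoint is an inequality between interactions alone, opposite to convexity: the equality
  case.\<close>

lemma minimizer_unique:
  assumes \<mu>: "is_arg_min (energy M R lam z) (\<lambda>\<nu>. \<nu> \<in> M_plus A) \<mu>"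
    and \<nu>: "is_arg_min (energy M R lam z) (\<lambda>\<nu>. \<nu> \<in> M_plus A) \<nu>"
  shows "\<mu> = \<nu>"
proof -
  let ?E = "energy M R lam z"
  have M: "\<mu> \<in> M_plus A" "\<nu> \<in> M_plus A" using assms by (auto simp: is_arg_min_def)
  have le: "?E \<mu> \<le> ?E \<rho>" "?E \<nu> \<le> ?E \<rho>" if "\<rho> \<in> M_plus A" for \<rho>
    using assms that by (auto simp: is_arg_min_def not_less)
  have "?E \<mu> \<noteq> \<infinity>" "?E \<nu> \<noteq> \<infinity>"
    using le[OF energy_null_measure(1)] energy_null_measure(2) by auto
  then obtain i j where
    i: "measure \<mu> (space \<mu>) \<le> lam" "0 \<le> i" "interaction \<mu> = ennreal i" "?E \<mu> = ereal (- (\<integral>y. W y \<partial>\<mu>) + i / 2)" and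
    j: "measure \<nu> (space \<nu>) \<le> lam" "0 \<le> j" "interaction \<nu> = ennreal j" "?E \<nu> = ereal (- (\<integral>y. W y \<partial>\<nu>) + j / 2)"
    using energy_finite_cases[OF M(1)] energy_finite_cases[OF M(2)] by metis
  have s: "sets \<nu> = sets \<mu>" using M by (simp add: M_plus_def)
  define \<rho> where "\<rho> = midpoint \<mu> \<nu>"
  have \<rho>: "\<rho> \<in> M_plus A" unfolding \<rho>_def by (rule midpoint_M_plus[OF M])
  \<comment> \<open>Passing through nonnegative integrals suffices, since constants and
    \<open>W\<close> are nonnegative on \<open>A\<close>.\<close>
  have int\<rho>: "(\<integral>y. f y \<partial>\<rho>) = ((\<integral>y. f y \<partial>\<mu>) + (\<integral>y. f y \<partial>\<nu>)) / 2"
    if f: "f \<in> borel_measurable borel" "\<And>y. y \<in> A \<Longrightarrow> 0 \<le> f y" "integrable \<mu> f" "integrable \<nu> f" for f :: "real^3 \<Rightarrow> real"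
  proof -
    have pos: "AE y in \<kappa>. 0 \<le> f y" if "\<kappa> \<in> M_plus A" for \<kappa>
      using f(2) space_M_plus[OF that] by auto
    have "(\<integral>y. f y \<partial>\<rho>) = enn2real (\<integral>\<^sup>+y. ennreal (f y) \<partial>\<rho>)"
      by (rule integral_eq_nn_integral[OF borel_measurable_M_plus[OF \<rho> f(1)] pos[OF \<rho>]])
    also have "(\<integral>\<^sup>+y. ennreal (f y) \<partial>\<rho>) = ennreal (1/2) * ((\<integral>\<^sup>+y. ennreal (f y) \<partial>\<mu>) + (\<integral>\<^sup>+y. ennreal (f y) \<partial>\<nu>))"
      unfolding \<rho>_def using borel_measurable_M_plus[OF M(1) f(1)] by (intro nn_integral_midpoint[OF s]) auto
    also have "\<dots> = ennreal (1/2) * (ennreal (\<integral>y. f y \<partial>\<mu>) + ennreal (\<integral>y. f y \<partial>\<nu>))"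
      by (simp only: nn_integral_eq_integral[OF f(3) pos[OF M(1)]] nn_integral_eq_integral[OF f(4) pos[OF M(2)]])
    also have "\<dots> = ennreal (1/2 * ((\<integral>y. f y \<partial>\<mu>) + (\<integral>y. f y \<partial>\<nu>)))"
      by (simp only: ennreal_plus[OF integral_nonneg_AE[OF pos[OF M(1)]] integral_nonneg_AE[OF pos[OF M(2)]], symmetric],
          subst ennreal_mult'[symmetric]) auto
    finally show ?thesis
      using integral_nonneg_AE[OF pos[OF M(1)]] integral_nonneg_AE[OF pos[OF M(2)]] by simp
  qed
  have fin: "finite_measure \<mu>" "finite_measure \<nu>" using M by (simp_all add: M_plus_def)
  have "(\<integral>y. 1 \<partial>\<rho>) = ((\<integral>y. 1 \<partial>\<mu>) + (\<integral>y. 1 \<partial>\<nu>)) / (2::real)"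
    by (rule int\<rho>[OF borel_measurable_const zero_le_one finite_measure.integrable_const[OF fin(1)] finite_measure.integrable_const[OF fin(2)]])
  then have "measure \<rho> (space \<rho>) = (measure \<mu> (space \<mu>) + measure \<nu> (space \<nu>)) / 2"
    by simp
  then have m\<rho>: "measure \<rho> (space \<rho>) \<le> lam" using i(1) j(1) by simp
  have W\<rho>: "(\<integral>y. W y \<partial>\<rho>) = ((\<integral>y. W y \<partial>\<mu>) + (\<integral>y. W y \<partial>\<nu>)) / 2"
    by (rule int\<rho>[OF W_borel(1) W_bounds(1) integrable_W(1)[OF M(1)] integrable_W(1)[OF M(2)]])
  have ge: "ennreal (1/2) * (interaction \<mu> + interaction \<nu>) \<le> interaction \<rho>"
  proof (cases "interaction \<rho>")
    case (real l)
    have "?E \<rho> = ereal (- (\<integral>y. W y \<partial>\<rho>) + l / 2)"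
      by (rule energy_eq_real[OF \<rho> m\<rho> real(2,1)])
    then have "i + j \<le> 2 * l"
      using le[OF \<rho>] unfolding i(4) j(4) W\<rho> by (simp add: field_simps)
    moreover have "ennreal (1/2) * (interaction \<mu> + interaction \<nu>) = ennreal (1/2 * (i + j))"
      unfolding i(3) j(3) by (simp only: ennreal_plus[OF i(2) j(2), symmetric], subst ennreal_mult'[symmetric]) auto
    ultimately show ?thesis unfolding real(2) by (simp add: ennreal_leI)
  qed simp
  show ?thesis
    using midpoint_interaction_eqI[OF M _ _ ge[unfolded \<rho>_def] closed_A] unfolding i(3) j(3) by simp
qed

lemma integral_point_masses:
  assumes f: "f \<in> C0 A"
  shows "(\<integral>y. f y \<partial>point_masses A (1 / Zt k) (N k) (x k)) = (1 / Zt k) * (\<Sum>i=1..N k. f (x k i))"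
proof -
  have m: "x k \<in> count_space {1..N k} \<rightarrow>\<^sub>M restrict_space borel A"
    using x_in_A by (auto simp: space_restrict_space)
  have fm: "f \<in> borel_measurable (restrict_space borel A)"
    using f by (intro borel_measurable_continuous_on_restrict) (simp add: C0_def)
  have "(\<integral>y. f y \<partial>distr (count_space {1..N k}) (restrict_space borel A) (x k)) = (\<Sum>i=1..N k. f (x k i))"
    by (subst integral_distr[OF m fm], rule lebesgue_integral_count_space_finite) simp
  moreover have "f \<in> borel_measurable (distr (count_space {1..N k}) (restrict_space borel A) (x k))"
    using fm by simp
  ultimately show ?thesis
    unfolding point_masses_def using Zt_pos[of k] integral_scale_measure[of f _ "1 / Zt k"]
    by (metis less_imp_le zero_less_divide_1_iff)
qed

text \<open>A limit point of the given sequence provides existence. By uniqueness, every subsequence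
  has a further subsequence with the same limit, which gives convergence of the whole
  sequence.\<close>

lemma minimizer_limit:
  "(\<exists>!\<mu>. is_arg_min (energy M R lam z) (\<lambda>\<nu>. \<nu> \<in> M_plus A) \<mu>) \<and>
    (\<forall>\<mu>. is_arg_min (energy M R lam z) (\<lambda>\<nu>. \<nu> \<in> M_plus A) \<mu> \<longrightarrow>
       weak_star_conv A (\<lambda>k. point_masses A (1 / Zt k) (N k) (x k)) \<mu> \<and>
       (\<lambda>k. Vx k / ereal ((Zt k)\<^sup>2)) \<longlonglongrightarrow> energy M R lam z \<mu>)"
proof -
  have sub: "\<exists>r' \<mu>. strict_mono r' \<and> is_arg_min (energy M R lam z) (\<lambda>\<nu>. \<nu> \<in> M_plus A) \<mu> \<and>
     (\<forall>f\<in>C0 A. (\<lambda>k. \<integral>y. f y \<partial>point_masses A (1 / Zt (r (r' k))) (N (r (r' k))) (x (r (r' k)))) \<longlonglongrightarrow> (\<integral>y. f y \<partial>\<mu>)) \<and>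
     (\<lambda>k. Vx (r (r' k)) / ereal ((Zt (r (r' k)))\<^sup>2)) \<longlonglongrightarrow> energy M R lam z \<mu>"
    if r: "strict_mono r" for r :: "nat \<Rightarrow> nat"
  proof -
    obtain r' \<mu> where r': "strict_mono r'" and \<mu>: "\<mu> \<in> M_plus A" "measure \<mu> (space \<mu>) \<le> lam" and
      conv: "\<And>f. f \<in> C0 A \<Longrightarrow> (\<lambda>k. (1 / Zt (r (r' k))) * (\<Sum>i=1..N (r (r' k)). f (x (r (r' k)) i))) \<longlonglongrightarrow> (\<integral>y. f y \<partial>\<mu>)"
      using exists_limit_point[OF r] by blast
    have "strict_mono (\<lambda>k. r (r' k))" using strict_mono_compose[OF r r'] .
    note lim = limit_point_minimizes[OF this \<mu> conv]
    then show ?thesis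
      using r' conv by (intro exI[of _ r'] exI[of _ \<mu>]) (simp add: integral_point_masses)
  qed
  show ?thesis
  proof (intro conjI allI impI)
    show "\<exists>!\<mu>. is_arg_min (energy M R lam z) (\<lambda>\<nu>. \<nu> \<in> M_plus A) \<mu>"
      using sub[OF strict_mono_id] minimizer_unique by blast
    fix \<mu> assume \<mu>: "is_arg_min (energy M R lam z) (\<lambda>\<nu>. \<nu> \<in> M_plus A) \<mu>"
    have sub': "\<exists>r'. strict_mono r' \<and>
      (\<forall>f\<in>C0 A. (\<lambda>k. \<integral>y. f y \<partial>point_masses A (1 / Zt (r (r' k))) (N (r (r' k))) (x (r (r' k)))) \<longlonglongrightarrow> (\<integral>y. f y \<partial>\<mu>)) \<and>
      (\<lambda>k. Vx (r (r' k)) / ereal ((Zt (r (r' k)))\<^sup>2)) \<longlonglongrightarrow> energy M R lam z \<mu>"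
      if "strict_mono r" for r :: "nat \<Rightarrow> nat"
      using sub[OF that] minimizer_unique[OF \<mu>] by blast
    show "weak_star_conv A (\<lambda>k. point_masses A (1 / Zt k) (N k) (x k)) \<mu>"
      unfolding weak_star_conv_def
    proof
      fix f assume f: "f \<in> C0 A"
      show "(\<lambda>k. \<integral>y. f y \<partial>point_masses A (1 / Zt k) (N k) (x k)) \<longlonglongrightarrow> (\<integral>y. f y \<partial>\<mu>)"
        by (rule tendsto_subsubsequence) (use sub' f in blast)
    qed
    show "(\<lambda>k. Vx k / ereal ((Zt k)\<^sup>2)) \<longlonglongrightarrow> energy M R lam z \<mu>"
      by (rule tendsto_subsubsequence) (use sub' in blast)
  qed
qed

end

theorem theorem1p2:
  fixes M :: nat and R :: "nat \<Rightarrow> real^3" and d lam :: real and z :: "nat \<Rightarrow> real"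
    and N :: "nat \<Rightarrow> nat" and Z :: "nat \<Rightarrow> nat \<Rightarrow> real"
    and x :: "nat \<Rightarrow> nat \<Rightarrow> real^3"
  assumes "M \<ge> 1" and "d > 0"
    and "\<And>k \<alpha>. \<alpha> \<in> {1..M} \<Longrightarrow> Z k \<alpha> > 0"
    and "filterlim N at_top sequentially"
    and "filterlim (\<lambda>k. total_charge M (Z k)) at_top sequentially"
    and "(\<lambda>k. real (N k) / total_charge M (Z k)) \<longlonglongrightarrow> lam" and "lam > 0"
    and "\<And>\<alpha>. \<alpha> \<in> {1..M} \<Longrightarrow> (\<lambda>k. Z k \<alpha> / total_charge M (Z k)) \<longlonglongrightarrow> z \<alpha>"
    and "approximate_minimizers M R d N Z x"
  shows "(\<exists>!\<mu>. is_arg_min (energy M R lam z) (\<lambda>\<nu>. \<nu> \<in> M_plus (- Omega M R d)) \<mu>) \<and>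
    (\<forall>\<mu>. is_arg_min (energy M R lam z) (\<lambda>\<nu>. \<nu> \<in> M_plus (- Omega M R d)) \<mu> \<longrightarrow>
       weak_star_conv (- Omega M R d)
         (\<lambda>k. point_masses (- Omega M R d) (1 / total_charge M (Z k)) (N k) (x k)) \<mu> \<and>
       (\<lambda>k. V M R (N k) (Z k) (x k) / ereal ((total_charge M (Z k))\<^sup>2))
         \<longlonglongrightarrow> energy M R lam z \<mu>)"
proof -
  interpret coulomb_limit M R d lam z N Z x
    using assms by unfold_locales
  show ?thesis by (rule minimizer_limit)
qed

end
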